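(* Let $l\ge 2$ and $d_1,\ldots,d_l\ge 2$ be integers. The following statements hold: 1. There exists an $O_{\otimes}(\otimes_{i=1}^{l}\mathbb{R}^{d_{i}})$-equivariant retraction $r:\mathcal{B}_{\otimes}(\otimes_{i=1}^{l}\mathbb{R}^{d_{i}})\rightarrow\mathscr{L}_{\otimes}(\otimes_{i=1}^{l}\mathbb{R}^{d_{i}})$ such that $r(P)$ belongs to the $GL_{\otimes}(\otimes_{i=1}^{l}\mathbb{R}^{d_{i}})$-orbit of $P$ for every $P\in\mathcal{B}_{\otimes}(\otimes_{i=1}^{l}\mathbb{R}^{d_{i}})$. 2. $\mathcal{B}_{\otimes}(\otimes_{i=1}^{l}\mathbb{R}^{d_{i}})$ is homeomorphic to $\mathscr{L}_{\otimes}(\otimes_{i=1}^{l}\mathbb{R}^{d_{i}})\times\mathscr{E}_{\otimes}(\otimes_{i=1}^{l}\mathbb{R}^{d_{i}})$.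
   Context: $\otimes_{i=1}^l\mathbb{R}^{d_i}$ is a Euclidean space with the scalar product $\langle\cdot,\cdot\rangle_H$ determined by $\langle x^1\otimes\cdots\otimes x^l,y^1\otimes\cdots\otimes y^l\rangle_H=\prod_{i=1}^l\langle x^i,y^i\rangle$; its closed unit ball is $B_2^{d_1,\ldots,d_l}$. A $0$-symmetric convex body in a finite-dimensional Euclidean space $\mathbb{E}$ is a compact convex set $Q\subset\mathbb{E}$ with nonempty interior and $Q=-Q$. Its polar is $Q^\circ=\{y\in\mathbb{E}:\sup_{x\in Q}|\langle x,y\rangle|\le 1\}$ and its Minkowski functional is $g_Q(x)=\inf\{\lambda>0:\lambda^{-1}x\in Q\}$. For $0$-symmetric convex bodies $Q_i\subset\mathbb{R}^{d_i}$: $Q_1\otimes_\pi\cdots\otimes_\pi Q_l:=\mathrm{conv}\{x^1\otimes\cdots\otimes x^l: x^i\in Q_i\}$ and $Q_1\otimes_\epsilon\cdots\otimes_\epsilon Q_l:=(Q_1^\circ\otimes_\pi\cdots\otimes_\pi Q_l^\circ)^\circ$. A $0$-symmetric convex body $Q\subset\otimes_{i=1}^l\mathbb{R}^{d_i}$ is a tensorial body if there exist $0$-symmetric convex bodies $Q_i\subset\mathbb{R}^{d_i}$ with $Q_1\otimes_\pi\cdots\otimes_\pi Q_l\subseteq Q\subseteq Q_1\otimes_\epsilon\cdots\otimes_\epsilon Q_l$. The set of tensorial bodies is $\mathcal{B}_\otimes(\otimes_{i=1}^l\mathbb{R}^{d_i})$, with the topology of the Hausdorff distance induced by the norm of $\langle\cdot,\cdot\rangle_H$;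 its subsets carry the subspace topology. A decomposable vector is one of the form $x^1\otimes\cdots\otimes x^l$. $GL_\otimes(\otimes_{i=1}^l\mathbb{R}^{d_i})$ is the group of linear isomorphisms of $\otimes_{i=1}^l\mathbb{R}^{d_i}$ mapping decomposable vectors to decomposable vectors, acting on $\mathcal{B}_\otimes(\otimes_{i=1}^l\mathbb{R}^{d_i})$ by $TQ=\{Tu:u\in Q\}$. $O_\otimes(\otimes_{i=1}^l\mathbb{R}^{d_i})$ is the subgroup of its elements that are orthogonal for $\langle\cdot,\cdot\rangle_H$. A $G$-equivariant retraction is a continuous retraction $f$ with $f(gx)=gf(x)$ for all $g\in G$. An ellipsoid in $\otimes_{i=1}^l\mathbb{R}^{d_i}$ is a linear isomorphic image of $B_2^{d_1,\ldots,d_l}$; $\mathscr{E}_\otimes(\otimes_{i=1}^l\mathbb{R}^{d_i})$ is the set of ellipsoids in $\otimes_{i=1}^l\mathbb{R}^{d_i}$ that are tensorial bodies. $L\ddot{o}w(Q)$ is the L\"owner ellipsoid of $Q$, the unique ellipsoid of minimal volume containing $Q$. For a $0$-symmetric convex body $Q\subset\otimes_{i=1}^l\mathbb{R}^{d_i}$, put $a^j=e_1^{d_j}$ (first canonical basis vector of $\mathbb{R}^{d_j}$) for $j<l$, and $a^l=\lambda e_1^{d_l}$ with $\lambda=1/g_Q(e_1^{d_1}\otimes\cdots\otimes e_1^{d_l})$. Then $Q^i:=\{x\in\mathbb{R}^{d_i}: a^1\otimes\cdots\otimes a^{i-1}\otimes x\otimes a^{i+1}\otimes\cdots\otimes a^l\in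 Q\}$, $i=1,\ldots,l$. For a tensorial body $Q$, $l_\otimes(Q):=L\ddot{o}w(Q^1\otimes_\pi\cdots\otimes_\pi Q^l)$, and $\mathscr{L}_\otimes(\otimes_{i=1}^l\mathbb{R}^{d_i}):=\{Q\in\mathcal{B}_\otimes(\otimes_{i=1}^l\mathbb{R}^{d_i}): l_\otimes(Q)=B_2^{d_1,\ldots,d_l}\}$. *)

theory Defs
  imports "HOL-Analysis.Analysis" "HOL-Analysis.Finite_Function_Topology"
begin

text \<open>
  Conventions. Factors and coordinates are numbered from 0: the factors are the
  \<open>i < l\<close>, the coordinates of the \<open>i\<close>-th factor are the \<open>k < d i\<close>, and the first canonical basis
  vector has index 0.

  The space of dimension \<open>n\<close> is the subspace of the finitely supported real sequences that
  vanish from index \<open>n\<close> on, so that the dimensions \<open>d i\<close> can vary with \<open>i\<close>.  The library metric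
  on \<^typ>\<open>nat \<Rightarrow>\<^sub>0 real\<close> is the sum metric; on \<open>euclid n\<close> it induces the Euclidean topology, and
  only that topology is used below.
\<close>

definition euclid :: "nat \<Rightarrow> (nat \<Rightarrow>\<^sub>0 real) set" where
  "euclid n = {x. Poly_Mapping.keys x \<subseteq> {..<n}}"

definition dot :: "nat \<Rightarrow> (nat \<Rightarrow>\<^sub>0 real) \<Rightarrow> (nat \<Rightarrow>\<^sub>0 real) \<Rightarrow> real" where
  "dot n x y = (\<Sum>k<n. Poly_Mapping.lookup x k * Poly_Mapping.lookup y k)"

definition e1 :: "nat \<Rightarrow>\<^sub>0 real" where
  "e1 = Poly_Mapping.single 0 1"

definition factor_body :: "nat \<Rightarrow> (nat \<Rightarrow>\<^sub>0 real) set \<Rightarrow> bool" where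
  "factor_body n K \<longleftrightarrow> K \<subseteq> euclid n \<and> compact K \<and> convex K \<and>
     (top_of_set (euclid n)) interior_of K \<noteq> {} \<and> K = uminus ` K"

definition factor_polar :: "nat \<Rightarrow> (nat \<Rightarrow>\<^sub>0 real) set \<Rightarrow> (nat \<Rightarrow>\<^sub>0 real) set" where
  "factor_polar n K = {y \<in> euclid n. \<forall>x\<in>K. \<bar>dot n x y\<bar> \<le> 1}"


definition symmetric_body :: "'a::euclidean_space set \<Rightarrow> bool" where
  "symmetric_body Q \<longleftrightarrow> compact Q \<and> convex Q \<and> interior Q \<noteq> {} \<and> Q = uminus ` Q"

definition polar :: "'a::euclidean_space set \<Rightarrow> 'a set" where
  "polar Q = {y. \<forall>x\<in>Q. \<bar>x \<bullet> y\<bar> \<le> 1}"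

definition minkowski_functional :: "'a::real_vector set \<Rightarrow> 'a \<Rightarrow> real" where
  "minkowski_functional Q x = Inf {c. 0 < c \<and> inverse c *\<^sub>R x \<in> Q}"

definition ellipsoid :: "'a::euclidean_space set \<Rightarrow> bool" where
  "ellipsoid E \<longleftrightarrow> (\<exists>T::'a \<Rightarrow> 'a. linear T \<and> bij T \<and> E = T ` cball 0 1)"

definition lowner :: "'a::euclidean_space set \<Rightarrow> 'a set" where
  "lowner Q = (THE E. ellipsoid E \<and> Q \<subseteq> E \<and>
     (\<forall>E'. ellipsoid E' \<and> Q \<subseteq> E' \<longrightarrow> measure lebesgue E \<le> measure lebesgue E'))"


text \<open>
  The tensor product of the spaces \<open>euclid (d i)\<close>, \<open>i < l\<close>, is \<^typ>\<open>real ^ 't\<close> for any finite type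
  \<open>'t\<close> with \<open>\<Prod>i<l. d i\<close> elements; these are identified with the multi-indices
  by a fixed bijection. By \<open>inner_tensor\<close> below, the inner product of \<^typ>\<open>real ^ 't\<close> is the
  tensor scalar product, and \<^term>\<open>cball 0 1\<close> is its unit ball.
\<close>

definition multi_index :: "nat \<Rightarrow> (nat \<Rightarrow> nat) \<Rightarrow> 't::finite \<Rightarrow> nat \<Rightarrow> nat" where
  "multi_index l d = (SOME b. bij_betw b UNIV (\<Pi>\<^sub>E i\<in>{..<l}. {..<d i}))"

definition tensor :: "nat \<Rightarrow> (nat \<Rightarrow> nat) \<Rightarrow> (nat \<Rightarrow> nat \<Rightarrow>\<^sub>0 real) \<Rightarrow> real ^ 't::finite" where
  "tensor l d x = (\<chi> t. \<Prod>i<l. Poly_Mapping.lookup (x i) (multi_index l d t i))"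

lemma bij_multi_index:
  assumes "CARD('t::finite) = (\<Prod>i<l. d i)"
  shows "bij_betw (multi_index l d :: 't \<Rightarrow> nat \<Rightarrow> nat) UNIV (\<Pi>\<^sub>E i\<in>{..<l}. {..<d i})"
proof -
  have "\<exists>b. bij_betw b (UNIV :: 't set) (\<Pi>\<^sub>E i\<in>{..<l}. {..<d i})"
    by (rule finite_same_card_bij) (auto simp: assms card_PiE finite_PiE)
  then show ?thesis
    unfolding multi_index_def by (rule someI_ex)
qed

lemma inner_tensor:
  assumes "CARD('t::finite) = (\<Prod>i<l. d i)"
  shows "(tensor l d x :: real ^ 't) \<bullet> tensor l d y = (\<Prod>i<l. dot (d i) (x i) (y i))"
proof -
  let ?f = "\<lambda>i k. Poly_Mapping.lookup (x i) k * Poly_Mapping.lookup (y i) k"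
  have "(tensor l d x :: real ^ 't) \<bullet> tensor l d y = (\<Sum>t\<in>(UNIV::'t set). \<Prod>i<l. ?f i (multi_index l d t i))"
    by (simp add: inner_vec_def tensor_def prod.distrib)
  also have "\<dots> = (\<Sum>s\<in>(\<Pi>\<^sub>E i\<in>{..<l}. {..<d i}). \<Prod>i<l. ?f i (s i))"
    by (rule sum.reindex_bij_betw[OF bij_multi_index[OF assms]])
  also have "\<dots> = (\<Prod>i<l. dot (d i) (x i) (y i))"
    unfolding dot_def by (subst prod_sum_PiE) auto
  finally show ?thesis .
qed

definition decomposable :: "nat \<Rightarrow> (nat \<Rightarrow> nat) \<Rightarrow> (real ^ 't::finite) set" where
  "decomposable l d = {tensor l d x | x. \<forall>i<l. x i \<in> euclid (d i)}"

definition proj_tensor ::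
  "nat \<Rightarrow> (nat \<Rightarrow> nat) \<Rightarrow> (nat \<Rightarrow> (nat \<Rightarrow>\<^sub>0 real) set) \<Rightarrow> (real ^ 't::finite) set" where
  "proj_tensor l d K = convex hull {tensor l d x | x. \<forall>i<l. x i \<in> K i}"

definition inj_tensor ::
  "nat \<Rightarrow> (nat \<Rightarrow> nat) \<Rightarrow> (nat \<Rightarrow> (nat \<Rightarrow>\<^sub>0 real) set) \<Rightarrow> (real ^ 't::finite) set" where
  "inj_tensor l d K = polar (proj_tensor l d (\<lambda>i. factor_polar (d i) (K i)))"

definition tensorial_bodies :: "nat \<Rightarrow> (nat \<Rightarrow> nat) \<Rightarrow> (real ^ 't::finite) set set" where
  "tensorial_bodies l d = {Q. symmetric_body Q \<and>
     (\<exists>K. (\<forall>i<l. factor_body (d i) (K i)) \<and> proj_tensor l d K \<subseteq> Q \<and> Q \<subseteq> inj_tensor l d K)}"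

definition GL_tensor :: "nat \<Rightarrow> (nat \<Rightarrow> nat) \<Rightarrow> (real ^ 't::finite \<Rightarrow> real ^ 't) set" where
  "GL_tensor l d = {T. linear T \<and> bij T \<and> (\<forall>u\<in>decomposable l d. T u \<in> decomposable l d)}"

definition O_tensor :: "nat \<Rightarrow> (nat \<Rightarrow> nat) \<Rightarrow> (real ^ 't::finite \<Rightarrow> real ^ 't) set" where
  "O_tensor l d = {T \<in> GL_tensor l d. orthogonal_transformation T}"

definition base_vectors ::
  "nat \<Rightarrow> (nat \<Rightarrow> nat) \<Rightarrow> (real ^ 't::finite) set \<Rightarrow> nat \<Rightarrow> nat \<Rightarrow>\<^sub>0 real" where
  "base_vectors l d Q j =
     (if j = l - 1 then (1 / minkowski_functional Q (tensor l d (\<lambda>_. e1))) *\<^sub>R e1 else e1)"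

definition factor_section ::
  "nat \<Rightarrow> (nat \<Rightarrow> nat) \<Rightarrow> (real ^ 't::finite) set \<Rightarrow> nat \<Rightarrow> (nat \<Rightarrow>\<^sub>0 real) set" where
  "factor_section l d Q i = {x \<in> euclid (d i). tensor l d ((base_vectors l d Q)(i := x)) \<in> Q}"

definition tensor_lowner :: "nat \<Rightarrow> (nat \<Rightarrow> nat) \<Rightarrow> (real ^ 't::finite) set \<Rightarrow> (real ^ 't) set" where
  "tensor_lowner l d Q = lowner (proj_tensor l d (factor_section l d Q))"

definition lowner_position_bodies :: "nat \<Rightarrow> (nat \<Rightarrow> nat) \<Rightarrow> (real ^ 't::finite) set set" where
  "lowner_position_bodies l d = {Q \<in> tensorial_bodies l d. tensor_lowner l d Q = cball 0 1}"

definition tensorial_ellipsoids :: "nat \<Rightarrow> (nat \<Rightarrow> nat) \<Rightarrow> (real ^ 't::finite) set set" where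
  "tensorial_ellipsoids l d = {E \<in> tensorial_bodies l d. ellipsoid E}"


text \<open>
  The value 0 on unbounded or empty sets is a dummy; it makes the function nonnegative
  everywhere, as the locale \<^locale>\<open>Metric_space\<close> requires even outside the carrier.
\<close>

definition hausdorff_dist :: "'a::metric_space set \<Rightarrow> 'a set \<Rightarrow> real" where
  "hausdorff_dist A B =
     (if A \<noteq> {} \<and> B \<noteq> {} \<and> bounded A \<and> bounded B
      then Inf {e. 0 \<le> e \<and> (\<forall>a\<in>A. \<exists>b\<in>B. dist a b \<le> e) \<and> (\<forall>b\<in>B. \<exists>a\<in>A. dist a b \<le> e)}
      else 0)"

definition hausdorff_topology :: "'a::metric_space set topology" where
  "hausdorff_topology = Metric_space.mtopology {K. compact K \<and> K \<noteq> {}} hausdorff_dist"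

lemma hausdorff_dist_set:
  fixes A B :: "'a::metric_space set"
  assumes "A \<noteq> {}" "B \<noteq> {}" "bounded A" "bounded B"
  defines "S \<equiv> {e. 0 \<le> e \<and> (\<forall>a\<in>A. \<exists>b\<in>B. dist a b \<le> e) \<and> (\<forall>b\<in>B. \<exists>a\<in>A. dist a b \<le> e)}"
  shows "hausdorff_dist A B = Inf S" "S \<noteq> {}" "bdd_below S"
proof -
  show "hausdorff_dist A B = Inf S"
    using assms by (simp add: hausdorff_dist_def)
  show "bdd_below S"
    unfolding S_def by (rule bdd_belowI[of _ 0]) auto
  have "bounded (A \<union> B)" using assms by simp
  then obtain e where e: "\<forall>x\<in>A \<union> B. \<forall>y\<in>A \<union> B. dist x y \<le> e"
    unfolding bounded_two_points by blast
  moreover obtain a where "a \<in> A" using assms by blast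
  ultimately have "0 \<le> e" by (metis Un_iff dist_self)
  with e assms(1,2) have "e \<in> S" unfolding S_def by blast
  then show "S \<noteq> {}" by blast
qed

lemma hausdorff_dist_lessD:
  fixes A B :: "'a::metric_space set"
  assumes "A \<noteq> {}" "B \<noteq> {}" "bounded A" "bounded B" "hausdorff_dist A B < r"
  shows "\<exists>e<r. 0 \<le> e \<and> (\<forall>a\<in>A. \<exists>b\<in>B. dist a b \<le> e) \<and> (\<forall>b\<in>B. \<exists>a\<in>A. dist a b \<le> e)"
  using hausdorff_dist_set[OF assms(1-4)] assms(5) by (auto simp: cInf_less_iff)

lemma Metric_space_hausdorff:
  "Metric_space {K :: 'a::metric_space set. compact K \<and> K \<noteq> {}} hausdorff_dist"
proof
  fix A B C :: "'a set"
  show nonneg: "0 \<le> hausdorff_dist A B" for A B :: "'a set"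
  proof (cases "A \<noteq> {} \<and> B \<noteq> {} \<and> bounded A \<and> bounded B")
    case True
    then show ?thesis
      using hausdorff_dist_set[of A B] by (auto intro: cInf_greatest)
  qed (auto simp: hausdorff_dist_def)
  show "hausdorff_dist A B = hausdorff_dist B A"
    unfolding hausdorff_dist_def by (simp add: dist_commute conj_ac)
  have upper: "hausdorff_dist A B \<le> e"
    if "0 \<le> e" "\<forall>a\<in>A. \<exists>b\<in>B. dist a b \<le> e" "\<forall>b\<in>B. \<exists>a\<in>A. dist a b \<le> e" for A B :: "'a set" and e
  proof (cases "A \<noteq> {} \<and> B \<noteq> {} \<and> bounded A \<and> bounded B")
    case True
    then show ?thesis
      using hausdorff_dist_set[of A B] that by (auto intro: cInf_lower)
  next
    case False
    then have "hausdorff_dist A B = 0" unfolding hausdorff_dist_def by auto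
    then show ?thesis using that by simp
  qed
  {
    assume "A \<in> {K. compact K \<and> K \<noteq> {}}" "B \<in> {K. compact K \<and> K \<noteq> {}}"
    then have AB: "A \<noteq> {}" "B \<noteq> {}" "compact A" "compact B" by auto
    have sub: "A \<subseteq> B" if "hausdorff_dist A B = 0" and AB: "A \<noteq> {}" "B \<noteq> {}" "compact A" "compact B"
      for A B :: "'a set"
    proof
      fix a assume "a \<in> A"
      have "\<exists>b\<in>B. dist b a < r" if "r > 0" for r
        using hausdorff_dist_lessD[of A B r] AB \<open>hausdorff_dist A B = 0\<close> \<open>r > 0\<close> \<open>a \<in> A\<close>
        by (force simp: compact_imp_bounded dist_commute)
      then have "a \<in> closure B" unfolding closure_approachable by blast
      then show "a \<in> B" using AB by (simp add: compact_imp_closed)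
    qed
    have com: "hausdorff_dist B A = hausdorff_dist A B"
      unfolding hausdorff_dist_def by (simp add: dist_commute conj_ac)
    have "hausdorff_dist A A \<le> 0"
      by (rule upper) auto
    then show "(hausdorff_dist A B = 0) = (A = B)"
      using sub[of A B] sub[of B A] AB com nonneg[of A A] by auto
  }
  assume "A \<in> {K. compact K \<and> K \<noteq> {}}" "B \<in> {K. compact K \<and> K \<noteq> {}}" "C \<in> {K. compact K \<and> K \<noteq> {}}"
  then have *: "A \<noteq> {}" "B \<noteq> {}" "C \<noteq> {}" "bounded A" "bounded B" "bounded C"
    by (auto simp: compact_imp_bounded)
  show "hausdorff_dist A C \<le> hausdorff_dist A B + hausdorff_dist B C"
  proof (rule field_le_epsilon)
    fix r :: real assume "r > 0"
    obtain e where e: "e < hausdorff_dist A B + r/2" "0 \<le> e"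
      "\<forall>a\<in>A. \<exists>b\<in>B. dist a b \<le> e" "\<forall>b\<in>B. \<exists>a\<in>A. dist a b \<le> e"
      using hausdorff_dist_lessD[of A B "hausdorff_dist A B + r/2"] * \<open>r > 0\<close> by auto
    obtain f where f: "f < hausdorff_dist B C + r/2" "0 \<le> f"
      "\<forall>a\<in>B. \<exists>b\<in>C. dist a b \<le> f" "\<forall>b\<in>C. \<exists>a\<in>B. dist a b \<le> f"
      using hausdorff_dist_lessD[of B C "hausdorff_dist B C + r/2"] * \<open>r > 0\<close> by auto
    have "hausdorff_dist A C \<le> e + f"
    proof (rule upper)
      show "\<forall>a\<in>A. \<exists>c\<in>C. dist a c \<le> e + f"
        by (metis e(3) f(3) dist_triangle add_mono order_trans)
      show "\<forall>c\<in>C. \<exists>a\<in>A. dist a c \<le> e + f"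
        by (metis e(4) f(4) dist_triangle add_mono order_trans)
    qed (use e f in auto)
    then show "hausdorff_dist A C \<le> hausdorff_dist A B + hausdorff_dist B C + r"
      using e(1) f(1) by simp
  qed
qed

end

(*
A tensorial body Q with factors K_i has gauge product of the gauges of the K_i on decomposable
vectors, so Q^1 (x)_pi ... (x)_pi Q^l is the convex hull of the decomposable vectors in Q, and
l_(x)(Q) is the Loewner ellipsoid of (Q Int decomposable).  Each K_i has a John position: a
positive definite a_i such that a_i^-1 K_i lies in the unit ball and the identity is a combination
of the x x^T with x in a_i^-1 K_i.  Products of such decompositions decompose the identity of the
tensor space, so l_(x)(Q) = T B with T the tensor product of the a_i, which is positive definite.
Put r(Q) = T^-1 Q.  Since T is the only positive definite operator mapping B onto l_(x)(Q), the map
r commutes with the orthogonal maps that preserve decomposable vectors.  A tensorial ellipsoid E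
equals l_(x)(E): after applying T^-1, the John decomposition bounds the Hilbert-Schmidt norm of
S^-1, and the bound by the injective norm that of S, where E = T S B, which forces S = 1.  Hence
Q |-> (r(Q), l_(x)(Q)) has the inverse (P, T B) |-> T P.  Continuity is checked for the relation
"P <= s Q and Q <= s P", whose neighbourhoods generate the Hausdorff topology on symmetric bodies
and which linear isomorphisms preserve.
*)
theory Submission
  imports Defs
begin

section \<open>Positive definite operators\<close>

text \<open>An orthogonal map preserving decomposable vectors may permute factors of equal
  dimension, and the sections \<open>factor_section\<close> depend on the chosen base vectors, so
  nothing can be made equivariant factor by factor. The proof therefore works only with data free of
  such choices: the set of decomposable vectors, and the unique positive definite operator producing
  a given ellipsoid. Membership in \<open>GL_tensor\<close> asks only that decomposable vectors go
  into decomposable vectors; for orthogonal maps, equality of the two sets comes from compactness of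
  the decomposable unit vectors.

  John positions are found by maximizing a determinant over second-moment matrices rather than by
  minimizing a volume, because the maximizer carries the decomposition of the identity with it. The
  decomposition in turn certifies minimality, so existence of the Loewner ellipsoid needs no
  separate compactness argument.\<close>

definition symmetric_op :: "('a::euclidean_space \<Rightarrow> 'a) \<Rightarrow> bool" where
  "symmetric_op f \<longleftrightarrow> linear f \<and> (\<forall>x y. f x \<bullet> y = x \<bullet> f y)"

definition posdef :: "('a::euclidean_space \<Rightarrow> 'a) \<Rightarrow> bool" where
  "posdef f \<longleftrightarrow> symmetric_op f \<and> (\<forall>x. x \<noteq> 0 \<longrightarrow> 0 < f x \<bullet> x)"

text \<open>The eigenvalues are a parameter, so that volumes and Hilbert-Schmidt norms become
  products and sums of \<open>m\<close> over \<open>B\<close>.\<close>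

definition eigenbasis :: "('a::euclidean_space \<Rightarrow> 'a) \<Rightarrow> 'a set \<Rightarrow> ('a \<Rightarrow> real) \<Rightarrow> bool" where
  "eigenbasis f B m \<longleftrightarrow> finite B \<and> card B = DIM('a) \<and> pairwise orthogonal B \<and> (\<forall>b\<in>B. norm b = 1) \<and>
     span B = UNIV \<and> (\<forall>b\<in>B. f b = m b *\<^sub>R b)"

section \<open>Spectral theorem for symmetric operators\<close>

lemma symmetric_opD: "symmetric_op f \<Longrightarrow> linear f" "symmetric_op f \<Longrightarrow> f x \<bullet> y = x \<bullet> f y"
  by (auto simp: symmetric_op_def)

lemma posdefD:
  "posdef f \<Longrightarrow> symmetric_op f" "posdef f \<Longrightarrow> linear f"
  "posdef f \<Longrightarrow> x \<noteq> 0 \<Longrightarrow> 0 < f x \<bullet> x" "posdef f \<Longrightarrow> f x \<bullet> y = x \<bullet> f y"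
  by (auto simp: posdef_def symmetric_op_def)

text \<open>First-order condition at a minimum, used to recognize a maximizer of the Rayleigh
  quotient as an eigenvector.\<close>

lemma nonneg_quadratic_linear_term:
  fixes a b :: real
  assumes "\<And>t. 0 \<le> 2 * t * a + t\<^sup>2 * b" and "0 \<le> b"
  shows "a = 0"
proof (rule ccontr)
  assume "a \<noteq> 0"
  have "2 * (- a / (b+1)) * a + (- a / (b+1))\<^sup>2 * b = a\<^sup>2 * (- b - 2) / (b+1)\<^sup>2"
    using assms(2) by (simp add: divide_simps power2_eq_square) (simp add: algebra_simps)
  also have "\<dots> < 0"
    using \<open>a \<noteq> 0\<close> assms(2) by (intro divide_neg_pos mult_pos_neg) auto
  finally show False using assms(1)[of "- a / (b+1)"] by simp
qed

text \<open>The form \<open>g\<close> below is nonnegative on \<open>V\<close> and vanishes at the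
  maximizer \<open>u\<close> of the Rayleigh quotient, so its linear term at \<open>u\<close>
  vanishes on \<open>V\<close>.\<close>

lemma eigenvector_in_invariant_subspace:
  fixes f :: "'a::euclidean_space \<Rightarrow> 'a"
  assumes f: "symmetric_op f" and V: "subspace V" "f ` V \<subseteq> V" "V \<noteq> {0}"
  obtains u m where "u \<in> V" "norm u = 1" "f u = m *\<^sub>R u"
proof -
  have lf: "linear f" using f by (rule symmetric_opD)
  have cf: "continuous_on S f" for S using lf by (simp add: linear_continuous_on linear_conv_bounded_linear)
  let ?S = "sphere 0 1 \<inter> V"
  have "compact ?S" using V(1) by (simp add: closed_subspace compact_Int_closed)
  moreover obtain v where "v \<in> V" "v \<noteq> 0" using V subspace_0 by blast
  then have "(1 / norm v) *\<^sub>R v \<in> ?S" using V(1) by (auto simp: subspace_scale)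
  then have "?S \<noteq> {}" by blast
  moreover have "continuous_on ?S (\<lambda>x. f x \<bullet> x)" by (intro continuous_intros cf)
  ultimately obtain u where u: "u \<in> ?S" and max: "\<And>y. y \<in> ?S \<Longrightarrow> f y \<bullet> y \<le> f u \<bullet> u"
    using continuous_attains_sup by (metis (no_types, lifting))
  have uu: "u \<bullet> u = 1" using u by (simp add: dot_square_norm)
  define m where "m = f u \<bullet> u"
  define g where "g w = m * (w \<bullet> w) - f w \<bullet> w" for w
  have g0: "0 \<le> g w" if "w \<in> V" for w
  proof (cases "w = 0")
    case False
    let ?w = "(1 / norm w) *\<^sub>R w"
    have "?w \<in> ?S" using that False V(1) by (auto simp: subspace_scale)
    then have "f ?w \<bullet> ?w \<le> m" using max m_def by blast
    then have "(f w \<bullet> w) / (norm w)\<^sup>2 \<le> m"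
      by (simp add: linear_scale[OF lf] power2_eq_square)
    then show ?thesis using False by (simp add: g_def divide_simps dot_square_norm)
  qed (simp add: g_def linear_0[OF lf])
  \<comment> \<open>This vector is orthogonal to \<open>V\<close>; by invariance it also lies in
    \<open>V\<close>, hence it is zero.\<close>
  have "(m *\<^sub>R u - f u) \<bullet> w = 0" if "w \<in> V" for w
  proof (rule nonneg_quadratic_linear_term)
    fix t
    have "0 \<le> g (u + t *\<^sub>R w)" using u that V(1) by (intro g0) (auto simp: subspace_add subspace_scale)
    also have "f w \<bullet> u = f u \<bullet> w" using symmetric_opD(2)[OF f] by (metis inner_commute)
    then have "g (u + t *\<^sub>R w) = 2 * t * ((m *\<^sub>R u - f u) \<bullet> w) + t\<^sup>2 * g w"
      using uu by (simp add: g_def m_def linear_add[OF lf] linear_scale[OF lf] inner_simps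
          inner_commute[of w u] power2_eq_square) (simp add: algebra_simps)
    finally show "0 \<le> 2 * t * ((m *\<^sub>R u - f u) \<bullet> w) + t\<^sup>2 * g w" .
  qed (rule g0[OF that])
  moreover have "m *\<^sub>R u - f u \<in> V" using u V by (auto intro!: subspace_diff subspace_scale)
  ultimately have "m *\<^sub>R u - f u = 0" by (metis inner_eq_zero_iff)
  then show thesis using that[of u m] u by simp
qed

text \<open>Induction on the dimension: by symmetry of \<open>f\<close>, the orthogonal complement
  in \<open>V\<close> of a unit eigenvector is again invariant.\<close>

lemma eigenbasis_invariant_subspace:
  fixes f :: "'a::euclidean_space \<Rightarrow> 'a"
  assumes f: "symmetric_op f" and V: "subspace V" "f ` V \<subseteq> V"
  shows "\<exists>B\<subseteq>V. pairwise orthogonal B \<and> (\<forall>b\<in>B. norm b = 1) \<and> span B = V \<and> (\<forall>b\<in>B. \<exists>m. f b = m *\<^sub>R b)"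
  using V
proof (induction "dim V" arbitrary: V rule: less_induct)
  case less
  show ?case
  proof (cases "V = {0}")
    case True
    then show ?thesis by (intro exI[of _ "{}"]) auto
  next
    case False
    obtain u m where u: "u \<in> V" "norm u = 1" "f u = m *\<^sub>R u"
      using eigenvector_in_invariant_subspace[OF f less.prems False] by blast
    define W where "W = V \<inter> {x. u \<bullet> x = 0}"
    have W: "subspace W" unfolding W_def using less.prems by (intro subspace_inter subspace_hyperplane)
    have "f ` W \<subseteq> W"
      using less.prems symmetric_opD(2)[OF f, symmetric] u by (auto simp: W_def)
    moreover have "dim W < dim V"
    proof (rule dim_psubset)
      have "u \<notin> W" using u by (auto simp: W_def dot_square_norm)
      then show "span W \<subset> span V"
        using W less.prems u by (metis W_def inf.cobounded1 span_eq_iff psubsetI)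
    qed
    ultimately obtain B where B: "B \<subseteq> W" "pairwise orthogonal B" "\<forall>b\<in>B. norm b = 1" "span B = W"
      "\<forall>b\<in>B. \<exists>m. f b = m *\<^sub>R b"
      using less.hyps W by blast
    have "span (insert u B) = V"
    proof
      show "span (insert u B) \<subseteq> V" using B u W_def less.prems by (intro span_minimal) auto
      show "V \<subseteq> span (insert u B)"
      proof
        fix x assume "x \<in> V"
        then have "x - (x \<bullet> u) *\<^sub>R u \<in> W"
          using u less.prems(1) by (auto simp: W_def subspace_diff subspace_scale inner_simps dot_square_norm inner_commute)
        then have "x - (x \<bullet> u) *\<^sub>R u \<in> span B" using B by simp
        then show "x \<in> span (insert u B)" by (auto simp: span_insert)
      qed
    qed
    moreover have "pairwise orthogonal (insert u B)"
      using B(1,2) by (auto simp: pairwise_insert orthogonal_def W_def inner_commute)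
    ultimately show ?thesis
      using B u W_def by (intro exI[of _ "insert u B"]) auto
  qed
qed

theorem symmetric_op_eigenbasis:
  fixes f :: "'a::euclidean_space \<Rightarrow> 'a"
  assumes "symmetric_op f"
  obtains B m where "eigenbasis f B m"
proof -
  obtain B where B: "pairwise orthogonal B" "\<forall>b\<in>B. norm b = 1" "span B = UNIV" "\<forall>b\<in>B. \<exists>m. f b = m *\<^sub>R b"
    using eigenbasis_invariant_subspace[OF assms, of UNIV] by auto
  then have ind: "independent B" by (intro pairwise_orthogonal_independent) auto
  then have "finite B" by (rule independent_imp_finite)
  moreover have "card B = DIM('a)"
    using dim_eq_card[of B UNIV] ind B(3) by (simp add: dim_UNIV)
  moreover obtain m where "\<forall>b\<in>B. f b = m b *\<^sub>R b" using B(4) by metis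
  ultimately show thesis using that B unfolding eigenbasis_def by blast
qed

context
  fixes f :: "'a::euclidean_space \<Rightarrow> 'a" and B m
  assumes B: "eigenbasis f B m"
begin

lemma eigenbasis_expand: "(\<Sum>b\<in>B. (x \<bullet> b) *\<^sub>R b) = x"
  using B unfolding eigenbasis_def by (intro orthonormal_basis_expand) auto

lemma eigenbasis_inner: "(\<Sum>b\<in>B. (x \<bullet> b) * (y \<bullet> b)) = x \<bullet> y"
proof -
  have "(\<Sum>b\<in>B. (x \<bullet> b) * (y \<bullet> b)) = x \<bullet> (\<Sum>b\<in>B. (y \<bullet> b) *\<^sub>R b)"
    by (simp add: inner_sum_right mult.commute)
  then show ?thesis by (simp only: eigenbasis_expand)
qed

lemma eigenbasis_norm: "(\<Sum>b\<in>B. (x \<bullet> b)\<^sup>2) = (norm x)\<^sup>2"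
  using eigenbasis_inner[of x x] by (simp add: power2_eq_square dot_square_norm)

lemma eigenbasis_orthonormal: "a \<in> B \<Longrightarrow> b \<in> B \<Longrightarrow> a \<bullet> b = (if a = b then 1 else 0)"
  using B unfolding eigenbasis_def pairwise_def orthogonal_def by (auto simp: dot_square_norm)

end

lemma eigenbasis_apply:
  assumes "symmetric_op f" "eigenbasis f B m"
  shows "f x = (\<Sum>b\<in>B. (m b * (x \<bullet> b)) *\<^sub>R b)" "b \<in> B \<Longrightarrow> f x \<bullet> b = m b * (x \<bullet> b)"
proof -
  have *: "f x \<bullet> b = m b * (x \<bullet> b)" if "b \<in> B" for b
    using assms that by (simp add: symmetric_opD(2)) (simp add: eigenbasis_def)
  then show "b \<in> B \<Longrightarrow> f x \<bullet> b = m b * (x \<bullet> b)" .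
  have "(\<Sum>b\<in>B. (f x \<bullet> b) *\<^sub>R b) = (\<Sum>b\<in>B. (m b * (x \<bullet> b)) *\<^sub>R b)" by (simp add: *)
  then show "f x = (\<Sum>b\<in>B. (m b * (x \<bullet> b)) *\<^sub>R b)" by (simp only: eigenbasis_expand[OF assms(2)])
qed

lemma symmetric_op_norm_le:
  assumes f: "symmetric_op f" "eigenbasis f B m" and c: "\<And>b. b \<in> B \<Longrightarrow> \<bar>m b\<bar> \<le> c" "0 \<le> c"
  shows "norm (f x) \<le> c * norm x"
proof -
  have "(norm (f x))\<^sup>2 = (\<Sum>b\<in>B. (m b)\<^sup>2 * (x \<bullet> b)\<^sup>2)"
    by (subst eigenbasis_norm[OF f(2), symmetric]) (simp add: eigenbasis_apply(2)[OF f] power_mult_distrib)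
  also have "\<dots> \<le> (\<Sum>b\<in>B. c\<^sup>2 * (x \<bullet> b)\<^sup>2)"
  proof (intro sum_mono mult_right_mono)
    fix b assume "b \<in> B"
    then show "(m b)\<^sup>2 \<le> c\<^sup>2" using c abs_le_square_iff[of "m b" c] by auto
  qed auto
  also have "\<dots> = (c * norm x)\<^sup>2"
    by (simp only: sum_distrib_left[symmetric] eigenbasis_norm[OF f(2)] power_mult_distrib)
  finally show ?thesis by (rule power2_le_imp_le) (use c(2) in simp)
qed

section \<open>Positive definite operators, square roots and polar decomposition\<close>

lemma posdef_bij: "posdef f \<Longrightarrow> bij f"
proof -
  assume f: "posdef f"
  then have "inj f"
    using linear_injective_0[OF posdefD(2)[OF f]] posdefD(3)[OF f] by (metis inner_zero_left order_less_irrefl)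
  then show "bij f" using linear_injective_imp_surjective[OF posdefD(2)[OF f]] by (simp add: bij_def)
qed

lemma posdef_id: "posdef (\<lambda>x. x)"
  by (simp add: posdef_def symmetric_op_def linear_id[unfolded id_def])

lemma posdef_inv: assumes "posdef f" shows "posdef (inv f)"
proof -
  have b: "bij f" by (rule posdef_bij[OF assms])
  then have fi: "f (inv f x) = x" for x by (simp add: bij_is_surj surj_f_inv_f)
  have "linear (inv f)" using b assms by (simp add: bij_is_inj inj_linear_imp_inv_linear posdefD)
  moreover have "inv f x \<bullet> y = x \<bullet> inv f y" for x y
    using posdefD(4)[OF assms, of "inv f x" "inv f y"] fi by metis
  moreover have "0 < inv f x \<bullet> x" if "x \<noteq> 0" for x
    using posdefD(3)[OF assms, of "inv f x"] fi[of x] that linear_0[OF posdefD(2)[OF assms]]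
    by (metis inner_commute)
  ultimately show ?thesis by (simp add: posdef_def symmetric_op_def)
qed

lemma posdef_eigenvalue_pos: "posdef f \<Longrightarrow> eigenbasis f B m \<Longrightarrow> b \<in> B \<Longrightarrow> 0 < m b"
  using posdefD(3)[of f b] by (force simp: eigenbasis_def dot_square_norm)

lemma posdef_lower_bound:
  fixes f :: "'a::euclidean_space \<Rightarrow> 'a"
  assumes "posdef f"
  obtains c where "0 < c" "\<And>x. c * (norm x)\<^sup>2 \<le> f x \<bullet> x"
proof -
  obtain B m where B: "eigenbasis f B m" using symmetric_op_eigenbasis posdefD(1)[OF assms] by blast
  have fin: "finite B" "B \<noteq> {}" using B unfolding eigenbasis_def by (auto simp: card_gt_0_iff[symmetric])
  let ?c = "Min (m ` B)"
  have "?c * (norm x)\<^sup>2 \<le> f x \<bullet> x" for x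
  proof -
    have "?c * (norm x)\<^sup>2 = (\<Sum>b\<in>B. ?c * (x \<bullet> b)\<^sup>2)"
      by (simp only: sum_distrib_left[symmetric] eigenbasis_norm[OF B])
    also have "\<dots> \<le> (\<Sum>b\<in>B. m b * (x \<bullet> b)\<^sup>2)" using fin by (intro sum_mono mult_right_mono) auto
    also have "\<dots> = (\<Sum>b\<in>B. (f x \<bullet> b) * (x \<bullet> b))"
      by (simp add: eigenbasis_apply(2)[OF posdefD(1)[OF assms] B] power2_eq_square mult.assoc)
    also have "\<dots> = f x \<bullet> x" by (rule eigenbasis_inner[OF B])
    finally show ?thesis .
  qed
  moreover have "0 < ?c" using fin posdef_eigenvalue_pos[OF assms B] by auto
  ultimately show thesis using that by blast
qed

text \<open>Quantitative uniqueness of a positive root: if b is a unit eigenvector of S - R with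
  eigenvalue \<mu>, then |S b|^2 - |R b|^2 = \<mu> (S b . b + R b . b), and the last factor is at
  least c. The case k = 0 is uniqueness, small k is continuity.\<close>

lemma posdef_diff_norm_le:
  assumes R: "posdef R" and S: "posdef S" and c: "0 < c" "\<And>x. c * (norm x)\<^sup>2 \<le> R x \<bullet> x"
    and k: "\<And>x. \<bar>(norm (S x))\<^sup>2 - (norm (R x))\<^sup>2\<bar> \<le> k * (norm x)\<^sup>2"
  shows "norm (S x - R x) \<le> k / c * norm x"
proof -
  let ?f = "\<lambda>x. S x - R x"
  have f: "symmetric_op ?f"
    using R S by (auto simp: symmetric_op_def posdefD inner_simps intro: linear_compose_sub)
  obtain B m where B: "eigenbasis ?f B m" using symmetric_op_eigenbasis[OF f] by blast
  have k0: "0 \<le> k"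
  proof -
    obtain i :: 'a where "i \<in> Basis" using nonempty_Basis by blast
    then show ?thesis using k[of i] by simp
  qed
  have "\<bar>m b\<bar> \<le> k / c" if b: "b \<in> B" for b
  proof -
    have nb: "norm b = 1" "S b = R b + m b *\<^sub>R b" using B b by (auto simp: eigenbasis_def algebra_simps)
    have "(norm (S b))\<^sup>2 - (norm (R b))\<^sup>2 = (S b - R b) \<bullet> (S b + R b)"
      by (simp add: inner_simps dot_square_norm inner_commute)
    also have "\<dots> = m b * (S b \<bullet> b + R b \<bullet> b)" by (simp add: nb(2) inner_simps algebra_simps inner_commute)
    finally have "\<bar>m b\<bar> * \<bar>S b \<bullet> b + R b \<bullet> b\<bar> \<le> k" using k[of b] nb(1) by (simp add: abs_mult)
    moreover have "c \<le> \<bar>S b \<bullet> b + R b \<bullet> b\<bar>"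
      using c(2)[of b] posdefD(3)[OF S, of b] nb(1) by force
    ultimately have "\<bar>m b\<bar> * c \<le> k" by (meson abs_ge_zero mult_left_mono order_trans)
    then show ?thesis using c(1) by (simp add: field_simps)
  qed
  then show ?thesis using symmetric_op_norm_le[OF f B] k0 c(1) by force
qed

lemma posdef_unique:
  assumes "posdef R" "posdef S" "\<And>x. norm (R x) = norm (S x)"
  shows "R = S"
proof
  fix x
  obtain c where c: "0 < c" "\<And>x. c * (norm x)\<^sup>2 \<le> R x \<bullet> x" using posdef_lower_bound[OF assms(1)] by blast
  have "norm (S x - R x) \<le> 0 / c * norm x"
    by (rule posdef_diff_norm_le[OF assms(1,2) c]) (simp add: assms(3))
  then show "R x = S x" by simp
qed

lemma posdef_sqrt:
  assumes f: "posdef f"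
  obtains g where "posdef g" "\<And>x. g (g x) = f x"
proof -
  have sf: "symmetric_op f" using f by (rule posdefD)
  obtain B m where B: "eigenbasis f B m" using symmetric_op_eigenbasis[OF sf] by blast
  define g where "g x = (\<Sum>b\<in>B. (sqrt (m b) * (x \<bullet> b)) *\<^sub>R b)" for x
  have fin: "finite B" using B by (simp add: eigenbasis_def)
  have gb: "g x \<bullet> b = sqrt (m b) * (x \<bullet> b)" if "b \<in> B" for b x
  proof -
    have "g x \<bullet> b = (\<Sum>a\<in>B. sqrt (m a) * (x \<bullet> a) * (a \<bullet> b))" by (simp add: g_def inner_sum_left)
    also have "\<dots> = (\<Sum>a\<in>B. if a = b then sqrt (m b) * (x \<bullet> b) else 0)"
      using that by (intro sum.cong) (auto simp: eigenbasis_orthonormal[OF B])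
    also have "\<dots> = sqrt (m b) * (x \<bullet> b)" using that fin by simp
    finally show ?thesis .
  qed
  have "linear g"
    unfolding g_def
    by (intro linear_compose_sum ballI linearI) (simp_all add: inner_left_distrib distrib_left scaleR_add_left mult.left_commute)
  moreover have "g x \<bullet> y = x \<bullet> g y" for x y
  proof -
    have "(\<Sum>b\<in>B. (g x \<bullet> b) * (y \<bullet> b)) = (\<Sum>b\<in>B. (x \<bullet> b) * (g y \<bullet> b))"
      using gb by (intro sum.cong) (auto simp: algebra_simps)
    then show ?thesis by (simp only: eigenbasis_inner[OF B])
  qed
  moreover have "0 < g x \<bullet> x" if "x \<noteq> 0" for x
  proof -
    have "(\<Sum>b\<in>B. (g x \<bullet> b) * (x \<bullet> b)) = (\<Sum>b\<in>B. sqrt (m b) * (x \<bullet> b)\<^sup>2)"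
      using gb by (intro sum.cong) (auto simp: power2_eq_square)
    then have *: "g x \<bullet> x = (\<Sum>b\<in>B. sqrt (m b) * (x \<bullet> b)\<^sup>2)"
      by (simp only: eigenbasis_inner[OF B])
    have "\<exists>b\<in>B. x \<bullet> b \<noteq> 0"
    proof (rule ccontr)
      assume "\<not> ?thesis"
      then have "(\<Sum>b\<in>B. (x \<bullet> b) *\<^sub>R b) = 0" by (intro sum.neutral) auto
      then show False using that by (simp only: eigenbasis_expand[OF B])
    qed
    then obtain b where "b \<in> B" "x \<bullet> b \<noteq> 0" by blast
    then show ?thesis unfolding *
      using posdef_eigenvalue_pos[OF f B] fin by (intro sum_pos2[of _ b]) (auto simp: less_imp_le)
  qed
  moreover have "g (g x) = f x" for x
  proof -
    have "g (g x) = (\<Sum>b\<in>B. (sqrt (m b) * (g x \<bullet> b)) *\<^sub>R b)" by (rule g_def)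
    also have "\<dots> = (\<Sum>b\<in>B. (m b * (x \<bullet> b)) *\<^sub>R b)"
      using gb posdef_eigenvalue_pos[OF f B]
      by (intro sum.cong refl) (simp add: mult.assoc[symmetric] less_imp_le)
    also have "\<dots> = f x" by (rule eigenbasis_apply(1)[OF sf B, symmetric])
    finally show ?thesis .
  qed
  ultimately show thesis using that[of g] by (simp add: posdef_def symmetric_op_def)
qed

lemma linear_inv_bij: "linear f \<Longrightarrow> bij f \<Longrightarrow> linear (inv f)" for f :: "'a::euclidean_space \<Rightarrow> 'a"
  by (simp add: bij_is_inj inj_linear_imp_inv_linear)

text \<open>\<open>R\<close> is the square root of \<open>T\<close> composed with its adjoint. The
  remaining factor \<open>inv R\<close> after \<open>T\<close> is orthogonal and disappears on the
  unit ball.\<close>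

lemma polar_decomposition:
  fixes T :: "'a::euclidean_space \<Rightarrow> 'a"
  assumes T: "linear T" "bij T"
  obtains R where "posdef R" "T ` cball 0 1 = R ` cball 0 1"
proof -
  have adj: "T x \<bullet> y = x \<bullet> adjoint T y" for x y using adjoint_works[OF T(1)] by (simp add: inner_commute)
  have la: "linear (adjoint T)" by (rule adjoint_linear[OF T(1)])
  have a0: "adjoint T x \<noteq> 0" if "x \<noteq> 0" for x
  proof
    assume "adjoint T x = 0"
    then have "T y \<bullet> x = 0" for y by (simp add: adj)
    moreover obtain y where "T y = x" using T(2) by (metis bij_pointE)
    ultimately have "x \<bullet> x = 0" by blast
    then show False using that by simp
  qed
  have adj': "adjoint T x \<bullet> y = x \<bullet> T y" for x y by (metis adj inner_commute)
  have "linear (\<lambda>x. T (adjoint T x))" using linear_compose[OF la T(1)] by (simp add: o_def)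
  moreover have "T (adjoint T x) \<bullet> y = x \<bullet> T (adjoint T y)" for x y by (metis adj adj')
  moreover have "0 < T (adjoint T x) \<bullet> x" if "x \<noteq> 0" for x using a0[OF that] by (subst adj) simp
  ultimately have "posdef (\<lambda>x. T (adjoint T x))"
    by (simp add: posdef_def symmetric_op_def)
  then obtain R where R: "posdef R" "\<And>x. R (R x) = T (adjoint T x)" using posdef_sqrt by metis
  have nR: "norm (R x) = norm (adjoint T x)" for x
  proof -
    have "R x \<bullet> R x = x \<bullet> T (adjoint T x)" unfolding posdefD(4)[OF R(1)] R(2) ..
    also have "\<dots> = adjoint T x \<bullet> adjoint T x" by (rule adj'[symmetric])
    finally show ?thesis by (simp add: norm_eq)
  qed
  have bR: "bij R" by (rule posdef_bij[OF R(1)])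
  have iR: "posdef (inv R)" by (rule posdef_inv[OF R(1)])
  have RiR: "R (inv R x) = x" for x using bR by (simp add: bij_is_surj surj_f_inv_f)
  have iRR: "inv R (R x) = x" for x using bR by (simp add: bij_is_inj)
  let ?U = "\<lambda>x. inv R (T x)"
  have lU: "linear ?U" using linear_compose[OF T(1) posdefD(2)[OF iR]] by (simp add: o_def)
  \<comment> \<open>\<open>?V\<close> is the adjoint of \<open>?U\<close>. It is an isometry because
    \<open>R x\<close> and \<open>adjoint T x\<close> have equal norms; being surjective and a right
    inverse of \<open>?U\<close>, it makes \<open>?U\<close> an isometry too.\<close>
  let ?V = "\<lambda>x. adjoint T (inv R x)"
  have V: "norm (?V x) = norm x" for x using nR[of "inv R x"] RiR by simp
  have "orthogonal_transformation ?V"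
    using V linear_compose[OF posdefD(2)[OF iR] la] by (simp add: orthogonal_transformation o_def)
  then have sV: "surj ?V" by (rule orthogonal_transformation_surj)
  have UV: "?U (?V x) = x" for x
    unfolding R(2)[symmetric] by (simp only: RiR iRR)
  have nU: "norm (?U x) = norm x" for x
  proof -
    obtain y where y: "x = ?V y" using sV by blast
    show ?thesis unfolding y UV V ..
  qed
  have "?U ` cball 0 1 = cball 0 1"
  proof
    show "cball 0 1 \<subseteq> ?U ` cball 0 1"
    proof
      fix y :: 'a assume "y \<in> cball 0 1"
      then show "y \<in> ?U ` cball 0 1" using UV[of y] V[of y] by (intro image_eqI[of _ _ "?V y"]) auto
    qed
  qed (auto simp: nU)
  moreover have "T ` cball 0 1 = R ` ?U ` cball 0 1" by (simp add: image_image RiR)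
  ultimately show thesis using that R(1) by simp
qed

text \<open>The support function of the ellipsoid of a symmetric operator in direction
  \<open>u\<close> is the norm of its value at \<open>u\<close>; inclusions compare support
  functions. The point \<open>?y\<close> is where the support of the smaller ellipsoid is
  attained.\<close>

lemma posdef_cball_subset:
  assumes R: "posdef R" and S: "posdef S" and s: "0 \<le> s" and sub: "S ` cball 0 1 \<subseteq> (*\<^sub>R) s ` R ` cball 0 1"
  shows "norm (S u) \<le> s * norm (R u)"
proof (cases "S u = 0")
  case False
  let ?y = "(1 / norm (S u)) *\<^sub>R S u"
  have "S ?y \<in> (*\<^sub>R) s ` R ` cball 0 1" using False sub by auto
  then obtain z where z: "norm z \<le> 1" "S ?y = s *\<^sub>R R z" by auto
  have "norm (S u) = ?y \<bullet> S u" using False by (simp add: dot_square_norm power2_eq_square)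
  also have "\<dots> = S ?y \<bullet> u" by (rule posdefD(4)[OF S, symmetric])
  also have "\<dots> = s * (z \<bullet> R u)" unfolding z(2) by (simp add: posdefD(4)[OF R])
  also have "\<dots> \<le> s * norm (R u)"
  proof (rule mult_left_mono[OF _ s])
    have "z \<bullet> R u \<le> norm z * norm (R u)" by (rule norm_cauchy_schwarz)
    also have "\<dots> \<le> norm (R u)" using z(1) by (simp add: mult_left_le_one_le)
    finally show "z \<bullet> R u \<le> norm (R u)" .
  qed
  finally show ?thesis .
qed (use s in auto)

lemma posdef_cball_unique:
  assumes "posdef R" "posdef S" "R ` cball 0 1 = S ` cball 0 1"
  shows "R = S"
proof (rule posdef_unique[OF assms(1,2)])
  fix x show "norm (R x) = norm (S x)"
    using posdef_cball_subset[of R S 1 x] posdef_cball_subset[of S R 1 x] assms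
    by (simp add: order_antisym)
qed

section \<open>Volumes of ellipsoids\<close>

text \<open>The determinant formula for the volume of a linear image is available only over well-ordered
  index types, so coordinates are transported to such a type of the same size.\<close>

typedef ('a::finite) index = "{..<CARD('a)}"
  by (rule exI[of _ 0]) simp

instance index :: (finite) finite
proof
  have "finite (Rep_index ` (UNIV :: 'a index set))"
    by (rule finite_subset[of _ "{..<CARD('a)}"]) (use Rep_index in auto)
  then show "finite (UNIV :: 'a index set)"
    by (rule finite_imageD) (simp add: inj_on_def Rep_index_inject)
qed

instantiation index :: (finite) wellorder
begin

definition less_eq_index :: "'a index \<Rightarrow> 'a index \<Rightarrow> bool" where "x \<le> y \<longleftrightarrow> Rep_index x \<le> Rep_index y"
definition less_index :: "'a index \<Rightarrow> 'a index \<Rightarrow> bool" where "x < y \<longleftrightarrow> Rep_index x < Rep_index y"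

instance
proof
  fix P :: "'a index \<Rightarrow> bool" and a
  assume step: "\<And>x. (\<And>y. y < x \<Longrightarrow> P y) \<Longrightarrow> P x"
  show "P a"
    by (induction a rule: measure_induct[where f = Rep_index]) (metis step less_index_def)
qed (auto simp: less_eq_index_def less_index_def Rep_index_inject)

end

lemma bij_index: "\<exists>\<beta> :: 'a::finite index \<Rightarrow> 'a. bij \<beta>"
proof -
  have "CARD('a index) = CARD('a)"
    using type_definition.card[OF type_definition_index[where 'a='a]] by simp
  then show ?thesis
    using finite_same_card_bij[of "UNIV :: 'a index set" "UNIV :: 'a set"] by auto
qed

lemma prod_Basis_vec: "(\<Prod>b\<in>(Basis :: (real ^ 'n) set). f b) = (\<Prod>i\<in>UNIV. f (axis i 1))"
proof -
  have "(Basis :: (real ^ 'n) set) = range (\<lambda>i. axis i 1)" by (auto simp: Basis_vec_def)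
  moreover have "inj (\<lambda>i. axis i (1::real) :: real ^ 'n)" by (simp add: inj_on_def axis_eq_axis)
  ultimately show ?thesis by (metis (no_types, lifting) prod.reindex_cong)
qed

text \<open>Reindexing coordinates maps boxes to boxes with the same side lengths, so the image of
  Lebesgue measure is Lebesgue measure. Compactness makes the image of \<open>S\<close> a Borel
  set.\<close>

lemma measure_reindex_compact:
  fixes \<beta> :: "'m::finite \<Rightarrow> 'n::finite" and S :: "(real ^ 'n) set"
  assumes \<beta>: "bij \<beta>" and S: "compact S"
  shows "measure lebesgue ((\<lambda>x. \<chi> i. x $ \<beta> i) ` S) = measure lebesgue S"
proof -
  let ?\<phi> = "\<lambda>x :: real ^ 'n. (\<chi> i. x $ \<beta> i) :: real ^ 'm"
  have lin: "linear ?\<phi>" by (rule linearI) (auto simp: vec_eq_iff)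
  have inv\<beta>: "\<beta> (inv \<beta> a) = a" "inv \<beta> (\<beta> i) = i" for a i
    using \<beta> by (auto simp: bij_is_surj surj_f_inv_f bij_is_inj)
  have inj: "inj ?\<phi>"
  proof (rule injI)
    fix x y assume "?\<phi> x = ?\<phi> y"
    then have "x $ \<beta> i = y $ \<beta> i" for i by (simp add: vec_eq_iff)
    then show "x = y" by (metis inv\<beta>(1) vec_eq_iff)
  qed
  have m: "?\<phi> \<in> borel_measurable borel"
    using lin by (intro borel_measurable_continuous_onI) (simp add: linear_continuous_on linear_conv_bounded_linear)
  have "lborel = distr lborel borel ?\<phi>"
  proof (rule lborel_eqI)
    fix l u :: "real ^ 'm" assume lu: "\<And>b. b \<in> Basis \<Longrightarrow> l \<bullet> b \<le> u \<bullet> b"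
    let ?\<psi> = "\<lambda>y :: real ^ 'm. (\<chi> a. y $ inv \<beta> a) :: real ^ 'n"
    have "?\<phi> -` box l u = box (?\<psi> l) (?\<psi> u)"
      using \<beta> by (auto simp: mem_box_cart) (metis inv\<beta>)+
    then have "emeasure (distr lborel borel ?\<phi>) (box l u) = emeasure lborel (box (?\<psi> l) (?\<psi> u))"
      using m by (simp add: emeasure_distr)
    also have "\<dots> = ennreal (\<Prod>b\<in>Basis. (?\<psi> u - ?\<psi> l) \<bullet> b)"
    proof (intro emeasure_lborel_box)
      fix b :: "real ^ 'n" assume "b \<in> Basis"
      then obtain a where b: "b = axis a 1" by (auto simp: Basis_vec_def)
      have "l \<bullet> axis (inv \<beta> a) 1 \<le> u \<bullet> axis (inv \<beta> a) 1" by (intro lu) (auto simp: Basis_vec_def)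
      then show "?\<psi> l \<bullet> b \<le> ?\<psi> u \<bullet> b" by (simp add: b inner_axis)
    qed
    also have "(\<Prod>b\<in>Basis. (?\<psi> u - ?\<psi> l) \<bullet> b) = (\<Prod>a\<in>UNIV. u $ inv \<beta> a - l $ inv \<beta> a)"
      by (simp add: prod_Basis_vec inner_axis)
    also have "\<dots> = (\<Prod>i\<in>UNIV. u $ i - l $ i)"
      using prod.reindex_bij_betw[of "inv \<beta>" UNIV UNIV "\<lambda>i. u $ i - l $ i"] bij_imp_bij_inv[OF \<beta>] by simp
    also have "\<dots> = (\<Prod>b\<in>Basis. (u - l) \<bullet> b)" by (simp add: prod_Basis_vec inner_axis)
    finally show "emeasure (distr lborel borel ?\<phi>) (box l u) = ennreal (\<Prod>b\<in>Basis. (u - l) \<bullet> b)" .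
  qed simp
  then have "emeasure lborel (?\<phi> ` S) = emeasure (distr lborel borel ?\<phi>) (?\<phi> ` S)" by simp
  also have "compact (?\<phi> ` S)"
    using lin S by (intro compact_continuous_image) (simp_all add: linear_continuous_on linear_conv_bounded_linear)
  then have c: "?\<phi> ` S \<in> sets borel" by (simp add: borel_compact)
  then have "emeasure (distr lborel borel ?\<phi>) (?\<phi> ` S) = emeasure lborel (?\<phi> -` ?\<phi> ` S)"
    using m by (simp add: emeasure_distr)
  also have "?\<phi> -` ?\<phi> ` S = S" using inj by (rule inj_vimage_image_eq)
  finally show ?thesis using c S by (simp add: measure_def borel_compact emeasure_completion)
qed

text \<open>The factor is left abstract: positivity for bijections and its value for orthogonal maps
  are read off from the unit ball.\<close>

theorem measure_linear_image_compact:
  fixes f :: "real ^ 'n \<Rightarrow> real ^ 'n"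
  assumes f: "linear f"
  obtains \<Delta> where "0 \<le> \<Delta>" "\<And>S. compact S \<Longrightarrow> measure lebesgue (f ` S) = \<Delta> * measure lebesgue S"
proof -
  obtain \<beta> :: "'n index \<Rightarrow> 'n" where \<beta>: "bij \<beta>" using bij_index by blast
  have inv\<beta>: "\<beta> (inv \<beta> a) = a" "inv \<beta> (\<beta> i) = i" for a i
    using \<beta> by (auto simp: bij_is_surj surj_f_inv_f bij_is_inj)
  let ?\<phi> = "\<lambda>x :: real ^ 'n. (\<chi> i. x $ \<beta> i) :: real ^ 'n index"
  let ?\<psi> = "\<lambda>y :: real ^ 'n index. (\<chi> a. y $ inv \<beta> a) :: real ^ 'n"
  have \<psi>\<phi>: "?\<psi> (?\<phi> x) = x" for x by (simp add: vec_eq_iff inv\<beta>)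
  have lin: "linear ?\<phi>" "linear ?\<psi>" by (auto intro!: linearI simp: vec_eq_iff)
  let ?g = "?\<phi> \<circ> f \<circ> ?\<psi>"
  have lg: "linear ?g" using lin f by (intro linear_compose)
  have comp: "compact (h ` S)" if "compact S" "linear h" for h :: "real^'a::finite \<Rightarrow> real^'b::finite" and S
    using that by (intro compact_continuous_image) (simp_all add: linear_continuous_on linear_conv_bounded_linear)
  show thesis
  proof
    fix S :: "(real ^ 'n) set" assume S: "compact S"
    have "measure lebesgue (f ` S) = measure lebesgue (?\<phi> ` f ` S)"
      using measure_reindex_compact[OF \<beta> comp[OF S f]] by simp
    also have "?\<phi> ` f ` S = ?g ` ?\<phi> ` S" by (simp only: image_image o_def \<psi>\<phi>)
    also have "measure lebesgue \<dots> = \<bar>det (matrix ?g)\<bar> * measure lebesgue (?\<phi> ` S)"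
      using comp[OF S lin(1)] by (intro measure_linear_image lg lmeasurable_compact)
    finally show "measure lebesgue (f ` S) = \<bar>det (matrix ?g)\<bar> * measure lebesgue S"
      by (simp add: measure_reindex_compact[OF \<beta> S])
  qed simp
qed

lemma measure_unit_cball_pos: "0 < measure lebesgue (cball 0 1 :: 'a::euclidean_space set)"
  by (simp add: content_cball_pos)

lemma compact_linear_image: "compact S \<Longrightarrow> linear f \<Longrightarrow> compact (f ` S)"
  for f :: "'a::euclidean_space \<Rightarrow> 'b::real_normed_vector"
  by (intro compact_continuous_image) (simp_all add: linear_continuous_on linear_conv_bounded_linear)

text \<open>\<open>?P\<close> rotates the coordinate axes to the eigenbasis and turns
  \<open>R\<close> into the coordinate stretch \<open>?D\<close>.\<close>

lemma measure_posdef_cball: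
  fixes R :: "real ^ 'n \<Rightarrow> real ^ 'n"
  assumes R: "posdef R" and B: "eigenbasis R B m"
  shows "measure lebesgue (R ` cball 0 1) = (\<Prod>b\<in>B. m b) * measure lebesgue (cball 0 1 :: (real ^ 'n) set)"
proof -
  have "card (UNIV :: 'n set) = card B" using B by (simp add: eigenbasis_def)
  then obtain \<beta> where \<beta>: "bij_betw \<beta> (UNIV :: 'n set) B"
    using finite_same_card_bij[of "UNIV :: 'n set" B] B by (auto simp: eigenbasis_def)
  let ?P = "\<lambda>x :: real ^ 'n. \<Sum>i\<in>UNIV. (x $ i) *\<^sub>R \<beta> i"
  let ?D = "\<lambda>x :: real ^ 'n. (\<chi> i. m (\<beta> i) * x $ i)"
  have \<beta>B: "\<beta> i \<in> B" for i using \<beta> by (auto simp: bij_betw_def)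
  have on: "\<beta> i \<bullet> \<beta> j = (if i = j then 1 else 0)" for i j
    using eigenbasis_orthonormal[OF B \<beta>B \<beta>B] \<beta> by (auto simp: bij_betw_def inj_on_def)
  have lP: "linear ?P" by (intro linear_compose_sum ballI linearI) (simp_all add: scaleR_add_left)
  have "?P x \<bullet> ?P y = x \<bullet> y" for x y
  proof -
    have "?P x \<bullet> ?P y = (\<Sum>i\<in>UNIV. \<Sum>j\<in>UNIV. if j = i then x $ i * y $ i else 0)"
      unfolding inner_sum_left inner_sum_right by (intro sum.cong) (auto simp: on)
    then show ?thesis by (simp add: inner_vec_def)
  qed
  then have P: "orthogonal_transformation ?P" using lP by (simp add: orthogonal_transformation_def)
  have "?P ` cball 0 1 = cball 0 1"
    using image_orthogonal_transformation_cball[OF P, of 0 1] by simp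
  obtain \<Delta> where \<Delta>: "\<And>S. compact S \<Longrightarrow> measure lebesgue (?P ` S) = \<Delta> * measure lebesgue S"
    using measure_linear_image_compact[OF lP] by blast
  \<comment> \<open>The rotation maps the unit ball onto itself, which fixes its volume
    factor.\<close>
  have "\<Delta> = 1"
    using \<Delta>[of "cball 0 1"] \<open>?P ` cball 0 1 = cball 0 1\<close> measure_unit_cball_pos[where 'a="real^'n"] by simp
  have "R (?P x) = ?P (?D x)" for x
  proof -
    have "R (?P x) = (\<Sum>i\<in>UNIV. (x $ i) *\<^sub>R R (\<beta> i))"
      by (simp add: linear_sum[OF posdefD(2)[OF R]] linear_scale[OF posdefD(2)[OF R]])
    also have "\<dots> = ?P (?D x)" using B \<beta>B by (simp add: eigenbasis_def mult.commute)
    finally show ?thesis .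
  qed
  then have "R ` ?P ` cball 0 1 = ?P ` ?D ` cball 0 1" by (simp only: image_image)
  then have "measure lebesgue (R ` cball 0 1) = measure lebesgue (?P ` ?D ` cball 0 1)"
    by (simp only: \<open>?P ` cball 0 1 = cball 0 1\<close>)
  also have "linear ?D" by (rule linearI) (auto simp: vec_eq_iff algebra_simps)
  then have "measure lebesgue (?P ` ?D ` cball 0 1) = measure lebesgue (?D ` cball 0 1)"
    using \<Delta>[of "?D ` cball 0 1"] \<open>\<Delta> = 1\<close> by (simp add: compact_linear_image)
  also have "\<dots> = \<bar>\<Prod>i\<in>UNIV. m (\<beta> i)\<bar> * measure lebesgue (cball 0 1 :: (real ^ 'n) set)"
    by (rule measure_stretch) simp
  also have "(\<Prod>i\<in>UNIV. m (\<beta> i)) = (\<Prod>b\<in>B. m b)" by (rule prod.reindex_bij_betw[OF \<beta>])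
  also have "\<bar>\<Prod>b\<in>B. m b\<bar> = (\<Prod>b\<in>B. m b)"
    using posdef_eigenvalue_pos[OF R B] by (intro abs_of_pos prod_pos) auto
  finally show ?thesis .
qed

section \<open>John decompositions and the Loewner ellipsoid\<close>

text \<open>The quadratic form of the equation "sum of c x times x x^T is the identity". Taking
  traces, the c-weighted sum of squared norms is the dimension, which is also the total weight;
  inside the unit ball the vectors of positive weight therefore have norm 1.\<close>

definition frame :: "'a::euclidean_space set \<Rightarrow> ('a \<Rightarrow> real) \<Rightarrow> bool" where
  "frame X c \<longleftrightarrow> finite X \<and> (\<forall>x\<in>X. 0 \<le> c x) \<and> sum c X = DIM('a) \<and>
     (\<forall>v. (\<Sum>x\<in>X. c x * (x \<bullet> v)\<^sup>2) = (norm v)\<^sup>2)"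

text \<open>John's criterion for the unit ball to be the Loewner ellipsoid. It is stated for
  arbitrary sets because it will be applied to decomposable vectors, which do not form a convex
  set.\<close>

definition john :: "'a::euclidean_space set \<Rightarrow> bool" where
  "john K \<longleftrightarrow> K \<subseteq> cball 0 1 \<and> (\<exists>X\<subseteq>K. \<exists>c. frame X c)"

text \<open>The logarithm of the best \<open>s\<close> plays the role of a distance: constants
  multiply along a chain of bodies.\<close>

definition body_near :: "real \<Rightarrow> 'a::real_vector set \<Rightarrow> 'a set \<Rightarrow> bool" where
  "body_near s P Q \<longleftrightarrow> P \<subseteq> (*\<^sub>R) s ` Q \<and> Q \<subseteq> (*\<^sub>R) s ` P"

text \<open>Both sides are the squared Hilbert-Schmidt norm of \<open>S\<close>: a frame sums
  squared norms in the same way as an orthonormal basis.\<close>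

lemma frame_hilbert_schmidt:
  assumes X: "frame X c" and S: "symmetric_op S" "eigenbasis S B m"
  shows "(\<Sum>x\<in>X. c x * (norm (S x))\<^sup>2) = (\<Sum>b\<in>B. (m b)\<^sup>2)"
proof -
  have "(\<Sum>x\<in>X. c x * (norm (S x))\<^sup>2) = (\<Sum>x\<in>X. \<Sum>b\<in>B. (m b)\<^sup>2 * (c x * (x \<bullet> b)\<^sup>2))"
  proof (rule sum.cong[OF refl])
    fix x
    have "(norm (S x))\<^sup>2 = (\<Sum>b\<in>B. (m b)\<^sup>2 * (x \<bullet> b)\<^sup>2)"
      by (subst eigenbasis_norm[OF S(2), symmetric]) (simp add: eigenbasis_apply(2)[OF S] power_mult_distrib)
    then show "c x * (norm (S x))\<^sup>2 = (\<Sum>b\<in>B. (m b)\<^sup>2 * (c x * (x \<bullet> b)\<^sup>2))"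
      by (simp add: sum_distrib_left mult.left_commute)
  qed
  also have "\<dots> = (\<Sum>b\<in>B. (m b)\<^sup>2 * (\<Sum>x\<in>X. c x * (x \<bullet> b)\<^sup>2))"
    by (subst sum.swap) (simp only: sum_distrib_left)
  also have "\<dots> = (\<Sum>b\<in>B. (m b)\<^sup>2)"
    using X S(2) by (intro sum.cong refl) (simp add: frame_def eigenbasis_def)
  finally show ?thesis .
qed

lemma frame_sum_squares_le:
  fixes S :: "'a::euclidean_space \<Rightarrow> 'a" and m :: "'a \<Rightarrow> real" and s :: real
  assumes X: "frame X c" and S: "symmetric_op S" "eigenbasis S B m" and s: "\<And>x. x \<in> X \<Longrightarrow> norm (S x) \<le> s"
  shows "(\<Sum>b\<in>B. (m b)\<^sup>2) \<le> DIM('a) * s\<^sup>2"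
proof -
  have "(\<Sum>x\<in>X. c x * (norm (S x))\<^sup>2) \<le> (\<Sum>x\<in>X. c x * s\<^sup>2)"
    using X s by (intro sum_mono mult_left_mono power_mono) (auto simp: frame_def)
  also have "\<dots> = DIM('a) * s\<^sup>2" using X by (simp add: frame_def sum_distrib_right[symmetric])
  finally show ?thesis unfolding frame_hilbert_schmidt[OF X S] .
qed

lemma eigenbasis_inv:
  assumes R: "posdef R" and B: "eigenbasis R B m"
  shows "eigenbasis (inv R) B (\<lambda>b. 1 / m b)"
proof -
  have "inv R b = (1 / m b) *\<^sub>R b" if "b \<in> B" for b
  proof -
    have "R ((1 / m b) *\<^sub>R b) = b"
      using B that posdef_eigenvalue_pos[OF R B that]
      by (simp add: linear_scale[OF posdefD(2)[OF R]] eigenbasis_def)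
    then show ?thesis using posdef_bij[OF R] by (metis bij_inv_eq_iff)
  qed
  then show ?thesis using B by (simp add: eigenbasis_def)
qed

text \<open>Each summand \<open>x - 1 - ln x\<close>, \<open>x = 1 / (m b)\<^sup>2\<close>, is nonnegative and vanishes only for \<open>x = 1\<close>: the bound
  gives the minimality, the uniqueness and the stability of the Loewner ellipsoid.\<close>

lemma sum_excess_le:
  fixes R :: "'a::euclidean_space \<Rightarrow> 'a" and m :: "'a \<Rightarrow> real" and s v :: real
  assumes X: "frame X c" and R: "posdef R" "eigenbasis R B m"
    and s: "0 \<le> (s::real)" "X \<subseteq> (*\<^sub>R) s ` R ` cball 0 1" and v: "(\<Prod>b\<in>B. m b) \<le> v"
  shows "(\<Sum>b\<in>B. (1 / m b)\<^sup>2 - 1 - ln ((1 / m b)\<^sup>2)) \<le> DIM('a) * (s\<^sup>2 - 1) + 2 * ln v"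
proof -
  have mp: "0 < m b" if "b \<in> B" for b using posdef_eigenvalue_pos[OF R that] .
  have fin: "finite B" "card B = DIM('a)" using R by (auto simp: eigenbasis_def)
  \<comment> \<open>The inclusion bounds \<open>inv R\<close> on the frame, hence the sum of its
    squared eigenvalues.\<close>
  have "norm (inv R x) \<le> s" if x: "x \<in> X" for x
  proof -
    obtain y where y: "norm y \<le> 1" "x = s *\<^sub>R R y" using x s(2) by auto
    then have "inv R x = s *\<^sub>R y"
      using bij_is_inj[OF posdef_bij[OF R(1)]] linear_scale[OF posdefD(2)[OF posdef_inv[OF R(1)]]] by simp
    then show ?thesis using y s(1) by (simp add: mult_left_le)
  qed
  then have "(\<Sum>b\<in>B. (1 / m b)\<^sup>2) \<le> DIM('a) * s\<^sup>2"
    by (rule frame_sum_squares_le[OF X posdefD(1)[OF posdef_inv[OF R(1)]] eigenbasis_inv[OF R]])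
  moreover have "(\<Sum>b\<in>B. ln ((1 / m b)\<^sup>2)) = - 2 * ln (\<Prod>b\<in>B. m b)"
  proof -
    have nz: "m b \<noteq> 0" if "b \<in> B" for b using mp[OF that] by simp
    have "(\<Sum>b\<in>B. ln ((1 / m b)\<^sup>2)) = (\<Sum>b\<in>B. - 2 * ln (m b))"
    proof (rule sum.cong[OF refl])
      fix b assume "b \<in> B"
      then show "ln ((1 / m b)\<^sup>2) = - 2 * ln (m b)" using mp by (simp add: ln_realpow ln_div)
    qed
    also have "\<dots> = - 2 * ln (\<Prod>b\<in>B. m b)"
      by (simp only: ln_prod[of B m, OF fin(1) nz] sum_distrib_left)
    finally show ?thesis .
  qed
  moreover have "ln (\<Prod>b\<in>B. m b) \<le> ln v" 
  proof (rule ln_mono[OF v])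
    show "0 < (\<Prod>b\<in>B. m b)" using mp by (rule prod_pos)
  qed
  moreover have "(\<Sum>b\<in>B. (1 / m b)\<^sup>2 - 1 - ln ((1 / m b)\<^sup>2)) =
      (\<Sum>b\<in>B. (1 / m b)\<^sup>2) - DIM('a) - (\<Sum>b\<in>B. ln ((1 / m b)\<^sup>2))"
    by (simp only: sum_subtractf sum_constant fin(2) mult_1_right)
  moreover have "DIM('a) * (s\<^sup>2 - 1) = DIM('a) * s\<^sup>2 - DIM('a)" by (simp only: right_diff_distrib mult_1_right)
  ultimately show ?thesis by linarith
qed

lemma excess_nonneg: "0 < x \<Longrightarrow> 0 \<le> x - 1 - ln (x::real)"
  using ln_le_minus_one[of x] by simp

text \<open>The convex function x - 1 - ln x lies above its tangent at a, whose slope 1 - 1/a has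
  the sign of x - a or vanishes under either hypothesis.\<close>

lemma excess_mono:
  fixes a x :: real
  assumes "0 < x" "0 < a" "1 \<le> a \<and> a \<le> x \<or> a \<le> 1 \<and> x \<le> a"
  shows "a - 1 - ln a \<le> x - 1 - ln x"
proof -
  have "ln (x / a) \<le> x / a - 1" using assms by (intro ln_le_minus_one) auto
  then have "ln x - ln a \<le> x / a - 1" using assms by (simp add: ln_div)
  moreover have "0 \<le> (x - a) * (1 - 1 / a)"
    using assms by (cases "1 \<le> a \<and> a \<le> x") (auto intro: mult_nonneg_nonneg mult_nonpos_nonpos)
  moreover have "(x - a) * (1 - 1 / a) = (x - a) - (x / a - 1)" using assms by (simp add: field_simps)
  ultimately show ?thesis by linarith
qed

lemma excess_small:
  assumes "1 < (a::real)"
  obtains e where "0 < e" "\<And>x. 0 < x \<Longrightarrow> x - 1 - ln x \<le> e \<Longrightarrow> 1 / a \<le> x \<and> x \<le> a"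
proof -
  let ?f = "\<lambda>x::real. x - 1 - ln x"
  have pos: "0 < ?f x" if "0 < x" "x \<noteq> 1" for x
    using excess_nonneg[OF that(1)] ln_eq_minus_one[OF that(1)] that(2) by (cases "?f x = 0") auto
  have a: "0 < 1 / a" "1 / a < 1" using assms by auto
  show thesis
  \<comment> \<open>Half of the smaller boundary value turns the weak bound on \<open>x\<close> into
    strict inequalities.\<close>
  proof (rule that[of "min (?f a) (?f (1 / a)) / 2"])
    show "0 < min (?f a) (?f (1 / a)) / 2" using pos[of a] pos[of "1 / a"] a assms by auto
    fix x assume x: "0 < x" "?f x \<le> min (?f a) (?f (1 / a)) / 2"
    then have less: "?f x < ?f a" "?f x < ?f (1 / a)"
      using pos[of a] pos[of "1 / a"] a assms by auto
    have "\<not> a \<le> x"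
      using excess_mono[OF x(1), of a] less(1) assms by auto
    moreover have "\<not> x \<le> 1 / a"
      using excess_mono[OF x(1) a(1)] less(2) a(2) by auto
    ultimately show "1 / a \<le> x \<and> x \<le> a" by linarith
  qed
qed

lemma posdef_image_cball_bounds:
  fixes R :: "'a::euclidean_space \<Rightarrow> 'a"
  assumes R: "posdef R" "eigenbasis R B m" and s: "\<And>b. b \<in> B \<Longrightarrow> 1 / s \<le> m b \<and> m b \<le> s" "0 < s"
  shows "body_near s (R ` cball 0 1) (cball 0 1)"
proof -
  have 1: "norm (R x) \<le> s * norm x" for x
  proof (rule symmetric_op_norm_le[OF posdefD(1)[OF R(1)] R(2)])
    fix b assume "b \<in> B"
    then show "\<bar>m b\<bar> \<le> s" using s(1)[of b] posdef_eigenvalue_pos[OF R, of b] by simp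
  qed (use s in simp)
  have "\<bar>1 / m b\<bar> \<le> s" if "b \<in> B" for b
    using s(1)[OF that] s(2) posdef_eigenvalue_pos[OF R that] by (simp add: field_simps)
  then have 2: "norm (inv R x) \<le> s * norm x" for x
    using s(2) by (intro symmetric_op_norm_le[OF posdefD(1)[OF posdef_inv[OF R(1)]] eigenbasis_inv[OF R]]) auto
  have RiR: "R (inv R x) = x" for x using posdef_bij[OF R(1)] by (simp add: bij_is_surj surj_f_inv_f)
  have "R x \<in> (*\<^sub>R) s ` cball 0 1" if "norm x \<le> 1" for x
  proof (rule image_eqI[of _ _ "(1 / s) *\<^sub>R R x"])
    have "norm (R x) \<le> s * 1" using 1[of x] that s(2) by (meson mult_left_mono order_trans less_imp_le)
    then show "(1 / s) *\<^sub>R R x \<in> cball 0 1" using s(2) by (simp add: field_simps)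
  qed (use s(2) in simp)
  moreover have "x \<in> (*\<^sub>R) s ` R ` cball 0 1" if "norm x \<le> 1" for x
  proof (rule image_eqI[of _ _ "R ((1 / s) *\<^sub>R inv R x)"])
    have "norm (inv R x) \<le> s * 1" using 2[of x] that s(2) by (meson mult_left_mono order_trans less_imp_le)
    then show "R ((1 / s) *\<^sub>R inv R x) \<in> R ` cball 0 1" using s(2) by (intro imageI) (simp add: field_simps)
  qed (use s(2) in \<open>simp add: linear_scale[OF posdefD(2)[OF R(1)]] RiR\<close>)
  ultimately show ?thesis by (auto simp: body_near_def)
qed

lemma small_perturbation:
  fixes N :: nat
  assumes "0 < (e::real)"
  obtains t :: real where "1 < t" "N * (t\<^sup>2 - 1) + 2 * ln (t ^ N) \<le> e"
proof -
  \<comment> \<open>For h at most 1 the two terms are at most 3 N h and 2 N h, whence 5 N; the added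
    1 covers N = 0.\<close>
  define h where "h = min 1 (e / (5 * N + 1))"
  have h: "0 < h" "h \<le> 1" using assms by (auto simp: h_def)
  have "h * (5 * N + 1) \<le> e"
    using mult_right_mono[of h "e / (5 * N + 1)" "5 * N + 1"] by (simp add: h_def)
  moreover have "N * ((1 + h)\<^sup>2 - 1) \<le> N * (3 * h)"
    using h mult_left_mono[of h 1 h] by (intro mult_left_mono) (auto simp: power2_eq_square algebra_simps)
  moreover have "ln ((1 + h) ^ N) \<le> N * h"
    using h ln_le_minus_one[of "1 + h"] by (simp add: ln_realpow mult_left_mono)
  ultimately have "N * ((1 + h)\<^sup>2 - 1) + 2 * ln ((1 + h) ^ N) \<le> e"
    using h by (simp add: algebra_simps)
  then show thesis using that[of "1 + h"] h by simp
qed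

section \<open>Minimal volume and uniqueness of the Loewner ellipsoid\<close>

lemma ellipsoid_posdef:
  fixes E :: "'a::euclidean_space set"
  shows "ellipsoid E \<longleftrightarrow> (\<exists>R. posdef R \<and> E = R ` cball 0 1)"
proof
  assume "ellipsoid E"
  then obtain T :: "'a \<Rightarrow> 'a" where T: "linear T" "bij T" "E = T ` cball 0 1" using ellipsoid_def by blast
  then show "\<exists>R. posdef R \<and> E = R ` cball 0 1" using polar_decomposition[OF T(1,2)] by metis
next
  assume "\<exists>R. posdef R \<and> E = R ` cball 0 1"
  then show "ellipsoid E" using posdefD(2) posdef_bij unfolding ellipsoid_def by blast
qed

lemma ellipsoid_linear_image:
  fixes T :: "'a::euclidean_space \<Rightarrow> 'a"
  assumes "ellipsoid E" "linear T" "bij T" shows "ellipsoid (T ` E)"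
proof -
  obtain S :: "'a \<Rightarrow> 'a" where "linear S" "bij S" "E = S ` cball 0 1" using assms(1) ellipsoid_def by blast
  then show ?thesis
    using assms unfolding ellipsoid_def
    by (intro exI[of _ "T \<circ> S"]) (auto simp: linear_compose bij_comp image_comp)
qed

text \<open>With s = 1, a nonnegative sum of excesses is bounded by twice the logarithm of the
  product of the eigenvalues, so this product, the volume ratio, is at least 1. If it equals 1,
  every excess vanishes and every eigenvalue is 1.\<close>

lemma ellipsoid_minimal_ball:
  fixes K :: "(real ^ 'n) set"
  assumes K: "john K" and E: "ellipsoid E" "K \<subseteq> E"
  shows "measure lebesgue (cball 0 1 :: (real ^ 'n) set) \<le> measure lebesgue E"
    and "measure lebesgue E \<le> measure lebesgue (cball 0 1 :: (real ^ 'n) set) \<Longrightarrow> E = cball 0 1"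
proof -
  obtain R where R: "posdef R" "E = R ` cball 0 1" using E ellipsoid_posdef by blast
  obtain B m where B: "eigenbasis R B m" using symmetric_op_eigenbasis[OF posdefD(1)[OF R(1)]] by blast
  obtain X c where X: "X \<subseteq> K" "frame X c" using K by (auto simp: john_def)
  have fin: "finite B" using B by (simp add: eigenbasis_def)
  have mp: "0 < m b" if "b \<in> B" for b using posdef_eigenvalue_pos[OF R(1) B that] .
  have "(*\<^sub>R) 1 ` R ` cball 0 1 = E" using R by simp
  then have *: "(\<Sum>b\<in>B. (1 / m b)\<^sup>2 - 1 - ln ((1 / m b)\<^sup>2)) \<le> 2 * ln (\<Prod>b\<in>B. m b)"
    using sum_excess_le[OF X(2) R(1) B, of 1, OF _ _ order_refl] X E(2) by simp
  have ex: "0 \<le> (1 / m b)\<^sup>2 - 1 - ln ((1 / m b)\<^sup>2)" if "b \<in> B" for b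
    using mp[OF that] by (intro excess_nonneg) simp
  have prod: "0 < (\<Prod>b\<in>B. m b)" using mp by (rule prod_pos)
  have exs: "0 \<le> (\<Sum>b\<in>B. (1 / m b)\<^sup>2 - 1 - ln ((1 / m b)\<^sup>2))" using ex by (rule sum_nonneg)
  have "0 \<le> 2 * ln (\<Prod>b\<in>B. m b)" using * exs by linarith
  then have ge: "1 \<le> (\<Prod>b\<in>B. m b)" using prod by simp
  have vol: "measure lebesgue E = (\<Prod>b\<in>B. m b) * measure lebesgue (cball 0 1 :: (real ^ 'n) set)"
    unfolding R(2) by (rule measure_posdef_cball[OF R(1) B])
  show "measure lebesgue (cball 0 1 :: (real ^ 'n) set) \<le> measure lebesgue E"
    unfolding vol using ge by (simp add: mult_le_cancel_right1)
  assume "measure lebesgue E \<le> measure lebesgue (cball 0 1 :: (real ^ 'n) set)"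
  then have "(\<Prod>b\<in>B. m b) = 1"
    using ge measure_unit_cball_pos[where 'a="real^'n"] unfolding vol by (simp add: mult_le_cancel_right2)
  then have "(\<Sum>b\<in>B. (1 / m b)\<^sup>2 - 1 - ln ((1 / m b)\<^sup>2)) = 0"
    using * exs by simp
  then have zero: "(1 / m b)\<^sup>2 - 1 - ln ((1 / m b)\<^sup>2) = 0" if "b \<in> B" for b
    using sum_nonneg_eq_0_iff[of B "\<lambda>b. (1 / m b)\<^sup>2 - 1 - ln ((1 / m b)\<^sup>2)"] fin ex that by blast
  have m1: "m b = 1" if "b \<in> B" for b
  proof -
    have "ln ((1 / m b)\<^sup>2) = (1 / m b)\<^sup>2 - 1" using zero[OF that] by linarith
    then have "(1 / m b)\<^sup>2 = 1" using mp[OF that] by (intro ln_eq_minus_one) auto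
    then have "(m b)\<^sup>2 = 1" by (simp add: power_divide)
    then show ?thesis using mp[OF that] by (simp add: power2_eq_1_iff)
  qed
  have "R x = x" for x
  proof -
    have "R x = (\<Sum>b\<in>B. (x \<bullet> b) *\<^sub>R b)"
      unfolding eigenbasis_apply(1)[OF posdefD(1)[OF R(1)] B, of x] by (intro sum.cong) (auto simp: m1)
    then show ?thesis by (simp only: eigenbasis_expand[OF B])
  qed
  then show "E = cball 0 1" by (simp add: R(2))
qed

lemma ellipsoid_compact: "ellipsoid E \<Longrightarrow> compact E"
  by (auto simp: ellipsoid_def compact_linear_image)

lemma measure_bij_linear_image:
  fixes T :: "real ^ 'n \<Rightarrow> real ^ 'n"
  assumes T: "linear T" "bij T"
  obtains \<Delta> where "0 < \<Delta>" "\<And>S. compact S \<Longrightarrow> measure lebesgue (T ` S) = \<Delta> * measure lebesgue S"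
proof -
  obtain \<Delta> where \<Delta>: "0 \<le> \<Delta>" "\<And>S. compact S \<Longrightarrow> measure lebesgue (T ` S) = \<Delta> * measure lebesgue S"
    using measure_linear_image_compact[OF T(1)] by blast
  have "T ` inv T ` cball 0 1 = cball 0 1" using T(2) by (simp add: bij_is_surj image_f_inv_f)
  moreover have "compact (inv T ` cball 0 1)"
    by (rule compact_linear_image[OF compact_cball linear_inv_bij[OF T]])
  ultimately have "\<Delta> * measure lebesgue (inv T ` cball 0 1) = measure lebesgue (cball 0 1 :: (real ^ 'n) set)"
    using \<Delta>(2)[of "inv T ` cball 0 1"] by simp
  then have "\<Delta> \<noteq> 0" using measure_unit_cball_pos[where 'a="real^'n"] by fastforce
  then have "0 < \<Delta>" using \<Delta>(1) by simp
  then show thesis using \<Delta>(2) by (rule that)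
qed

text \<open>A linear bijection multiplies all volumes by the same positive factor, so the comparison
  is pulled back by \<open>inv T\<close>.\<close>

lemma ellipsoid_minimal:
  fixes K :: "(real ^ 'n) set" and T :: "real ^ 'n \<Rightarrow> real ^ 'n"
  assumes K: "john K" and T: "linear T" "bij T" and E: "ellipsoid E" "T ` K \<subseteq> E"
  shows "measure lebesgue (T ` cball 0 1) \<le> measure lebesgue E"
    and "measure lebesgue E \<le> measure lebesgue (T ` cball 0 1) \<Longrightarrow> E = T ` cball 0 1"
proof -
  let ?E = "inv T ` E"
  have E': "ellipsoid ?E" using ellipsoid_linear_image[OF E(1) linear_inv_bij[OF T] bij_imp_bij_inv[OF T(2)]] .
  have TE: "T ` ?E = E" using T(2) by (simp add: bij_is_surj image_f_inv_f)
  have "inv T ` T ` K = K" using T(2) by (simp add: bij_is_inj image_inv_f_f)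
  then have sub: "K \<subseteq> ?E" using image_mono[OF E(2), of "inv T"] by simp
  obtain \<Delta> where \<Delta>: "0 < \<Delta>" "\<And>S. compact S \<Longrightarrow> measure lebesgue (T ` S) = \<Delta> * measure lebesgue S"
    using measure_bij_linear_image[OF T] by blast
  have 1: "measure lebesgue E = \<Delta> * measure lebesgue ?E"
    using \<Delta>(2)[OF ellipsoid_compact[OF E']] unfolding TE .
  have 2: "measure lebesgue (T ` cball 0 1) = \<Delta> * measure lebesgue (cball 0 1 :: (real ^ 'n) set)"
    by (rule \<Delta>(2)) simp
  show "measure lebesgue (T ` cball 0 1) \<le> measure lebesgue E"
    using mult_left_mono[OF ellipsoid_minimal_ball(1)[OF K E' sub], of \<Delta>] \<Delta>(1) 1 2 by linarith
  assume "measure lebesgue E \<le> measure lebesgue (T ` cball 0 1)"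
  then have "\<Delta> * measure lebesgue ?E \<le> \<Delta> * measure lebesgue (cball 0 1 :: (real ^ 'n) set)" using 1 2 by linarith
  then have "measure lebesgue ?E \<le> measure lebesgue (cball 0 1 :: (real ^ 'n) set)"
    by (rule mult_left_le_imp_le[OF _ \<Delta>(1)])
  then have "?E = cball 0 1" by (rule ellipsoid_minimal_ball(2)[OF K E' sub])
  then show "E = T ` cball 0 1" using TE by metis
qed

theorem lowner_john_image:
  fixes K :: "(real ^ 'n) set" and T :: "real ^ 'n \<Rightarrow> real ^ 'n"
  assumes K: "john K" and T: "linear T" "bij T"
  shows "lowner (T ` K) = T ` cball 0 1"
  unfolding lowner_def
proof (rule the_equality)
  have E: "ellipsoid (T ` cball 0 1)" using T unfolding ellipsoid_def by blast
  have sub: "T ` K \<subseteq> T ` cball 0 1" using K by (auto simp: john_def)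
  show "ellipsoid (T ` cball 0 1) \<and> T ` K \<subseteq> T ` cball 0 1 \<and>
    (\<forall>E'. ellipsoid E' \<and> T ` K \<subseteq> E' \<longrightarrow> measure lebesgue (T ` cball 0 1) \<le> measure lebesgue E')"
    using E sub ellipsoid_minimal(1)[OF K T] by simp
  fix E assume "ellipsoid E \<and> T ` K \<subseteq> E \<and>
    (\<forall>E'. ellipsoid E' \<and> T ` K \<subseteq> E' \<longrightarrow> measure lebesgue E \<le> measure lebesgue E')"
  then have *: "ellipsoid E" "T ` K \<subseteq> E" "measure lebesgue E \<le> measure lebesgue (T ` cball 0 1)"
    using E sub by auto
  then show "E = T ` cball 0 1" by (rule ellipsoid_minimal(2)[OF K T])
qed

text \<open>Ellipsoids are convex, so a set and its hull lie in the same ones.\<close>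

lemma lowner_convex_hull: "lowner (convex hull S) = lowner S"
proof -
  have "convex hull S \<subseteq> E \<longleftrightarrow> S \<subseteq> E" if E: "ellipsoid E" for E
  proof -
    have "convex E" using E by (auto simp: ellipsoid_def intro: convex_linear_image)
    then show ?thesis by (metis hull_minimal hull_subset subset_trans)
  qed
  then show ?thesis unfolding lowner_def by (metis (no_types, opaque_lifting))
qed

section \<open>Closeness up to scaling and stability of the Loewner ellipsoid\<close>

lemma body_near_sym: "body_near s P Q \<longleftrightarrow> body_near s Q P"
  by (auto simp: body_near_def)

lemma body_near_linear_image: "linear f \<Longrightarrow> body_near s P Q \<Longrightarrow> body_near s (f ` P) (f ` Q)"
  unfolding body_near_def by (auto simp: linear_scale image_iff subset_iff) (metis linear_scale)+

lemma body_near_trans: "body_near s P Q \<Longrightarrow> body_near t Q R \<Longrightarrow> body_near (s * t) P R"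
proof -
  assume *: "body_near s P Q" "body_near t Q R"
  have "P \<subseteq> (*\<^sub>R) s ` (*\<^sub>R) t ` R" using * unfolding body_near_def by blast
  moreover have "R \<subseteq> (*\<^sub>R) t ` (*\<^sub>R) s ` P" using * unfolding body_near_def by blast
  ultimately show ?thesis by (simp add: body_near_def image_image mult.commute)
qed

text \<open>After applying \<open>inv T\<close>, the unit ball is compared with an ellipsoid R B.
  Closeness puts the frame of \<open>K\<close> into t R B, and minimality bounds the volume of R B
  by that of t B. Together these make the total excess of the eigenvalues of \<open>R\<close> small.
  The constant \<open>t\<close> depends only on \<open>s\<close> and the dimension.\<close>

theorem body_near_lowner:
  fixes s :: real
  assumes "1 < s"
  obtains t where "1 < t"
    "\<And>T K T' K'. \<lbrakk>linear (T :: real ^ 'n \<Rightarrow> real ^ 'n); bij T; john K; linear (T' :: real ^ 'n \<Rightarrow> real ^ 'n); bij T'; john (K' :: (real ^ 'n) set); body_near t (T ` K) (T' ` K')\<rbrakk>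
      \<Longrightarrow> body_near s (T ` cball 0 1) (T' ` cball 0 1)"
proof -
  let ?B = "cball 0 1 :: (real ^ 'n) set" and ?N = "CARD('n)"
  have "1 < s\<^sup>2" using assms by (simp add: one_less_power)
  then obtain e where e: "0 < e" "\<And>x. 0 < x \<Longrightarrow> x - 1 - ln x \<le> e \<Longrightarrow> 1 / s\<^sup>2 \<le> x \<and> x \<le> s\<^sup>2"
    using excess_small by blast
  obtain t :: real where t: "1 < t" "?N * (t\<^sup>2 - 1) + 2 * ln (t ^ ?N) \<le> e"
    using small_perturbation[OF e(1)] by blast
  show thesis
  proof (rule that[OF t(1)])
    fix T T' :: "real ^ 'n \<Rightarrow> real ^ 'n" and K K' :: "(real ^ 'n) set"
    assume T: "linear T" "bij T" and K: "john K" and T': "linear T'" "bij T'" and K': "john K'"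
      and near: "body_near t (T ` K) (T' ` K')"
    define U where "U = inv T \<circ> T'"
    have U: "linear U" "bij U"
      unfolding U_def by (simp_all add: T T' linear_compose linear_inv_bij bij_comp bij_imp_bij_inv)
    have TU: "T ` U ` S = T' ` S" for S
      using T(2) by (simp add: U_def image_image bij_is_surj surj_f_inv_f)
    have "inv T ` T ` K = K" using T(2) by (simp add: bij_is_inj image_inv_f_f)
    then have near': "body_near t K (U ` K')"
      using body_near_linear_image[OF linear_inv_bij[OF T] near] by (simp add: U_def image_comp)
    have K'B: "U ` K' \<subseteq> U ` ?B" and KB: "K \<subseteq> ?B" using K K' by (auto simp: john_def)
    obtain R where R: "posdef R" "U ` ?B = R ` ?B" using polar_decomposition[OF U] by metis
    obtain B m where B: "eigenbasis R B m" using symmetric_op_eigenbasis[OF posdefD(1)[OF R(1)]] by blast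
    obtain X c where X: "X \<subseteq> K" "frame X c" using K by (auto simp: john_def)
    have lt: "linear ((*\<^sub>R) t :: real ^ 'n \<Rightarrow> _)" by (simp add: linear_scale_self)
    have bt: "bij ((*\<^sub>R) t :: real ^ 'n \<Rightarrow> _)"
      using t(1) by (intro o_bij[of "(*\<^sub>R) (1 / t)"]) (auto simp: o_def)
    \<comment> \<open>The ball of radius t contains the image of \<open>K'\<close>, so it competes
      with the minimal ellipsoid of that image.\<close>
    have "measure lebesgue (U ` ?B) \<le> measure lebesgue ((*\<^sub>R) t ` ?B)"
    proof (rule ellipsoid_minimal(1)[OF K' U])
      show "ellipsoid ((*\<^sub>R) t ` ?B)" using lt bt unfolding ellipsoid_def by blast
      show "U ` K' \<subseteq> (*\<^sub>R) t ` ?B" 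
        using near' image_mono[OF KB, of "(*\<^sub>R) t"] unfolding body_near_def by (meson subset_trans)
    qed
    also have "\<dots> = t ^ ?N * measure lebesgue ?B"
    proof -
      have eq: "(\<lambda>x :: real ^ 'n. \<chi> k. t * x $ k) = (*\<^sub>R) t" by (auto simp: vec_eq_iff)
      show ?thesis using measure_stretch[of ?B "\<lambda>_. t"] t(1) unfolding eq by simp
    qed
    finally have "(\<Prod>b\<in>B. m b) * measure lebesgue ?B \<le> t ^ ?N * measure lebesgue ?B"
      unfolding R(2) measure_posdef_cball[OF R(1) B] .
    then have "(\<Prod>b\<in>B. m b) \<le> t ^ ?N"
      by (rule mult_right_le_imp_le) (rule measure_unit_cball_pos)
    moreover have "X \<subseteq> (*\<^sub>R) t ` R ` ?B" 
      using X(1) near' image_mono[OF K'B, of "(*\<^sub>R) t"] unfolding body_near_def R(2)[symmetric] by (meson subset_trans)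
    ultimately have sum: "(\<Sum>b\<in>B. (1 / m b)\<^sup>2 - 1 - ln ((1 / m b)\<^sup>2)) \<le> e"
      using sum_excess_le[OF X(2) R(1) B, of t "t ^ ?N"] t by simp
    have mp: "0 < m b" if "b \<in> B" for b using posdef_eigenvalue_pos[OF R(1) B that] .
    have "1 / s \<le> m b \<and> m b \<le> s" if b: "b \<in> B" for b
    proof -
      have "(1 / m b)\<^sup>2 - 1 - ln ((1 / m b)\<^sup>2) \<le> (\<Sum>b\<in>B. (1 / m b)\<^sup>2 - 1 - ln ((1 / m b)\<^sup>2))"
      proof (rule member_le_sum[OF b])
        show "0 \<le> (1 / m x)\<^sup>2 - 1 - ln ((1 / m x)\<^sup>2)" if "x \<in> B - {b}" for x
          using mp[of x] that by (intro excess_nonneg zero_less_power) auto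
        show "finite B" using B by (simp add: eigenbasis_def)
      qed
      then have "1 / s\<^sup>2 \<le> (1 / m b)\<^sup>2 \<and> (1 / m b)\<^sup>2 \<le> s\<^sup>2" using sum mp[OF b] by (intro e(2)) auto
      then have "(1 / s)\<^sup>2 \<le> (1 / m b)\<^sup>2 \<and> (1 / m b)\<^sup>2 \<le> s\<^sup>2" by (simp add: power_divide)
      then have "1 / s \<le> 1 / m b" "1 / m b \<le> s"
        using power2_le_imp_le[of "1 / s" "1 / m b"] power2_le_imp_le[of "1 / m b" s] mp[OF b] assms by auto
      then show ?thesis using mp[OF b] assms by (simp add: field_simps)
    qed
    then have "body_near s ?B (U ` ?B)"
      using posdef_image_cball_bounds[OF R(1) B] assms unfolding R(2) by (simp add: body_near_sym)
    from body_near_linear_image[OF T(1) this] show "body_near s (T ` ?B) (T' ` ?B)" by (simp add: TU)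
  qed
qed

section \<open>Existence of the John position\<close>

definition outer :: "real ^ 'n \<Rightarrow> real ^ 'n ^ 'n" where
  "outer x = (\<chi> i j. x $ i * x $ j)"

lemma outer_mult_vec: "outer x *v v = (x \<bullet> v) *\<^sub>R x"
  by (simp add: outer_def matrix_vector_mult_def inner_vec_def vec_eq_iff sum_distrib_left mult_ac)

lemma sum_matrix_vector_mult:
  fixes A :: "'i \<Rightarrow> real ^ 'm ^ 'n"
  shows "(\<Sum>i\<in>I. A i) *v v = (\<Sum>i\<in>I. A i *v v)"
  by (induction I rule: infinite_finite_induct) (simp_all add: matrix_vector_mult_add_rdistrib)

lemma det_posdef_pos:
  fixes f :: "real ^ 'n \<Rightarrow> real ^ 'n"
  assumes "posdef f" shows "0 < det (matrix f)"
proof -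
  obtain g where g: "posdef g" "\<And>x. g (g x) = f x" using posdef_sqrt[OF assms] by metis
  have "matrix f = matrix g ** matrix g"
    using matrix_compose[OF posdefD(2)[OF g(1)] posdefD(2)[OF g(1)]] g(2) by (simp add: o_def)
  moreover have "det (matrix g) \<noteq> 0"
    using det_nz_iff_inj[of "g"] bij_is_inj[OF posdef_bij[OF g(1)]] posdefD(2)[OF g(1)] by simp
  ultimately show ?thesis by (auto simp: det_mul zero_less_mult_iff linorder_neq_iff)
qed

text \<open>Determinant of a I + b y y^T: after rotating \<open>y\<close> to a coordinate axis the
  matrix is diagonal, with one entry changed.\<close>

lemma det_rank_one_update:
  fixes y :: "real ^ 'n"
  shows "det (matrix (\<lambda>w. a *\<^sub>R w + b *\<^sub>R (y \<bullet> w) *\<^sub>R y)) = a ^ (CARD('n) - 1) * (a + b * (norm y)\<^sup>2)"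
proof -
  let ?h = "\<lambda>w. a *\<^sub>R w + b *\<^sub>R (y \<bullet> w) *\<^sub>R y"
  obtain k :: 'n where True by simp
  let ?e = "axis k 1 :: real ^ 'n"
  obtain U where U: "orthogonal_transformation U" "U y = norm y *\<^sub>R ?e"
    using orthogonal_transformation_exists[of y "norm y *\<^sub>R ?e"] by auto
  have lU: "linear U" using U(1) by (simp add: orthogonal_transformation_def)
  let ?D = "\<lambda>z. a *\<^sub>R z + (b * (norm y)\<^sup>2 * z $ k) *\<^sub>R ?e"
  have lh: "linear ?h" by (rule linearI) (simp_all add: algebra_simps inner_simps)
  have lD: "linear ?D" by (rule linearI) (simp_all add: algebra_simps)
  have "U (?h w) = ?D (U w)" for w
  proof -
    have "y \<bullet> w = U y \<bullet> U w" using U(1) by (simp add: orthogonal_transformation_def)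
    also have "\<dots> = norm y * U w $ k" by (simp add: U(2) inner_axis')
    finally show ?thesis
      by (simp add: linear_add[OF lU] linear_scale[OF lU] U(2) power2_eq_square mult_ac)
  qed
  then have "U \<circ> ?h = ?D \<circ> U" by (simp add: o_def)
  then have "matrix U ** matrix ?h = matrix ?D ** matrix U"
    using matrix_compose[OF lh lU] matrix_compose[OF lU lD] by simp
  then have "det (matrix U ** matrix ?h) = det (matrix ?D ** matrix U)" by (rule arg_cong)
  then have "det (matrix U) * det (matrix ?h) = det (matrix U) * det (matrix ?D)"
    by (simp only: det_mul mult.commute)
  moreover have "det (matrix U) \<noteq> 0"
    using det_nz_iff_inj[OF lU] orthogonal_transformation_inj[OF U(1)] by simp
  ultimately have "det (matrix ?h) = det (matrix ?D)" by simp
  also have "\<dots> = (\<Prod>i\<in>UNIV. matrix ?D $ i $ i)"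
    by (rule det_diagonal) (auto simp: matrix_def axis_def)
  also have "\<dots> = (\<Prod>i\<in>UNIV. if i = k then a + b * (norm y)\<^sup>2 else a)"
    by (intro prod.cong) (auto simp: matrix_def axis_def)
  also have "\<dots> = (a + b * (norm y)\<^sup>2) * a ^ (CARD('n) - 1)"
    by (subst prod.remove[of _ k]) (auto simp: card_Diff_singleton)
  finally show ?thesis by simp
qed

text \<open>The left side equals 1 at t = 0 and has derivative q - n there. Bernoulli's inequality
  replaces differentiation.\<close>

lemma linear_coefficient_le:
  fixes q :: real and n :: nat
  assumes "1 \<le> n" "0 \<le> q" and le: "\<And>t. 0 < t \<Longrightarrow> t < 1 \<Longrightarrow> (1 - t) ^ (n - 1) * (1 - t + t * q) \<le> 1"
  shows "q \<le> n"
proof (rule field_le_epsilon)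
  fix e :: real assume e: "0 < e"
  let ?a = "(real n - 1) * (q - 1)"
  \<comment> \<open>With this \<open>t\<close> the second-order remainder, \<open>?a * t\<close>
    after division by \<open>t\<close>, is at most \<open>e\<close>.\<close>
  define t where "t = min (1 / 2) (e / (\<bar>?a\<bar> + 1))"
  have t: "0 < t" "t < 1" using e by (auto simp: t_def)
  have "t * (\<bar>?a\<bar> + 1) \<le> e"
    using mult_right_mono[of t "e / (\<bar>?a\<bar> + 1)" "\<bar>?a\<bar> + 1"] by (simp add: t_def)
  moreover have "?a * t \<le> t * (\<bar>?a\<bar> + 1)" using t abs_ge_self[of ?a] by (simp add: mult.commute)
  ultimately have at: "?a * t \<le> e" by linarith
  have "1 - (real n - 1) * t \<le> (1 - t) ^ (n - 1)"
    using Bernoulli_inequality[of "- t" "n - 1"] t assms(1) by (simp add: of_nat_diff algebra_simps)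
  then have "(1 - (real n - 1) * t) * (1 - t + t * q) \<le> (1 - t) ^ (n - 1) * (1 - t + t * q)"
    using t assms(2) by (intro mult_right_mono) auto
  also have "\<dots> \<le> 1" using t le by simp
  finally have "t * (q - n) \<le> t * (?a * t)" by (simp add: algebra_simps power2_eq_square)
  then have "q - n \<le> ?a * t" using t by (simp add: mult_le_cancel_left)
  then show "q \<le> n + e" using at by linarith
qed

context
  fixes K :: "(real ^ 'n) set"
begin

text \<open>The second-moment matrices of finitely supported probability measures on
  \<open>K\<close>.\<close>

definition covariances where "covariances = convex hull (outer ` K)"

lemma covariances_explicit:
  assumes "M \<in> covariances"
  obtains X u where "finite X" "X \<subseteq> K" "\<forall>x\<in>X. 0 \<le> u x" "sum u X = 1" "\<forall>v. M *v v = (\<Sum>x\<in>X. (u x * (x \<bullet> v)) *\<^sub>R x)"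
proof -
  obtain S w where S: "finite S" "S \<subseteq> outer ` K" "\<forall>A\<in>S. 0 \<le> w A" "sum w S = 1" "(\<Sum>A\<in>S. w A *\<^sub>R A) = M"
    using assms unfolding covariances_def convex_hull_explicit by blast
  \<comment> \<open>\<open>outer\<close> identifies x and -x; one preimage per matrix is selected so
    that the weights can be carried by vectors.\<close>
  obtain X where X: "X \<subseteq> K" "inj_on outer X" "S = outer ` X"
    using S(2) unfolding subset_image_inj by blast
  show thesis
  proof (rule that[of X "w \<circ> outer"])
    show "finite X" using S(1) X finite_imageD by blast
    have "M *v v = (\<Sum>x\<in>X. ((w \<circ> outer) x * (x \<bullet> v)) *\<^sub>R x)" for v
    proof -
      have "M *v v = (\<Sum>x\<in>X. w (outer x) *\<^sub>R outer x) *v v"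
        using S(5) X by (simp add: sum.reindex)
      also have "\<dots> = (\<Sum>x\<in>X. (w (outer x) *\<^sub>R outer x) *v v)"
        by (rule sum_matrix_vector_mult)
      also have "\<dots> = (\<Sum>x\<in>X. ((w \<circ> outer) x * (x \<bullet> v)) *\<^sub>R x)"
        by (simp add: scaleR_matrix_vector_assoc[symmetric] outer_mult_vec)
      finally show ?thesis .
    qed
    then show "\<forall>v. M *v v = (\<Sum>x\<in>X. ((w \<circ> outer) x * (x \<bullet> v)) *\<^sub>R x)" by blast
  qed (use S X in \<open>auto simp: sum.reindex\<close>)
qed

end

text \<open>The Kiefer--Wolfowitz argument: a matrix of maximal determinant in the convex hull of the
  matrices \<open>x x\<^sup>T\<close>, \<open>x \<in> K\<close>, is a John decomposition after normalization; the first order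
  condition at the maximum is exactly the inclusion of \<open>K\<close> in the ellipsoid.\<close>

theorem john_position_exists:
  fixes K :: "(real ^ 'n) set"
  assumes K: "compact K" "span K = UNIV"
  obtains T where "posdef T" "john (inv T ` K)"
proof -
  let ?C = "covariances K" and ?N = "real CARD('n)"
  have "continuous_on K (outer :: real ^ 'n \<Rightarrow> _)"
    unfolding outer_def by (intro continuous_on_vec_lambda continuous_intros)
  then have C: "compact ?C" "convex ?C"
    unfolding covariances_def by (simp_all add: compact_convex_hull compact_continuous_image K(1) convex_convex_hull)
  have outerC: "outer x \<in> ?C" if "x \<in> K" for x
    using that unfolding covariances_def by (simp add: hull_inc)
  have sym: "symmetric_op (\<lambda>x. M *v x)" and psd: "0 \<le> (M *v v) \<bullet> v" if M: "M \<in> ?C" for M v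
  proof -
    obtain X u where X: "finite X" "X \<subseteq> K" "\<forall>x\<in>X. 0 \<le> u x" "sum u X = 1"
      "\<forall>v. M *v v = (\<Sum>x\<in>X. (u x * (x \<bullet> v)) *\<^sub>R x)"
      using covariances_explicit[OF M] by blast
    have "(M *v y) \<bullet> w = (\<Sum>x\<in>X. u x * (x \<bullet> y) * (x \<bullet> w))" for y w
      unfolding X(5)[rule_format] by (simp add: inner_sum_left)
    then have "(M *v y) \<bullet> w = (M *v w) \<bullet> y" for y w by (simp only: mult_ac)
    then have "(M *v y) \<bullet> w = y \<bullet> (M *v w)" for y w using inner_commute[of "M *v w" y] by simp
    then show "symmetric_op (\<lambda>x. M *v x)"
      by (simp add: symmetric_op_def matrix_vector_mul_linear)
    have "(M *v v) \<bullet> v = (\<Sum>x\<in>X. u x * (x \<bullet> v)\<^sup>2)"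
      unfolding X(5)[rule_format] by (simp add: inner_sum_left power2_eq_square mult.assoc)
    then show "0 \<le> (M *v v) \<bullet> v" using X(3) by (simp add: sum_nonneg)
  qed
  obtain Bs where Bs: "Bs \<subseteq> K" "independent Bs" "K \<subseteq> span Bs"
    using maximal_independent_subset[of K] by blast
  have sB: "span Bs = UNIV" using span_minimal[OF Bs(3) subspace_span] K(2) by auto
  have fB: "finite Bs" using Bs(2) by (rule independent_imp_finite)
  have "Bs \<noteq> {}"
  proof
    assume "Bs = {}"
    then have "(UNIV :: (real ^ 'n) set) = {0}" using sB by simp
    moreover have "axis k (1::real) \<noteq> (0 :: real ^ 'n)" for k by (simp add: axis_eq_0_iff)
    ultimately show False by blast
  qed
  \<comment> \<open>The average over a basis contained in \<open>K\<close> is positive definite, so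
    the maximal determinant is positive.\<close>
  define M0 :: "real ^ 'n ^ 'n" where "M0 = (\<Sum>b\<in>Bs. (1 / card Bs) *\<^sub>R outer b)"
  have M0C: "M0 \<in> ?C"
    unfolding M0_def using fB \<open>Bs \<noteq> {}\<close> Bs(1) outerC by (intro convex_sum C) auto
  have M0v: "(M0 *v v) \<bullet> v = (\<Sum>b\<in>Bs. (1 / card Bs) * (b \<bullet> v)\<^sup>2)" for v
  proof -
    have "M0 *v v = (\<Sum>b\<in>Bs. ((1 / card Bs) *\<^sub>R outer b) *v v)"
      unfolding M0_def by (rule sum_matrix_vector_mult)
    then show ?thesis
      by (simp add: scaleR_matrix_vector_assoc[symmetric] outer_mult_vec inner_sum_left power2_eq_square)
  qed
  have "posdef (\<lambda>x. M0 *v x)" unfolding posdef_def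
  proof (intro conjI allI impI)
    show "symmetric_op (\<lambda>x. M0 *v x)" using sym[OF M0C] .
    fix v :: "real ^ 'n" assume v: "v \<noteq> 0"
    have "\<exists>b\<in>Bs. b \<bullet> v \<noteq> 0"
    proof (rule ccontr)
      assume "\<not> ?thesis"
      then have "Bs \<subseteq> {x. v \<bullet> x = 0}" by (auto simp: inner_commute)
      then have "span Bs \<subseteq> {x. v \<bullet> x = 0}" by (rule span_minimal[OF _ subspace_hyperplane])
      then have "v \<bullet> v = 0" using sB by blast
      then show False using v by simp
    qed
    then obtain b where "b \<in> Bs" "b \<bullet> v \<noteq> 0" by blast
    then show "0 < (M0 *v v) \<bullet> v"
      unfolding M0v using fB \<open>Bs \<noteq> {}\<close> by (intro sum_pos2[of _ b]) (auto simp: card_gt_0_iff)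
  qed
  then have detM0: "0 < det M0" using det_posdef_pos by fastforce
  have "continuous_on ?C (det :: real ^ 'n ^ 'n \<Rightarrow> real)"
    unfolding det_def by (intro continuous_intros)
  then obtain M where M: "M \<in> ?C" and max: "\<And>A. A \<in> ?C \<Longrightarrow> det A \<le> det M"
    using continuous_attains_sup[OF C(1)] M0C by blast
  have detM: "0 < det M" using max[OF M0C] detM0 by linarith
  obtain X u where X: "finite X" "X \<subseteq> K" "\<forall>x\<in>X. 0 \<le> u x" "sum u X = 1"
    "\<forall>v. M *v v = (\<Sum>x\<in>X. (u x * (x \<bullet> v)) *\<^sub>R x)"
    using covariances_explicit[OF M] by blast
  have Mvv: "(M *v v) \<bullet> v = (\<Sum>x\<in>X. u x * (x \<bullet> v)\<^sup>2)" for v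
    unfolding X(5)[rule_format] by (simp add: inner_sum_left power2_eq_square mult.assoc)
  have pM: "posdef (\<lambda>x. M *v x)" unfolding posdef_def
  proof (intro conjI allI impI)
    show "symmetric_op (\<lambda>x. M *v x)" using sym[OF M] .
    fix v :: "real ^ 'n" assume v: "v \<noteq> 0"
    have "(M *v v) \<bullet> v \<noteq> 0"
    proof
      assume "(M *v v) \<bullet> v = 0"
      then have "\<forall>x\<in>X. u x * (x \<bullet> v)\<^sup>2 = 0"
        unfolding Mvv using X(1,3) by (subst (asm) sum_nonneg_eq_0_iff) auto
      then have "M *v v = 0" unfolding X(5)[rule_format] by (intro sum.neutral) auto
      moreover have "inj (\<lambda>x. M *v x)"
        using detM det_nz_iff_inj[of "\<lambda>x. M *v x"] by simp
      ultimately show False using v by (metis injD matrix_vector_mult_0_right)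
    qed
    then show "0 < (M *v v) \<bullet> v" using psd[OF M, of v] by linarith
  qed
  obtain R where R': "posdef R" "\<forall>x. R (R x) = M *v x" using posdef_sqrt[OF pM] by blast
  note R = R'(1) R'(2)[rule_format]
  have lR: "linear R" using R(1) by (rule posdefD)
  have iR: "posdef (inv R)" using R(1) by (rule posdef_inv)
  have RiR: "R (inv R x) = x" for x using posdef_bij[OF R(1)] by (simp add: bij_is_surj surj_f_inv_f)
  \<comment> \<open>Moving from \<open>M\<close> towards the matrix x x^T does not increase the
    determinant. Taking \<open>R\<close> out on both sides leaves the rank-one update by
    \<open>inv R x\<close>, and the first-order condition at t = 0 is the bound.\<close>
  have bound: "(norm (inv R x))\<^sup>2 \<le> ?N" if x: "x \<in> K" for x
  proof (rule linear_coefficient_le)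
    fix t :: real assume t: "0 < t" "t < 1"
    let ?y = "inv R x" and ?A = "(1 - t) *\<^sub>R M + t *\<^sub>R outer x"
    let ?h = "\<lambda>w. (1 - t) *\<^sub>R w + t *\<^sub>R (?y \<bullet> w) *\<^sub>R ?y"
    have lh: "linear ?h" by (rule linearI) (simp_all add: algebra_simps inner_simps)
    have "?A \<in> ?C" using t by (intro convexD C(2) M outerC x) auto
    then have "det ?A \<le> det M" by (rule max)
    moreover have "(R \<circ> (?h \<circ> R)) v = ?A *v v" for v
    proof -
      have "(R \<circ> (?h \<circ> R)) v = (1 - t) *\<^sub>R R (R v) + t *\<^sub>R (?y \<bullet> R v) *\<^sub>R R ?y"
        by (simp add: linear_add[OF lR] linear_scale[OF lR])
      also have "?y \<bullet> R v = x \<bullet> v" using posdefD(4)[OF R(1), of ?y v] RiR by simp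
      finally show ?thesis
        by (simp add: matrix_vector_mult_add_rdistrib scaleR_matrix_vector_assoc[symmetric] outer_mult_vec R(2) RiR)
    qed
    then have "R \<circ> (?h \<circ> R) = (\<lambda>v. ?A *v v)" by (rule ext)
    then have "matrix (R \<circ> (?h \<circ> R)) = ?A" by (simp only: matrix_of_matrix_vector_mul)
    then have "?A = matrix R ** (matrix ?h ** matrix R)"
      using matrix_compose[OF lR lh] matrix_compose[OF linear_compose[OF lR lh] lR] by simp
    then have "det ?A = det (matrix R) * (det (matrix ?h) * det (matrix R))" by (simp add: det_mul)
    moreover have "M = matrix R ** matrix R"
      using matrix_compose[OF lR lR] R(2) by (simp add: o_def)
    then have "det M = det (matrix R) * det (matrix R)" by (simp add: det_mul)
    ultimately have "det M * det (matrix ?h) \<le> det M * 1" by (simp add: mult_ac)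
    then have "det (matrix ?h) \<le> 1" using detM by (simp add: mult_le_cancel_left_pos)
    then show "(1 - t) ^ (CARD('n) - 1) * (1 - t + t * (norm ?y)\<^sup>2) \<le> 1"
      unfolding det_rank_one_update .
  qed auto
  \<comment> \<open>The factor sqrt N turns the bound N on squared norms into 1; the probability
    weights are multiplied by N to give total weight equal to the dimension.\<close>
  define T where "T = (\<lambda>x. sqrt ?N *\<^sub>R R x)"
  have N: "0 < ?N" by simp
  have "linear T" unfolding T_def by (rule linear_compose_scale_right[OF lR])
  moreover have "T x \<bullet> y = x \<bullet> T y" for x y using posdefD(4)[OF R(1), of x y] by (simp add: T_def)
  moreover have "0 < T x \<bullet> x" if "x \<noteq> 0" for x using posdefD(3)[OF R(1) that] by (simp add: T_def)
  ultimately have T: "posdef T" by (simp add: posdef_def symmetric_op_def)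
  have iT: "inv T x = (1 / sqrt ?N) *\<^sub>R inv R x" for x
  proof (rule inv_f_eq[OF bij_is_inj[OF posdef_bij[OF T]]])
    show "T ((1 / sqrt ?N) *\<^sub>R inv R x) = x" using N by (simp add: T_def linear_scale[OF lR] RiR)
  qed
  have "inj (inv T)" using posdef_bij[OF posdef_inv[OF T]] by (rule bij_is_inj)
  then have inj: "inj_on (inv T) X" by (rule inj_on_subset) simp
  have TiT: "T (inv T x) = x" for x using posdef_bij[OF T] by (simp add: bij_is_surj surj_f_inv_f)
  have "inv T ` K \<subseteq> cball 0 1"
  proof
    fix y assume "y \<in> inv T ` K"
    then obtain x where x: "x \<in> K" "y = inv T x" by blast
    have "norm (inv R x) \<le> sqrt ?N" using bound[OF x(1)] by (rule real_le_rsqrt)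
    moreover have "norm y = norm (inv R x) / sqrt ?N" unfolding x(2) iT by simp
    ultimately have "norm y \<le> 1" using N by (simp add: divide_le_eq_1)
    then show "y \<in> cball 0 1" by simp
  qed
  moreover have "frame (inv T ` X) (\<lambda>y. ?N * u (T y))"
    unfolding frame_def
  proof (intro conjI allI)
    show "finite (inv T ` X)" using X(1) by simp
    show "\<forall>x\<in>inv T ` X. 0 \<le> ?N * u (T x)" using X(3) by (simp add: TiT)
    show "(\<Sum>y\<in>inv T ` X. ?N * u (T y)) = DIM(real ^ 'n)"
      using X(4) by (simp add: sum.reindex inj TiT sum_distrib_left[symmetric])
    fix v
    let ?w = "inv R v"
    have "(\<Sum>y\<in>inv T ` X. ?N * u (T y) * (y \<bullet> v)\<^sup>2) = (\<Sum>x\<in>X. ?N * u x * (inv T x \<bullet> v)\<^sup>2)"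
      by (simp add: sum.reindex inj TiT)
    also have "\<dots> = (\<Sum>x\<in>X. u x * (x \<bullet> ?w)\<^sup>2)"
    proof (rule sum.cong[OF refl])
      fix x
      have "inv T x \<bullet> v = (1 / sqrt ?N) * (x \<bullet> ?w)" by (simp add: iT posdefD(4)[OF iR])
      then show "?N * u x * (inv T x \<bullet> v)\<^sup>2 = u x * (x \<bullet> ?w)\<^sup>2" by (simp add: power_divide)
    qed
    also have "\<dots> = R (R ?w) \<bullet> ?w" by (simp add: R(2) Mvv)
    also have "\<dots> = v \<bullet> v" using posdefD(4)[OF R(1), of v ?w] by (simp add: RiR)
    finally show "(\<Sum>y\<in>inv T ` X. ?N * u (T y) * (y \<bullet> v)\<^sup>2) = (norm v)\<^sup>2" by (simp add: dot_square_norm)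
  qed
  ultimately have "john (inv T ` K)" unfolding john_def using image_mono[OF X(2)] by (intro conjI exI)
  then show thesis by (rule that[OF T])
qed

section \<open>The Hausdorff topology on symmetric bodies\<close>

text \<open>A ball about \<open>x\<close> in \<open>Q\<close> is recentred at 0: \<open>y\<close> is
  the midpoint of \<open>x + y\<close> and \<open>- (x - y)\<close>.\<close>

lemma symmetric_body_cball:
  fixes Q :: "'a::euclidean_space set"
  assumes Q: "symmetric_body Q"
  obtains r where "0 < r" "cball 0 r \<subseteq> Q"
proof -
  obtain x where "x \<in> interior Q" using Q by (auto simp: symmetric_body_def)
  then obtain e where e: "0 < e" "cball x e \<subseteq> Q" by (auto simp: mem_interior_cball)
  have cv: "convex Q" and sm: "\<And>y. y \<in> Q \<Longrightarrow> - y \<in> Q" using Q by (auto simp: symmetric_body_def)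
  have "y \<in> Q" if "norm y \<le> e" for y
  proof -
    have "x + y \<in> Q" "x - y \<in> Q" using e(2) that by (auto simp: dist_norm)
    then have "x + y \<in> Q" "- (x - y) \<in> Q" using sm by blast+
    then have "(1 / 2) *\<^sub>R (x + y) + (1 / 2) *\<^sub>R (- (x - y)) \<in> Q" by (intro convexD[OF cv]) auto
    moreover have "(1 / 2) *\<^sub>R (x + y) + (1 / 2) *\<^sub>R (- (x - y)) = y"
      by (simp add: scaleR_add_right[symmetric] flip: scaleR_2)
    ultimately show ?thesis by simp
  qed
  then have "cball 0 e \<subseteq> Q" by auto
  then show thesis by (rule that[OF e(1)])
qed

lemma symmetric_body_bounds:
  fixes Q :: "'a::euclidean_space set"
  assumes Q: "symmetric_body Q"
  obtains r L where "0 < r" "0 < L" "cball 0 r \<subseteq> Q" "Q \<subseteq> cball 0 L"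
proof -
  obtain r where r: "0 < r" "cball 0 r \<subseteq> Q" using symmetric_body_cball[OF Q] by blast
  have "bounded Q" using Q by (simp add: symmetric_body_def compact_imp_bounded)
  then obtain L where "0 < L" "\<forall>x\<in>Q. norm x \<le> L" unfolding bounded_pos by blast
  then have "Q \<subseteq> cball 0 L" by auto
  with r \<open>0 < L\<close> show thesis using that[of r L] by simp
qed

lemma convex_combination_with_zero:
  assumes "convex P" "0 \<in> P" "x \<in> P" "y \<in> P" "0 \<le> a" "0 \<le> b" "a + b \<le> 1"
  shows "a *\<^sub>R x + b *\<^sub>R y \<in> P"
proof (cases "a + b = 0")
  case True
  then show ?thesis using assms by (simp add: add_nonneg_eq_0_iff)
next
  case False
  have "a / (a + b) + b / (a + b) = 1" using False by (metis add_divide_distrib divide_self)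
  then have "(a / (a + b)) *\<^sub>R x + (b / (a + b)) *\<^sub>R y \<in> P"
    by (rule convexD[OF assms(1,3,4), rotated 2]) (use assms(5,6) in simp_all)
  then have "(a + b) *\<^sub>R ((a / (a + b)) *\<^sub>R x + (b / (a + b)) *\<^sub>R y) + (1 - (a + b)) *\<^sub>R 0 \<in> P"
    by (rule convexD[OF assms(1) _ assms(2)]) (use assms(5-7) in simp_all)
  then show ?thesis using False by (simp add: scaleR_add_right)
qed

text \<open>Passes from additive to multiplicative closeness: y / s combines \<open>x\<close> with
  weight 1/s and (y - x) / (s - 1), a point of the inner ball, with weight (s - 1) / s.\<close>

lemma add_small_in_scaled:
  fixes P :: "'a::euclidean_space set"
  assumes P: "convex P" "cball 0 r \<subseteq> P" "0 < r" and s: "1 < s" and x: "x \<in> P" and y: "norm (y - x) \<le> r * (s - 1)"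
  shows "y \<in> (*\<^sub>R) s ` P"
proof -
  let ?z = "(1 / (s - 1)) *\<^sub>R (y - x)"
  have "norm ?z \<le> r" using y s by (simp add: divide_le_eq mult.commute)
  then have "?z \<in> P" using P(2) by auto
  moreover have "0 \<in> P" using P(2,3) by auto
  moreover have "1 / s + (s - 1) / s \<le> 1" using s by (simp add: field_simps)
  ultimately have "(1 / s) *\<^sub>R x + ((s - 1) / s) *\<^sub>R ?z \<in> P"
    using s x by (intro convex_combination_with_zero[OF P(1)]) auto
  moreover have "(1 / s) *\<^sub>R x + ((s - 1) / s) *\<^sub>R ?z = (1 / s) *\<^sub>R y"
    using s by (simp add: scaleR_diff_right)
  ultimately show ?thesis using s by (intro image_eqI[of _ _ "(1 / s) *\<^sub>R y"]) auto
qed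

lemma hausdorff_dist_le:
  assumes "0 \<le> e" "\<forall>a\<in>A. \<exists>b\<in>B. dist a b \<le> e" "\<forall>b\<in>B. \<exists>a\<in>A. dist a b \<le> e"
  shows "hausdorff_dist A B \<le> e"
proof (cases "A \<noteq> {} \<and> B \<noteq> {} \<and> bounded A \<and> bounded B")
  case True
  then show ?thesis using hausdorff_dist_set[of A B] assms by (auto intro: cInf_lower)
next
  case False
  then have "hausdorff_dist A B = 0" unfolding hausdorff_dist_def by auto
  then show ?thesis using assms by simp
qed

lemma symmetric_body_compact_nonempty: "symmetric_body Q \<Longrightarrow> compact Q \<and> Q \<noteq> {}"
  by (auto simp: symmetric_body_def)

text \<open>One inclusion uses the inner ball of \<open>P\<close>. For the other, no inner ball of
  \<open>Q\<close> is known in advance; instead a hyperplane separating x / s from \<open>Q\<close>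
  is tested against the support function of \<open>P\<close>.\<close>

lemma hausdorff_dist_imp_body_near:
  fixes P :: "'a::euclidean_space set"
  assumes P: "symmetric_body P" and s: "1 < s"
  obtains d where "0 < d" "\<And>Q. symmetric_body Q \<Longrightarrow> hausdorff_dist P Q < d \<Longrightarrow> body_near s P Q"
proof -
  obtain r where r: "0 < r" "cball 0 r \<subseteq> P" using symmetric_body_cball[OF P] by blast
  have P': "compact P" "convex P" "P \<noteq> {}" using P by (auto simp: symmetric_body_def)
  \<comment> \<open>Moving a point by \<open>d\<close> lowers a linear functional by at most the
    fraction 1 - 1/s of its support on \<open>P\<close>. Also d \<le> r (s - 1), as the first
    inclusion requires.\<close>
  define d where "d = r * (1 - 1 / s)"
  have d: "0 < d" using r s by (simp add: d_def)
  have ds: "d \<le> r * (s - 1)"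
  proof -
    have "1 - 1 / s \<le> s - 1" using s sum_power2_ge_zero[of "s - 1" 0] by (simp add: field_simps power2_eq_square)
    then show ?thesis unfolding d_def using r(1) by (intro mult_left_mono) auto
  qed
  show thesis
  proof (rule that[OF d])
    fix Q :: "'a set" assume Q: "symmetric_body Q" and less: "hausdorff_dist P Q < d"
    have Q': "compact Q" "convex Q" "Q \<noteq> {}" using Q by (auto simp: symmetric_body_def)
    obtain e where e: "e < d" "0 \<le> e" "\<forall>a\<in>P. \<exists>b\<in>Q. dist a b \<le> e" "\<forall>b\<in>Q. \<exists>a\<in>P. dist a b \<le> e"
      using hausdorff_dist_lessD[OF P'(3) Q'(3) _ _ less] P' Q' by (auto simp: compact_imp_bounded)
    have "Q \<subseteq> (*\<^sub>R) s ` P"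
    proof
      fix q assume "q \<in> Q"
      then obtain p where p: "p \<in> P" "dist p q \<le> e" using e(4) by blast
      then have "norm (q - p) \<le> r * (s - 1)" using e(1) ds by (simp add: dist_norm norm_minus_commute)
      then show "q \<in> (*\<^sub>R) s ` P" using add_small_in_scaled[OF P'(2) r(2,1) s p(1)] by blast
    qed
    moreover have "(1 / s) *\<^sub>R x \<in> Q" if x: "x \<in> P" for x
    proof (rule ccontr)
      assume "(1 / s) *\<^sub>R x \<notin> Q"
      then obtain a b where ab: "a \<bullet> ((1 / s) *\<^sub>R x) < b" "\<And>q. q \<in> Q \<Longrightarrow> b < a \<bullet> q"
        using separating_hyperplane_closed_point[of Q "(1 / s) *\<^sub>R x"] Q' by (auto simp: compact_imp_closed)
      define w where "w = - a"
      have w: "w \<bullet> q < w \<bullet> x / s" if "q \<in> Q" for q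
        using ab(1) ab(2)[OF that] by (simp add: w_def)
      have "continuous_on P (\<lambda>p. w \<bullet> p)" by (intro continuous_intros)
      then obtain p where p: "p \<in> P" "\<And>y. y \<in> P \<Longrightarrow> w \<bullet> y \<le> w \<bullet> p"
        using continuous_attains_sup[OF P'(1,3)] by blast
      have rw: "r * norm w \<le> w \<bullet> p"
      proof (cases "w = 0")
        case False
        have "(r / norm w) *\<^sub>R w \<in> P" using r False by auto
        then have "w \<bullet> ((r / norm w) *\<^sub>R w) \<le> w \<bullet> p" by (rule p(2))
        then show ?thesis using False by (simp add: dot_square_norm power2_eq_square)
      qed simp
      obtain q where q: "q \<in> Q" "dist p q \<le> e" using e(3) p(1) by blast
      have "w \<bullet> p - w \<bullet> q \<le> norm w * norm (p - q)"
        using norm_cauchy_schwarz[of w "p - q"] by (simp add: inner_diff_right)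
      also have "\<dots> \<le> norm w * d" using q(2) e(1) by (intro mult_left_mono) (auto simp: dist_norm)
      also have "\<dots> \<le> (w \<bullet> p) * (1 - 1 / s)"
        using mult_right_mono[OF rw, of "1 - 1 / s"] s by (simp add: d_def mult_ac)
      finally have "w \<bullet> p / s \<le> w \<bullet> q" by (simp add: algebra_simps)
      moreover have "w \<bullet> x / s \<le> w \<bullet> p / s" using p(2)[OF x] s by (simp add: divide_right_mono)
      ultimately show False using w[OF q(1)] by linarith
    qed
    then have "P \<subseteq> (*\<^sub>R) s ` Q" using s by (auto intro!: image_eqI[of _ _ "(1 / s) *\<^sub>R _"])
    ultimately show "body_near s P Q" by (simp add: body_near_def)
  qed
qed

lemma body_near_imp_hausdorff_dist:
  fixes P :: "'a::euclidean_space set"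
  assumes P: "symmetric_body P" and e: "0 < e"
  obtains s where "1 < s" "\<And>Q. body_near s P Q \<Longrightarrow> hausdorff_dist P Q < e"
proof -
  obtain L where L: "0 < L" "P \<subseteq> cball 0 L" using symmetric_body_bounds[OF P] by metis
  \<comment> \<open>Scaling by s moves a point of norm at most \<open>L\<close> by at most (s - 1) L
    = e / 2.\<close>
  define s where "s = 1 + e / (2 * L)"
  have s: "1 < s" using L e by (simp add: s_def)
  have sL: "(s - 1) * L = e / 2" using L by (simp add: s_def)
  show thesis
  proof (rule that[OF s])
    fix Q assume near: "body_near s P Q"
    have "hausdorff_dist P Q \<le> e / 2"
    proof (rule hausdorff_dist_le)
      show "\<forall>a\<in>P. \<exists>b\<in>Q. dist a b \<le> e / 2"
      proof
        fix a assume a: "a \<in> P"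
        then obtain b where b: "b \<in> Q" "a = s *\<^sub>R b" using near by (auto simp: body_near_def)
        have "dist a b = (s - 1) * norm b"
          using s norm_scaleR[of "s - 1" b] by (simp add: dist_norm b(2) scaleR_diff_left)
        also have "norm b \<le> norm a" using s by (simp add: b(2) mult_le_cancel_right1)
        then have "(s - 1) * norm b \<le> (s - 1) * L" using s L a by (intro mult_left_mono) auto
        finally show "\<exists>b\<in>Q. dist a b \<le> e / 2" using b(1) sL by auto
      qed
      show "\<forall>b\<in>Q. \<exists>a\<in>P. dist a b \<le> e / 2"
      proof
        fix b assume "b \<in> Q"
        then obtain a where a: "a \<in> P" "b = s *\<^sub>R a" using near by (auto simp: body_near_def)
        have "dist a b = (s - 1) * norm a"
          using s norm_scaleR[of "s - 1" a] by (simp add: dist_norm a(2) scaleR_diff_left norm_minus_commute)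
        also have "\<dots> \<le> (s - 1) * L" using s L a by (intro mult_left_mono) auto
        finally show "\<exists>a\<in>P. dist a b \<le> e / 2" using a(1) sL by auto
      qed
    qed (use e in simp)
    then show "hausdorff_dist P Q < e" using e by simp
  qed
qed

section \<open>Continuity expressed through scaled inclusions\<close>

lemma topspace_hausdorff: "topspace hausdorff_topology = {K. compact K \<and> K \<noteq> {}}"
  unfolding hausdorff_topology_def by (rule Metric_space.topspace_mtopology[OF Metric_space_hausdorff])

lemma openin_hausdorff_body_near:
  fixes P :: "'a::euclidean_space set"
  assumes "openin hausdorff_topology U" "P \<in> U" and P: "symmetric_body P"
  obtains s where "1 < s" "\<And>Q. symmetric_body Q \<Longrightarrow> body_near s P Q \<Longrightarrow> Q \<in> U"
proof -
  obtain e where e: "0 < e" "Metric_space.mball {K. compact K \<and> K \<noteq> {}} hausdorff_dist P e \<subseteq> U"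
    using assms unfolding hausdorff_topology_def Metric_space.openin_mtopology[OF Metric_space_hausdorff] by blast
  obtain s where s: "1 < s" "\<And>Q. body_near s P Q \<Longrightarrow> hausdorff_dist P Q < e"
    using body_near_imp_hausdorff_dist[OF P e(1)] by blast
  show thesis
  proof (rule that[OF s(1)])
    fix Q :: "'a set" assume "symmetric_body Q" "body_near s P Q"
    then have "Q \<in> Metric_space.mball {K. compact K \<and> K \<noteq> {}} hausdorff_dist P e"
      using s(2) symmetric_body_compact_nonempty[OF P] symmetric_body_compact_nonempty
      by (simp add: Metric_space.in_mball[OF Metric_space_hausdorff])
    then show "Q \<in> U" using e(2) by blast
  qed
qed

lemma body_near_openin_hausdorff:
  fixes P :: "'a::euclidean_space set"
  assumes P: "symmetric_body P" and s: "1 < s"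
  obtains U where "openin hausdorff_topology U" "P \<in> U" "\<And>Q. Q \<in> U \<Longrightarrow> symmetric_body Q \<Longrightarrow> body_near s P Q"
proof -
  obtain d where d: "0 < d" "\<And>Q. symmetric_body Q \<Longrightarrow> hausdorff_dist P Q < d \<Longrightarrow> body_near s P Q"
    using hausdorff_dist_imp_body_near[OF P s] by blast
  let ?U = "Metric_space.mball {K. compact K \<and> K \<noteq> {}} hausdorff_dist P d"
  show thesis
  proof (rule that)
    show "openin hausdorff_topology ?U" unfolding hausdorff_topology_def
      by (rule Metric_space.openin_mball[OF Metric_space_hausdorff])
    show "P \<in> ?U" using symmetric_body_compact_nonempty[OF P] d(1)
      by (simp add: Metric_space.centre_in_mball_iff[OF Metric_space_hausdorff])
    show "body_near s P Q" if "Q \<in> ?U" "symmetric_body Q" for Q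
      using that d(2) by (simp add: Metric_space.in_mball[OF Metric_space_hausdorff])
  qed
qed

lemma topspace_subtopology_hausdorff:
  "\<A> \<subseteq> Collect symmetric_body \<Longrightarrow> topspace (subtopology hausdorff_topology \<A>) = \<A>"
  unfolding topspace_subtopology topspace_hausdorff using symmetric_body_compact_nonempty by blast

text \<open>The constant \<open>t\<close> may depend on \<open>P\<close>: continuity is checked
  pointwise.\<close>

lemma continuous_map_body_nearI:
  fixes \<A> :: "'a::euclidean_space set set" and \<B> :: "'b::euclidean_space set set"
  assumes A: "\<A> \<subseteq> Collect symmetric_body" and B: "\<B> \<subseteq> Collect symmetric_body"
    and f: "\<And>P. P \<in> \<A> \<Longrightarrow> f P \<in> \<B>"
    and near: "\<And>P s. P \<in> \<A> \<Longrightarrow> 1 < s \<Longrightarrow> \<exists>t>1. \<forall>Q\<in>\<A>. body_near t P Q \<longrightarrow> body_near s (f P) (f Q)"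
  shows "continuous_map (subtopology hausdorff_topology \<A>) (subtopology hausdorff_topology \<B>) f"
  unfolding continuous_map_eq_topcontinuous_at topcontinuous_at_def topspace_subtopology_hausdorff[OF A]
    topspace_subtopology_hausdorff[OF B]
proof (intro ballI conjI allI impI funcsetI)
  fix P V assume P: "P \<in> \<A>" and "openin (subtopology hausdorff_topology \<B>) V \<and> f P \<in> V"
  then obtain W where W: "openin hausdorff_topology W" "V = W \<inter> \<B>" "f P \<in> W" by (auto simp: openin_subtopology)
  have sP: "symmetric_body P" "symmetric_body (f P)" using A B f P by auto
  obtain s where s: "1 < s" "\<And>Q. symmetric_body Q \<Longrightarrow> body_near s (f P) Q \<Longrightarrow> Q \<in> W"
    using openin_hausdorff_body_near[OF W(1,3) sP(2)] by blast
  obtain t where t: "1 < t" "\<forall>Q\<in>\<A>. body_near t P Q \<longrightarrow> body_near s (f P) (f Q)" using near[OF P s(1)] by blast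
  obtain U where U: "openin hausdorff_topology U" "P \<in> U" "\<And>Q. Q \<in> U \<Longrightarrow> symmetric_body Q \<Longrightarrow> body_near t P Q"
    using body_near_openin_hausdorff[OF sP(1) t(1)] by blast
  have "f Q \<in> V" if "Q \<in> U \<inter> \<A>" for Q
  proof -
    have "symmetric_body Q" "symmetric_body (f Q)" "f Q \<in> \<B>" using that A B f by auto
    then show ?thesis using that U(3) t(2) s(2) W(2) by blast
  qed
  moreover have "openin (subtopology hausdorff_topology \<A>) (U \<inter> \<A>)" using U(1) openin_subtopology by blast
  ultimately show "\<exists>U. openin (subtopology hausdorff_topology \<A>) U \<and> P \<in> U \<and> (\<forall>y\<in>U. f y \<in> V)"
    using P U(2) by blast
qed (use f in auto)

lemma continuous_map_prod_body_nearI: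
  fixes \<A> :: "'a::euclidean_space set set" and \<B> :: "'b::euclidean_space set set" and \<C> :: "'c::euclidean_space set set"
  assumes A: "\<A> \<subseteq> Collect symmetric_body" and B: "\<B> \<subseteq> Collect symmetric_body" and C: "\<C> \<subseteq> Collect symmetric_body"
    and f: "\<And>P E. P \<in> \<A> \<Longrightarrow> E \<in> \<B> \<Longrightarrow> f (P, E) \<in> \<C>"
    and near: "\<And>P E s. P \<in> \<A> \<Longrightarrow> E \<in> \<B> \<Longrightarrow> 1 < s \<Longrightarrow>
      \<exists>t>1. \<forall>Q\<in>\<A>. \<forall>F\<in>\<B>. body_near t P Q \<longrightarrow> body_near t E F \<longrightarrow> body_near s (f (P, E)) (f (Q, F))"
  shows "continuous_map (prod_topology (subtopology hausdorff_topology \<A>) (subtopology hausdorff_topology \<B>))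
    (subtopology hausdorff_topology \<C>) f"
  unfolding continuous_map_eq_topcontinuous_at topcontinuous_at_def topspace_prod_topology
    topspace_subtopology_hausdorff[OF A] topspace_subtopology_hausdorff[OF B] topspace_subtopology_hausdorff[OF C]
proof (intro ballI conjI allI impI funcsetI)
  fix p V assume p: "p \<in> \<A> \<times> \<B>" and V: "openin (subtopology hausdorff_topology \<C>) V \<and> f p \<in> V"
  obtain P E where PE: "p = (P, E)" "P \<in> \<A>" "E \<in> \<B>" using p by auto
  obtain W where W: "openin hausdorff_topology W" "V = W \<inter> \<C>" "f (P, E) \<in> W"
    using V PE(1) by (auto simp: openin_subtopology)
  have sP: "symmetric_body P" "symmetric_body E" "symmetric_body (f (P, E))"
    using A B C f[OF PE(2,3)] PE by auto
  obtain s where s: "1 < s" "\<And>Q. symmetric_body Q \<Longrightarrow> body_near s (f (P, E)) Q \<Longrightarrow> Q \<in> W"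
    using openin_hausdorff_body_near[OF W(1,3) sP(3)] by blast
  obtain t where t: "1 < t" "\<forall>Q\<in>\<A>. \<forall>F\<in>\<B>. body_near t P Q \<longrightarrow> body_near t E F \<longrightarrow> body_near s (f (P, E)) (f (Q, F))"
    using near[OF PE(2,3) s(1)] by blast
  obtain U1 where U1: "openin hausdorff_topology U1" "P \<in> U1" "\<And>Q. Q \<in> U1 \<Longrightarrow> symmetric_body Q \<Longrightarrow> body_near t P Q"
    using body_near_openin_hausdorff[OF sP(1) t(1)] by blast
  obtain U2 where U2: "openin hausdorff_topology U2" "E \<in> U2" "\<And>Q. Q \<in> U2 \<Longrightarrow> symmetric_body Q \<Longrightarrow> body_near t E Q"
    using body_near_openin_hausdorff[OF sP(2) t(1)] by blast
  let ?U = "(U1 \<inter> \<A>) \<times> (U2 \<inter> \<B>)"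
  have "f q \<in> V" if q: "q \<in> ?U" for q
  proof -
    obtain Q F where QF: "q = (Q, F)" "Q \<in> U1" "Q \<in> \<A>" "F \<in> U2" "F \<in> \<B>" using q by auto
    have "symmetric_body Q" "symmetric_body F" "symmetric_body (f (Q, F))" "f (Q, F) \<in> \<C>"
      using QF A B C f[of Q F] by auto
    moreover from this have "body_near t P Q" "body_near t E F" using QF U1(3) U2(3) by auto
    then have "body_near s (f (P, E)) (f (Q, F))" using t(2) QF by auto
    ultimately show ?thesis using s(2) W(2) QF(1) by simp
  qed
  moreover have "openin (prod_topology (subtopology hausdorff_topology \<A>) (subtopology hausdorff_topology \<B>)) ?U"
    unfolding openin_prod_Times_iff using U1(1) U2(1) by (auto simp: openin_subtopology)
  moreover have "p \<in> ?U" using PE U1(2) U2(2) by simp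
  ultimately show "\<exists>U. openin (prod_topology (subtopology hausdorff_topology \<A>) (subtopology hausdorff_topology \<B>)) U \<and>
      p \<in> U \<and> (\<forall>y\<in>U. f y \<in> V)"
    by (intro exI[of _ ?U] conjI ballI)
next
  fix p assume "p \<in> \<A> \<times> \<B>"
  then show "f p \<in> \<C>" using f by (cases p) simp
qed

text \<open>The body is fixed before the maps, so its inner and outer radii can enter the
  constant.\<close>

lemma body_near_near_identity:
  fixes P :: "'a::euclidean_space set"
  assumes P: "symmetric_body P" and s: "1 < s"
  obtains h where "0 < h"
    "\<And>A :: 'a \<Rightarrow> 'a. linear A \<Longrightarrow> bij A \<Longrightarrow> (\<And>u. norm (A u - u) \<le> h * norm u) \<Longrightarrow> body_near s P (A ` P)"
proof -
  obtain r L where b: "0 < r" "0 < L" "cball 0 r \<subseteq> P" "P \<subseteq> cball 0 L" using symmetric_body_bounds[OF P] by blast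
  have cv: "convex P" using P by (simp add: symmetric_body_def)
  \<comment> \<open>The bound 1/2 controls preimages: |y| is at most twice |A y|, so all points
    involved have norm at most 2 L.\<close>
  define h where "h = min (1 / 2) (r * (s - 1) / (2 * L))"
  have h: "0 < h" "h \<le> 1 / 2" using b s by (auto simp: h_def)
  have "h \<le> r * (s - 1) / (2 * L)" by (simp add: h_def)
  then have hL: "h * (2 * L) \<le> r * (s - 1)" using b by (simp add: field_simps)
  show thesis
  proof (rule that[OF h(1)])
    fix A :: "'a \<Rightarrow> 'a" assume A: "linear A" "bij A" and small: "\<And>u. norm (A u - u) \<le> h * norm u"
    have "A ` P \<subseteq> (*\<^sub>R) s ` P"
    proof clarify
      fix x assume x: "x \<in> P"
      have "h * norm x \<le> h * (2 * L)" using x b h by (intro mult_left_mono) auto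
      then have "norm (A x - x) \<le> r * (s - 1)" using small[of x] hL by linarith
      then show "A x \<in> (*\<^sub>R) s ` P" by (rule add_small_in_scaled[OF cv b(3,1) s x])
    qed
    moreover have "P \<subseteq> (*\<^sub>R) s ` A ` P"
    proof
      fix x assume x: "x \<in> P"
      obtain y where y: "x = A y" using A(2) by (metis bij_pointE)
      have "norm y \<le> norm x + h * norm y"
        using small[of y] norm_triangle_ineq4[of "A y" "A y - y"] by (simp add: y)
      also have "h * norm y \<le> 1 / 2 * norm y" using h by (intro mult_right_mono) auto
      finally have "norm y \<le> 2 * L" using x b(4) by (auto simp: subset_iff)
      then have "h * norm y \<le> h * (2 * L)" using h by (intro mult_left_mono) auto
      then have "norm (y - x) \<le> r * (s - 1)" using small[of y] hL by (simp add: y norm_minus_commute)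
      then obtain z where "z \<in> P" "y = s *\<^sub>R z" using add_small_in_scaled[OF cv b(3,1) s x] by blast
      then show "x \<in> (*\<^sub>R) s ` A ` P" using y linear_scale[OF A(1)] by auto
    qed
    ultimately show "body_near s P (A ` P)" by (simp add: body_near_def)
  qed
qed

lemma square_perturbation:
  assumes "0 < (h::real)" "0 < k"
  obtains t where "1 < t" "(t\<^sup>2 - 1) * k \<le> h"
proof -
  \<comment> \<open>For e at most 1, (1 + e)^2 - 1 is at most 3 e.\<close>
  define e where "e = min 1 (h / (3 * k))"
  have e: "0 < e" "e \<le> 1" using assms by (auto simp: e_def)
  have "e \<le> h / (3 * k)" by (simp add: e_def)
  then have "3 * e * k \<le> h" using assms by (simp add: field_simps)
  moreover have "((1 + e)\<^sup>2 - 1) * k \<le> 3 * e * k"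
    using e assms mult_left_mono[of e 1 e] by (intro mult_right_mono) (auto simp: power2_eq_square algebra_simps)
  ultimately show thesis using that[of "1 + e"] e by linarith
qed

text \<open>Close ellipsoids have close positive definite roots by
  \<open>posdef_diff_norm_le\<close>, so the quotient of the roots is close to the identity. The
  inverse quotient needs no new estimate: its inverse is applied to the first relation.\<close>

lemma body_near_posdef_quotient:
  fixes P :: "'a::euclidean_space set"
  assumes R: "posdef R" and P: "symmetric_body P" and s: "1 < s"
  obtains t where "1 < t"
    "\<And>S. posdef S \<Longrightarrow> body_near t (R ` cball 0 1) (S ` cball 0 1) \<Longrightarrow>
      body_near s P ((inv R \<circ> S) ` P) \<and> body_near s P ((inv S \<circ> R) ` P)"
proof -
  obtain h where h: "0 < h"
    "\<And>A :: 'a \<Rightarrow> 'a. linear A \<Longrightarrow> bij A \<Longrightarrow> (\<And>u. norm (A u - u) \<le> h * norm u) \<Longrightarrow> body_near s P (A ` P)"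
    using body_near_near_identity[OF P s] by blast
  obtain c where c: "0 < c" "\<And>x. c * (norm x)\<^sup>2 \<le> R x \<bullet> x" using posdef_lower_bound[OF R] by blast
  have iR: "posdef (inv R)" by (rule posdef_inv[OF R])
  have bR: "bij R" by (rule posdef_bij[OF R])
  obtain L where L: "0 < L" "\<And>x. norm (R x) \<le> L * norm x"
    using linear_bounded_pos[OF posdefD(2)[OF R]] by blast
  obtain M where M: "0 < M" "\<And>x. norm (inv R x) \<le> M * norm x"
    using linear_bounded_pos[OF posdefD(2)[OF iR]] by blast
  \<comment> \<open>The factor collects the operator bound \<open>M\<close> of \<open>inv R\<close>,
    the bound \<open>L\<close> of \<open>R\<close> (squared, from comparing squared norms) and the
    lower bound \<open>c\<close> of \<open>R\<close>.\<close>
  obtain t where t: "1 < t" "(t\<^sup>2 - 1) * (M * L\<^sup>2 / c) \<le> h"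
    using square_perturbation[OF h(1), of "M * L\<^sup>2 / c"] M L c by auto
  show thesis
  proof (rule that[OF t(1)])
    fix S :: "'a \<Rightarrow> 'a" assume S: "posdef S" and near: "body_near t (R ` cball 0 1) (S ` cball 0 1)"
    have SR: "norm (S u) \<le> t * norm (R u)" and RS: "norm (R u) \<le> t * norm (S u)" for u
      using posdef_cball_subset[OF R S, of t u] posdef_cball_subset[OF S R, of t u] near t(1)
      by (auto simp: body_near_def)
    have t2: "1 < t\<^sup>2" using t(1) by (simp add: one_less_power)
    have "\<bar>(norm (S u))\<^sup>2 - (norm (R u))\<^sup>2\<bar> \<le> ((t\<^sup>2 - 1) * L\<^sup>2) * (norm u)\<^sup>2" for u
    proof -
      have 1: "(norm (S u))\<^sup>2 \<le> t\<^sup>2 * (norm (R u))\<^sup>2" "(norm (R u))\<^sup>2 \<le> t\<^sup>2 * (norm (S u))\<^sup>2"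
        using power_mono[OF SR[of u], of 2] power_mono[OF RS[of u], of 2] by (simp_all add: power_mult_distrib)
      have "(norm (R u))\<^sup>2 - (norm (S u))\<^sup>2 \<le> (t\<^sup>2 - 1) * (norm (R u))\<^sup>2"
      proof (cases "norm (S u) \<le> norm (R u)")
        case True
        then have "(t\<^sup>2 - 1) * (norm (S u))\<^sup>2 \<le> (t\<^sup>2 - 1) * (norm (R u))\<^sup>2"
          using t2 by (intro mult_left_mono power_mono) auto
        then show ?thesis using 1(2) by (simp add: algebra_simps)
      next
        case False
        then have "(norm (R u))\<^sup>2 \<le> (norm (S u))\<^sup>2" by (intro power_mono) auto
        moreover have "0 \<le> (t\<^sup>2 - 1) * (norm (R u))\<^sup>2" using t2 by (intro mult_nonneg_nonneg) auto
        ultimately show ?thesis by linarith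
      qed
      then have "\<bar>(norm (S u))\<^sup>2 - (norm (R u))\<^sup>2\<bar> \<le> (t\<^sup>2 - 1) * (norm (R u))\<^sup>2"
        using 1(1) by (simp add: algebra_simps abs_le_iff)
      also have "\<dots> \<le> (t\<^sup>2 - 1) * (L * norm u)\<^sup>2"
        using t2 L(2)[of u] by (intro mult_left_mono power_mono) auto
      finally show ?thesis by (simp add: power_mult_distrib mult.assoc)
    qed
    then have diff: "norm (S u - R u) \<le> (t\<^sup>2 - 1) * L\<^sup>2 / c * norm u" for u
      by (rule posdef_diff_norm_le[OF R S c])
    let ?A = "inv R \<circ> S"
    have A: "linear ?A" "bij ?A"
      using linear_compose[OF posdefD(2)[OF S] posdefD(2)[OF iR]] bij_comp[OF posdef_bij[OF S] posdef_bij[OF iR]] by auto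
    have near1: "body_near s P (?A ` P)"
    proof (rule h(2)[OF A])
      fix u
      have "?A u - u = inv R (S u - R u)"
        using bR by (simp add: linear_diff[OF posdefD(2)[OF iR]] bij_is_inj)
      then have "norm (?A u - u) \<le> M * norm (S u - R u)" using M(2) by metis
      also have "\<dots> \<le> M * ((t\<^sup>2 - 1) * L\<^sup>2 / c * norm u)" using M(1) diff by (intro mult_left_mono) auto
      also have "\<dots> = (t\<^sup>2 - 1) * (M * L\<^sup>2 / c) * norm u" by simp
      also have "\<dots> \<le> h * norm u" using t(2) by (intro mult_right_mono) auto
      finally show "norm (?A u - u) \<le> h * norm u" .
    qed
    have "inv ?A = inv S \<circ> R"
      using o_inv_distrib[OF posdef_bij[OF iR] posdef_bij[OF S]] bR by (simp add: inv_inv_eq)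
    moreover have "inv ?A ` ?A ` P = P" using A(2) by (simp only: bij_is_inj image_inv_f_f)
    then have "body_near s (inv ?A ` P) P" using body_near_linear_image[OF linear_inv_bij[OF A] near1] by simp
    ultimately show "body_near s P ((inv R \<circ> S) ` P) \<and> body_near s P ((inv S \<circ> R) ` P)"
      using near1 by (simp add: body_near_sym)
  qed
qed

section \<open>Bodies in the factor spaces\<close>

abbreviation coord :: "(nat \<Rightarrow>\<^sub>0 real) \<Rightarrow> nat \<Rightarrow> real" where "coord \<equiv> Poly_Mapping.lookup"

lemma coord_scaleR [simp]: "coord (r *\<^sub>R x) k = r * coord x k"
proof -
  have "{i. r *\<^sub>R coord x i \<noteq> 0} \<subseteq> Poly_Mapping.keys x" by (auto simp: in_keys_iff)
  then have "finite {i. r *\<^sub>R coord x i \<noteq> 0}" by (rule finite_subset) simp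
  then show ?thesis by (simp add: scaleR_poly_mapping_def Abs_poly_mapping_inverse)
qed

lemma euclid_iff: "x \<in> euclid n \<longleftrightarrow> (\<forall>k\<ge>n. coord x k = 0)"
  unfolding euclid_def by (auto simp: subset_iff in_keys_iff) (meson leI)

lemma euclid_eqI: "x \<in> euclid n \<Longrightarrow> y \<in> euclid n \<Longrightarrow> (\<And>k. k < n \<Longrightarrow> coord x k = coord y k) \<Longrightarrow> x = y"
  by (rule poly_mapping_eqI) (metis euclid_iff not_le)

lemma euclid_scaleR: "x \<in> euclid n \<Longrightarrow> r *\<^sub>R x \<in> euclid n"
  by (simp add: euclid_iff)

lemma euclid_add: "x \<in> euclid n \<Longrightarrow> y \<in> euclid n \<Longrightarrow> x + y \<in> euclid n"
  by (simp add: euclid_iff lookup_add)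

lemma euclid_uminus: "x \<in> euclid n \<Longrightarrow> - x \<in> euclid n"
  by (simp add: euclid_iff)

lemma euclid_0: "0 \<in> euclid n"
  by (simp add: euclid_iff)

definition euclid_vec :: "nat \<Rightarrow> (nat \<Rightarrow> real) \<Rightarrow> nat \<Rightarrow>\<^sub>0 real" where
  "euclid_vec n f = (\<Sum>k<n. f k *\<^sub>R Poly_Mapping.single k 1)"

lemma coord_euclid_vec: "coord (euclid_vec n f) k = (if k < n then f k else 0)"
proof -
  have "coord (euclid_vec n f) k = (\<Sum>j<n. if j = k then f k else 0)"
    unfolding euclid_vec_def lookup_sum by (intro sum.cong) (auto simp: lookup_single)
  then show ?thesis by simp
qed

lemma euclid_vec_in_euclid: "euclid_vec n f \<in> euclid n"
  by (simp add: euclid_iff coord_euclid_vec)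

lemma dot_scaleR_left: "dot n (r *\<^sub>R x) y = r * dot n x y"
  by (simp add: dot_def sum_distrib_left mult.assoc)

lemma dot_scaleR_right: "dot n x (r *\<^sub>R y) = r * dot n x y"
  by (simp add: dot_def sum_distrib_left mult_ac)

lemma dot_uminus_left: "dot n (- x) y = - dot n x y"
  by (simp add: dot_def sum_negf)

lemma dot_commute: "dot n x y = dot n y x"
  by (simp add: dot_def mult.commute)

lemma dot_self_nonneg: "0 \<le> dot n x x"
  unfolding dot_def by (intro sum_nonneg) simp

lemma dot_Cauchy_Schwarz: "\<bar>dot n x y\<bar> \<le> sqrt (dot n x x) * sqrt (dot n y y)"
proof -
  have "(dot n x y)\<^sup>2 \<le> dot n x x * dot n y y"
    using Cauchy_Schwarz_ineq_sum[of "coord x" "coord y" "{..<n}"] by (simp add: dot_def power2_eq_square)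
  then show ?thesis by (metis real_sqrt_abs real_sqrt_le_iff real_sqrt_mult)
qed

text \<open>Matrices are functions on pairs of indices because the size varies with the factor; only
  the block of indices below \<open>n\<close> carries meaning, here and in the predicates that
  follow.\<close>

definition mat_apply :: "nat \<Rightarrow> (nat \<Rightarrow> nat \<Rightarrow> real) \<Rightarrow> (nat \<Rightarrow>\<^sub>0 real) \<Rightarrow> nat \<Rightarrow>\<^sub>0 real" where
  "mat_apply n a x = euclid_vec n (\<lambda>k. \<Sum>m<n. a k m * coord x m)"

definition mat_prod :: "nat \<Rightarrow> (nat \<Rightarrow> nat \<Rightarrow> real) \<Rightarrow> (nat \<Rightarrow> nat \<Rightarrow> real) \<Rightarrow> nat \<Rightarrow> nat \<Rightarrow> real" where
  "mat_prod n a b k m = (\<Sum>j<n. a k j * b j m)"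

definition mat_id :: "nat \<Rightarrow> (nat \<Rightarrow> nat \<Rightarrow> real) \<Rightarrow> bool" where
  "mat_id n a \<longleftrightarrow> (\<forall>k<n. \<forall>m<n. a k m = (if k = m then 1 else 0))"

definition mat_sym :: "nat \<Rightarrow> (nat \<Rightarrow> nat \<Rightarrow> real) \<Rightarrow> bool" where
  "mat_sym n a \<longleftrightarrow> (\<forall>k<n. \<forall>m<n. a k m = a m k)"

lemma coord_mat_apply: "k < n \<Longrightarrow> coord (mat_apply n a x) k = (\<Sum>m<n. a k m * coord x m)"
  by (simp add: mat_apply_def coord_euclid_vec)

lemma mat_apply_in_euclid: "mat_apply n a x \<in> euclid n"
  by (simp add: mat_apply_def euclid_vec_in_euclid)

lemma mat_apply_inverse:
  assumes "mat_id n (mat_prod n a b)" "x \<in> euclid n"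
  shows "mat_apply n a (mat_apply n b x) = x"
proof (rule euclid_eqI[OF mat_apply_in_euclid assms(2)])
  fix k assume k: "k < n"
  have "coord (mat_apply n a (mat_apply n b x)) k = (\<Sum>j<n. a k j * (\<Sum>m<n. b j m * coord x m))"
    using k by (simp add: coord_mat_apply)
  also have "\<dots> = (\<Sum>m<n. mat_prod n a b k m * coord x m)"
    unfolding sum_distrib_left mat_prod_def sum_distrib_right
    by (subst sum.swap) (simp add: mult.assoc)
  also have "\<dots> = (\<Sum>m<n. if m = k then coord x k else 0)"
    using assms(1) k by (intro sum.cong) (auto simp: mat_id_def)
  also have "\<dots> = coord x k" using k by simp
  finally show "coord (mat_apply n a (mat_apply n b x)) k = coord x k" .
qed

lemma dot_mat_apply:
  "dot n (mat_apply n a x) y = dot n x (mat_apply n (\<lambda>k m. a m k) y)"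
proof -
  have "dot n (mat_apply n a x) y = (\<Sum>k<n. \<Sum>m<n. a k m * coord x m * coord y k)"
    by (simp add: dot_def coord_mat_apply sum_distrib_right)
  also have "\<dots> = (\<Sum>m<n. \<Sum>k<n. a k m * coord x m * coord y k)" by (rule sum.swap)
  also have "\<dots> = dot n x (mat_apply n (\<lambda>k m. a m k) y)"
    by (simp add: dot_def coord_mat_apply sum_distrib_left mult_ac)
  finally show ?thesis .
qed

lemma mat_apply_sym: "mat_sym n a \<Longrightarrow> mat_apply n (\<lambda>k m. a m k) y = mat_apply n a y"
  by (rule euclid_eqI[OF mat_apply_in_euclid mat_apply_in_euclid]) (simp add: coord_mat_apply mat_sym_def)

lemma linear_mat_apply: "linear (mat_apply n a)"
  by (rule linearI; rule euclid_eqI[of _ n])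
    (auto simp: mat_apply_in_euclid euclid_add euclid_scaleR coord_mat_apply lookup_add sum.distrib
      sum_distrib_left distrib_left mult_ac)

lemma coord_dist: "\<bar>coord x k - coord y k\<bar> \<le> dist x y"
proof (cases "k \<in> Poly_Mapping.keys x \<union> Poly_Mapping.keys y")
  case True
  then show ?thesis
    unfolding dist_poly_mapping_def dist_real_def by (intro member_le_sum) auto
next
  case False
  then show ?thesis by (simp add: in_keys_iff)
qed

lemma continuous_on_coord: "continuous_on S (\<lambda>x. coord x k)"
  unfolding continuous_on_iff
  by (metis coord_dist dist_real_def order_le_less_trans)

lemma continuous_on_mat_apply: "continuous_on S (mat_apply n a)"
  unfolding mat_apply_def euclid_vec_def by (intro continuous_intros continuous_on_coord)

section \<open>Inner boxes, linear images and separation for factor bodies\<close>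

lemma factor_bodyD:
  assumes "factor_body n K"
  shows "K \<subseteq> euclid n" "compact K" "convex K" "x \<in> K \<Longrightarrow> - x \<in> K"
  using assms by (auto simp: factor_body_def)

text \<open>A coordinate box replaces an inner ball, since the metric on sequences is the sum metric
  while \<open>dot\<close> is Euclidean.\<close>

lemma factor_body_box:
  assumes K: "factor_body n K"
  obtains r where "0 < r" "\<And>z. z \<in> euclid n \<Longrightarrow> (\<And>k. k < n \<Longrightarrow> \<bar>coord z k\<bar> \<le> r) \<Longrightarrow> z \<in> K"
proof -
  obtain x where "x \<in> (top_of_set (euclid n)) interior_of K" using K by (auto simp: factor_body_def)
  then obtain V where V: "openin (top_of_set (euclid n)) V" "x \<in> V" "V \<subseteq> K" unfolding interior_of_def by blast
  then obtain U where U: "open U" "V = euclid n \<inter> U" unfolding openin_open by blast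
  obtain e where e: "0 < e" "ball x e \<subseteq> U" using U V(2) open_contains_ball by blast
  have xe: "x \<in> euclid n" using U(2) V(2) by blast
  \<comment> \<open>The sum norm on the box is at most n r, which is below e; the added 1 covers n =
    0.\<close>
  define r where "r = e / (real n + 1)"
  have r: "0 < r" using e by (simp add: r_def)
  have re: "n * r < e"
  proof -
    have "(real n + 1) * r = e" by (simp add: r_def)
    then show ?thesis using r by (simp add: algebra_simps)
  qed
  show thesis
  proof (rule that[OF r])
    fix z assume z: "z \<in> euclid n" "\<And>k. k < n \<Longrightarrow> \<bar>coord z k\<bar> \<le> r"
    have "norm z = (\<Sum>k\<in>Poly_Mapping.keys z. \<bar>coord z k\<bar>)"
      by (simp add: norm_poly_mapping_def dist_poly_mapping_def)
    also have "\<dots> \<le> (\<Sum>k<n. \<bar>coord z k\<bar>)" using z(1) by (intro sum_mono2) (auto simp: euclid_def)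
    also have "\<dots> \<le> n * r" using sum_bounded_above[of "{..<n}" "\<lambda>k. \<bar>coord z k\<bar>" r] z(2) by simp
    finally have nz: "norm z < e" using re by simp
    have "x + z \<in> U" "x - z \<in> U" using nz e(2) by (auto simp: dist_norm subset_iff)
    moreover have "x + z \<in> euclid n" "x - z \<in> euclid n"
      using xe z(1) euclid_add[OF xe euclid_uminus[OF z(1)]] by (auto simp: euclid_add)
    ultimately have "x + z \<in> K" "x - z \<in> K" using U(2) V(3) by auto
    then have "x + z \<in> K" "- (x - z) \<in> K" using factor_bodyD(4)[OF K] by blast+
    then have "(1 / 2) *\<^sub>R (x + z) + (1 / 2) *\<^sub>R (- (x - z)) \<in> K" by (intro convexD[OF factor_bodyD(3)[OF K]]) auto
    moreover have "(1 / 2) *\<^sub>R (x + z) + (1 / 2) *\<^sub>R (- (x - z)) = (1 / 2 + 1 / 2) *\<^sub>R z"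
      unfolding scaleR_add_left by (simp add: scaleR_add_right scaleR_diff_right)
    ultimately show "z \<in> K" by simp
  qed
qed

lemma factor_bodyI:
  assumes "K \<subseteq> euclid n" "compact K" "convex K" "\<And>x. x \<in> K \<Longrightarrow> - x \<in> K"
    and r: "0 < r" "\<And>z. z \<in> euclid n \<Longrightarrow> (\<And>k. k < n \<Longrightarrow> \<bar>coord z k\<bar> \<le> r) \<Longrightarrow> z \<in> K"
  shows "factor_body n K"
proof -
  have "euclid n \<inter> ball 0 r \<subseteq> K"
  proof
    fix z assume z: "z \<in> euclid n \<inter> ball 0 r"
    then have "\<bar>coord z k\<bar> \<le> r" for k using coord_dist[of z k 0] by (simp add: dist_commute)
    then show "z \<in> K" using r(2) z by blast
  qed
  moreover have "openin (top_of_set (euclid n)) (euclid n \<inter> ball 0 r)" by (auto simp: openin_open)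
  moreover have "0 \<in> euclid n \<inter> ball 0 r" using r(1) by (simp add: euclid_0)
  ultimately have "0 \<in> (top_of_set (euclid n)) interior_of K" unfolding interior_of_def by blast
  moreover have "K = uminus ` K" using assms(4) by (auto intro: image_eqI[of _ uminus "- _"])
  ultimately show ?thesis using assms(1-3) unfolding factor_body_def by blast
qed

lemma factor_body_0:
  assumes "factor_body n K" shows "0 \<in> K"
proof -
  obtain r where "0 < r" "\<And>z. z \<in> euclid n \<Longrightarrow> (\<And>k. k < n \<Longrightarrow> \<bar>coord z k\<bar> \<le> r) \<Longrightarrow> z \<in> K"
    using factor_body_box[OF assms] by blast
  then show ?thesis by (simp add: euclid_0)
qed

text \<open>The right inverse \<open>b\<close> maps a small enough box into the inner box of
  \<open>K\<close>, so the small box lies in the image of \<open>K\<close>.\<close>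

lemma factor_body_mat_image:
  assumes K: "factor_body n K" and a: "mat_id n (mat_prod n a b)"
  shows "factor_body n (mat_apply n a ` K)"
proof -
  obtain r where r: "0 < r" "\<And>z. z \<in> euclid n \<Longrightarrow> (\<And>k. k < n \<Longrightarrow> \<bar>coord z k\<bar> \<le> r) \<Longrightarrow> z \<in> K"
    using factor_body_box[OF K] by blast
  \<comment> \<open>Exceeds every absolute row sum of \<open>b\<close>; the added 1 keeps it
    positive.\<close>
  define s where "s = (\<Sum>k<n. \<Sum>m<n. \<bar>b k m\<bar>) + 1"
  have s: "0 < s" unfolding s_def by (intro add_nonneg_pos sum_nonneg) auto
  show ?thesis
  proof (rule factor_bodyI[where r = "r / s"])
    show "mat_apply n a ` K \<subseteq> euclid n" using mat_apply_in_euclid by blast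
    show "compact (mat_apply n a ` K)"
      by (rule compact_continuous_image[OF continuous_on_mat_apply factor_bodyD(2)[OF K]])
    show "convex (mat_apply n a ` K)" by (rule convex_linear_image[OF linear_mat_apply factor_bodyD(3)[OF K]])
    show "- x \<in> mat_apply n a ` K" if "x \<in> mat_apply n a ` K" for x
      using that factor_bodyD(4)[OF K] linear_neg[OF linear_mat_apply[of n a]] by (metis (no_types, lifting) image_iff)
    show "0 < r / s" using r s by simp
    fix z assume z: "z \<in> euclid n" "\<And>k. k < n \<Longrightarrow> \<bar>coord z k\<bar> \<le> r / s"
    have "\<bar>coord (mat_apply n b z) k\<bar> \<le> r" if k: "k < n" for k
    proof -
      have "\<bar>coord (mat_apply n b z) k\<bar> \<le> (\<Sum>m<n. \<bar>b k m\<bar> * \<bar>coord z m\<bar>)"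
        using k by (simp add: coord_mat_apply abs_mult[symmetric])
      also have "\<dots> \<le> (\<Sum>m<n. \<bar>b k m\<bar> * (r / s))" using z(2) by (intro sum_mono mult_left_mono) auto
      also have "\<dots> = (\<Sum>m<n. \<bar>b k m\<bar>) * (r / s)" by (rule sum_distrib_right[symmetric])
      also have "(\<Sum>m<n. \<bar>b k m\<bar>) \<le> s"
        using member_le_sum[of k "{..<n}" "\<lambda>k. \<Sum>m<n. \<bar>b k m\<bar>"] k by (simp add: s_def sum_nonneg)
      then have "(\<Sum>m<n. \<bar>b k m\<bar>) * (r / s) \<le> s * (r / s)" using r(1) s by (intro mult_right_mono) auto
      finally show ?thesis using s by simp
    qed
    then have "mat_apply n b z \<in> K" by (intro r(2) mat_apply_in_euclid)
    then show "z \<in> mat_apply n a ` K" using mat_apply_inverse[OF a z(1)] by force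
  qed
qed

text \<open>Places a factor on the coordinates \<iota> of the tensor space. For injective \<iota>
  this preserves inner products, so results about \<open>real ^ 't\<close> apply to factors.\<close>

definition embed :: "nat \<Rightarrow> (nat \<Rightarrow> 't::finite) \<Rightarrow> (nat \<Rightarrow>\<^sub>0 real) \<Rightarrow> real ^ 't" where
  "embed n \<iota> x = (\<Sum>k<n. coord x k *\<^sub>R axis (\<iota> k) 1)"

context
  fixes n :: nat and \<iota> :: "nat \<Rightarrow> 't::finite"
  assumes inj: "inj_on \<iota> {..<n}"
begin

lemma inner_embed: "embed n \<iota> x \<bullet> v = (\<Sum>k<n. coord x k * v $ \<iota> k)"
  by (simp add: embed_def inner_sum_left inner_axis')

lemma embed_component: "k < n \<Longrightarrow> embed n \<iota> x $ \<iota> k = coord x k"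
proof -
  assume k: "k < n"
  have "embed n \<iota> x $ \<iota> k = embed n \<iota> x \<bullet> axis (\<iota> k) 1" by (simp add: inner_axis)
  also have "\<dots> = (\<Sum>j<n. if j = k then coord x k else 0)"
    unfolding inner_embed using k inj by (intro sum.cong) (auto simp: axis_def inj_on_def)
  finally show ?thesis using k by simp
qed

lemma inner_embed_embed: "embed n \<iota> x \<bullet> embed n \<iota> y = dot n x y"
  by (simp add: inner_embed embed_component dot_def)

lemma embed_component_off: "t \<notin> \<iota> ` {..<n} \<Longrightarrow> embed n \<iota> x $ t = 0"
  by (auto simp: embed_def axis_def intro!: sum.neutral)

lemma continuous_on_embed: "continuous_on S (embed n \<iota>)"
  unfolding embed_def by (intro continuous_intros continuous_on_coord)

lemma linear_embed: "linear (embed n \<iota>)"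
  unfolding embed_def by (rule linearI) (simp_all add: lookup_add scaleR_add_left sum.distrib scaleR_sum_right)

lemma embed_inj: "x \<in> euclid n \<Longrightarrow> y \<in> euclid n \<Longrightarrow> embed n \<iota> x = embed n \<iota> y \<Longrightarrow> x = y"
  by (rule euclid_eqI) (auto simp: embed_component[symmetric])

text \<open>The ball is the image of the unit ball of \<open>real ^ 't\<close> under a coordinate
  projection, which yields compactness and convexity.\<close>

lemma factor_body_unit_ball: "factor_body n {x \<in> euclid n. dot n x x \<le> 1}"
proof (rule factor_bodyI[where r = "1 / (real n + 1)"])
  let ?g = "\<lambda>v :: real ^ 't. euclid_vec n (\<lambda>k. v $ \<iota> k)"
  have lin: "linear ?g"
    unfolding euclid_vec_def by (rule linearI) (simp_all add: scaleR_add_left sum.distrib scaleR_sum_right)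
  have cont: "continuous_on S ?g" for S unfolding euclid_vec_def by (intro continuous_intros)
  have eq: "{x \<in> euclid n. dot n x x \<le> 1} = ?g ` cball 0 1"
  proof
    show "{x \<in> euclid n. dot n x x \<le> 1} \<subseteq> ?g ` cball 0 1"
    proof
      fix x assume x: "x \<in> {x \<in> euclid n. dot n x x \<le> 1}"
      then have "?g (embed n \<iota> x) = x"
        by (intro euclid_eqI[of _ n]) (auto simp: euclid_vec_in_euclid coord_euclid_vec embed_component)
      moreover have "norm (embed n \<iota> x) \<le> 1"
        using x by (simp add: norm_eq_sqrt_inner inner_embed_embed)
      ultimately show "x \<in> ?g ` cball 0 1" by (metis image_eqI mem_cball_0)
    qed
    show "?g ` cball 0 1 \<subseteq> {x \<in> euclid n. dot n x x \<le> 1}"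
    proof clarify
      fix v :: "real ^ 't" assume "v \<in> cball 0 1"
      have "dot n (?g v) (?g v) = (\<Sum>k<n. v $ \<iota> k * v $ \<iota> k)" by (simp add: dot_def coord_euclid_vec)
      also have "\<dots> = (\<Sum>t\<in>\<iota> ` {..<n}. v $ t * v $ t)" by (simp add: sum.reindex[OF inj])
      also have "\<dots> \<le> (\<Sum>t\<in>UNIV. v $ t * v $ t)" by (intro sum_mono2) auto
      also have "\<dots> = (norm v)\<^sup>2" by (simp add: power2_norm_eq_inner inner_vec_def)
      also have "\<dots> \<le> 1" using \<open>v \<in> cball 0 1\<close> by (simp add: power_le_one)
      finally show "?g v \<in> euclid n \<and> dot n (?g v) (?g v) \<le> 1" by (simp add: euclid_vec_in_euclid)
    qed
  qed
  show "compact {x \<in> euclid n. dot n x x \<le> 1}"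
    unfolding eq by (rule compact_continuous_image[OF cont compact_cball])
  show "convex {x \<in> euclid n. dot n x x \<le> 1}"
    unfolding eq by (rule convex_linear_image[OF lin convex_cball])
  \<comment> \<open>Coordinates at most 1 in absolute value have squares no larger than themselves,
    and n terms of size 1/(n + 1) sum to at most 1.\<close>
  fix z assume z: "z \<in> euclid n" "\<And>k. k < n \<Longrightarrow> \<bar>coord z k\<bar> \<le> 1 / (real n + 1)"
  have "dot n z z \<le> (\<Sum>k<n. 1 / (real n + 1))"
    unfolding dot_def
  proof (rule sum_mono)
    fix k assume "k \<in> {..<n}"
    then have k: "\<bar>coord z k\<bar> \<le> 1 / (real n + 1)" using z(2) by simp
    also have "\<dots> \<le> 1" by simp
    finally have "\<bar>coord z k\<bar> * \<bar>coord z k\<bar> \<le> \<bar>coord z k\<bar>" by (rule mult_left_le) simp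
    moreover have "\<bar>coord z k\<bar> * \<bar>coord z k\<bar> = coord z k * coord z k" by (rule abs_mult_self_eq)
    ultimately show "coord z k * coord z k \<le> 1 / (real n + 1)" using k by linarith
  qed
  also have "\<dots> \<le> 1" by simp
  finally show "z \<in> {x \<in> euclid n. dot n x x \<le> 1}" using z(1) by simp
qed (auto simp: euclid_uminus dot_uminus_left dot_commute[of n _ "- _"])

text \<open>The nontrivial half of the bipolar theorem for \<open>K\<close>, obtained by separating
  a point from the embedded body.\<close>

lemma factor_body_separation:
  assumes K: "factor_body n K" and x: "x \<in> euclid n" "x \<notin> K"
  obtains y where "y \<in> factor_polar n K" "1 < dot n x y"
proof -
  let ?E = "embed n \<iota>"
  have "?E x \<notin> ?E ` K" using x factor_bodyD(1)[OF K] embed_inj by blast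
  moreover have "closed (?E ` K)"
    using compact_continuous_image[OF continuous_on_embed factor_bodyD(2)[OF K]] by (rule compact_imp_closed)
  moreover have "convex (?E ` K)" by (rule convex_linear_image[OF linear_embed factor_bodyD(3)[OF K]])
  moreover have "?E ` K \<noteq> {}" using factor_body_0[OF K] by blast
  ultimately obtain a b where ab: "a \<bullet> ?E x < b" "\<forall>q\<in>?E ` K. b < a \<bullet> q"
    using separating_hyperplane_closed_point[of "?E ` K" "?E x"] by blast
  have "?E 0 = 0" using linear_embed by (rule linear_0)
  then have b: "b < 0" using ab(2) factor_body_0[OF K] by force
  \<comment> \<open>Division by the negative \<open>b\<close> normalizes the functional: below 1 on
    \<open>K\<close>, hence bounded by 1 in absolute value by symmetry, and above 1 at
    \<open>x\<close>.\<close>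
  define y where "y = euclid_vec n (\<lambda>k. a $ \<iota> k / b)"
  have dy: "dot n z y = (a \<bullet> ?E z) / b" for z
    by (simp add: dot_def y_def coord_euclid_vec inner_commute[of a] inner_embed sum_divide_distrib)
  have "\<bar>dot n z y\<bar> \<le> 1" if "z \<in> K" for z
  proof -
    have "b < a \<bullet> ?E z" "b < a \<bullet> ?E (- z)" using ab(2) that factor_bodyD(4)[OF K] by auto
    then have "dot n z y < 1" "dot n (- z) y < 1" unfolding dy using b by (simp_all add: divide_less_eq)
    then show ?thesis by (simp add: dot_uminus_left)
  qed
  moreover have "1 < dot n x y" unfolding dy using ab(1) b by (simp add: less_divide_eq)
  moreover have "y \<in> euclid n" by (simp add: y_def euclid_vec_in_euclid)
  ultimately show thesis using that[of y] by (simp add: factor_polar_def)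
qed

end

section \<open>Gauges of factor bodies\<close>

lemma minkowski_functional_eqI:
  assumes "0 < c" "\<And>k. 0 < k \<Longrightarrow> inverse k *\<^sub>R x \<in> K \<longleftrightarrow> c \<le> k"
  shows "minkowski_functional K x = c"
proof -
  have "{k. 0 < k \<and> inverse k *\<^sub>R x \<in> K} = {c..}" using assms by auto
  then show ?thesis by (simp add: minkowski_functional_def)
qed

text \<open>Boundedness of \<open>K\<close> makes the gauge positive, the inner box makes it finite,
  and closedness makes the infimum attained, so membership is exactly an inequality for the
  gauge.\<close>

lemma factor_body_gauge:
  assumes K: "factor_body n K" and x: "x \<in> euclid n" "x \<noteq> 0"
  shows "0 < minkowski_functional K x"
    and "0 < k \<Longrightarrow> inverse k *\<^sub>R x \<in> K \<longleftrightarrow> minkowski_functional K x \<le> k"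
proof -
  let ?S = "{k. 0 < k \<and> inverse k *\<^sub>R x \<in> K}"
  have cK: "closed K" using factor_bodyD(2)[OF K] by (rule compact_imp_closed)
  have nx: "0 < norm x" using x by simp
  obtain B where B: "0 < B" "\<And>y. y \<in> K \<Longrightarrow> norm y \<le> B"
    using compact_imp_bounded[OF factor_bodyD(2)[OF K]] unfolding bounded_pos by blast
  obtain r where r: "0 < r" "\<And>z. z \<in> euclid n \<Longrightarrow> (\<And>k. k < n \<Longrightarrow> \<bar>coord z k\<bar> \<le> r) \<Longrightarrow> z \<in> K"
    using factor_body_box[OF K] by blast
  have lower: "norm x / B \<le> k" if "k \<in> ?S" for k
  proof -
    have "norm x / k \<le> B" using that B(2)[of "inverse k *\<^sub>R x"] by (simp add: divide_inverse mult.commute)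
    then show ?thesis using that B(1) by (simp add: field_simps)
  qed
  have "norm x / r \<in> ?S"
  proof -
    have "inverse (norm x / r) *\<^sub>R x \<in> K"
    proof (rule r(2)[OF euclid_scaleR[OF x(1)]])
      fix k
      have "\<bar>coord x k\<bar> \<le> norm x" using coord_dist[of x k 0] by simp
      then show "\<bar>coord (inverse (norm x / r) *\<^sub>R x) k\<bar> \<le> r"
        using nx r(1) by (simp add: abs_mult field_simps)
    qed
    then show ?thesis using nx r(1) by simp
  qed
  then have ne: "?S \<noteq> {}" by blast
  have bdd: "bdd_below ?S" using lower by (rule bdd_belowI)
  let ?g = "minkowski_functional K x"
  have "norm x / B \<le> ?g" unfolding minkowski_functional_def by (rule cInf_greatest[OF ne lower])
  then show g: "0 < ?g" using nx B(1) by (meson divide_pos_pos order_less_le_trans)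
  have up: "k' \<in> ?S" if k: "k \<in> ?S" and "k \<le> k'" for k k'
  proof -
    have "(k / k') *\<^sub>R (inverse k *\<^sub>R x) + (1 - k / k') *\<^sub>R 0 \<in> K"
      using that factor_body_0[OF K] by (intro convexD[OF factor_bodyD(3)[OF K]]) auto
    moreover have "(k / k') *\<^sub>R (inverse k *\<^sub>R x) + (1 - k / k') *\<^sub>R 0 = inverse k' *\<^sub>R x"
      using that by (simp add: field_simps)
    ultimately have "inverse k' *\<^sub>R x \<in> K" by (simp only:)
    then show ?thesis using that by simp
  qed
  have gS: "?g \<in> ?S"
  proof -
    have "\<exists>k\<in>?S. k < ?g + e" if "0 < e" for e
      using cInf_lessD[OF ne, of "?g + e"] that by (auto simp: minkowski_functional_def)
    then have "inverse (?g + e) *\<^sub>R x \<in> K" if "0 < e" for e using up that by force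
    then have ev: "\<forall>\<^sub>F e in at_right 0. inverse (?g + e) *\<^sub>R x \<in> K"
      by (auto simp: eventually_at_right_less eventually_at_filter intro: eventuallyI)
    have "((\<lambda>e. inverse (?g + e) *\<^sub>R x) \<longlongrightarrow> inverse (?g + 0) *\<^sub>R x) (at_right 0)"
      using g by (intro tendsto_intros) auto
    then have "inverse (?g + 0) *\<^sub>R x \<in> K"
      using Lim_in_closed_set[OF cK ev] by simp
    then show ?thesis using g by simp
  qed
  show "inverse k *\<^sub>R x \<in> K \<longleftrightarrow> ?g \<le> k" if "0 < k"
  proof
    assume "inverse k *\<^sub>R x \<in> K"
    then show "?g \<le> k" unfolding minkowski_functional_def using that by (intro cInf_lower bdd) auto
  qed (use up[OF gS] in auto)
qed

lemma factor_body_gauge_scaleR: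
  assumes K: "factor_body n K" and x: "x \<in> euclid n" "x \<noteq> 0" and c: "0 < c"
  shows "minkowski_functional K (c *\<^sub>R x) = c * minkowski_functional K x"
proof (rule minkowski_functional_eqI)
  show "0 < c * minkowski_functional K x" using factor_body_gauge(1)[OF K x] c by simp
  fix k :: real assume k: "0 < k"
  have "inverse k *\<^sub>R c *\<^sub>R x = inverse (k / c) *\<^sub>R x" using c k by (simp add: field_simps)
  then show "inverse k *\<^sub>R c *\<^sub>R x \<in> K \<longleftrightarrow> c * minkowski_functional K x \<le> k"
    using factor_body_gauge(2)[OF K x, of "k / c"] c k by (simp add: field_simps)
qed

text \<open>The John position of a factor body \<open>K\<close> is found inside \<^typ>\<open>real ^ 't\<close>: embed \<open>K\<close> as a set of vectors
  supported on a block of coordinates and add the remaining coordinate vectors. The John position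
  of the union commutes with the reflection in the block, hence is block diagonal.\<close>

definition block_entry :: "(nat \<Rightarrow> 't::finite) \<Rightarrow> (real ^ 't \<Rightarrow> real ^ 't) \<Rightarrow> nat \<Rightarrow> nat \<Rightarrow> real" where
  "block_entry \<iota> f k m = f (axis (\<iota> m) 1) $ \<iota> k"

definition reflect_off :: "'t set \<Rightarrow> real ^ 't::finite \<Rightarrow> real ^ 't" where
  "reflect_off S v = (\<chi> t. if t \<in> S then v $ t else - v $ t)"

section \<open>The John position of a factor body by reflection symmetry\<close>

lemma reflect_off_idem: "reflect_off S (reflect_off S v) = v"
  by (simp add: reflect_off_def vec_eq_iff)

lemma linear_reflect_off: "linear (reflect_off S)"
  by (rule linearI) (auto simp: reflect_off_def vec_eq_iff)

lemma reflect_off_inner: "reflect_off S v \<bullet> w = v \<bullet> reflect_off S w"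
  by (auto simp: reflect_off_def inner_vec_def intro!: sum.cong)

lemma norm_reflect_off: "norm (reflect_off S v) = norm v"
  using reflect_off_inner[of S v "reflect_off S v"] by (simp add: norm_eq_sqrt_inner reflect_off_idem)

text \<open>Conjugating \<open>f\<close> by the reflection gives a positive definite operator with
  the same norms, hence \<open>f\<close> itself by \<open>posdef_unique\<close>.\<close>

lemma posdef_reflect_off_commute:
  assumes f: "posdef f" and eq: "\<And>v. norm (f (reflect_off S v)) = norm (f v)"
  shows "f (reflect_off S v) = reflect_off S (f v)"
proof -
  let ?J = "reflect_off S" and ?g = "\<lambda>v. reflect_off S (f (reflect_off S v))"
  have "linear ?g"
    using linear_compose[OF linear_compose[OF linear_reflect_off posdefD(2)[OF f]] linear_reflect_off] by (simp add: o_def)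
  moreover have "?g x \<bullet> y = x \<bullet> ?g y" for x y
    unfolding reflect_off_inner[of S "f (?J x)"] posdefD(4)[OF f] by (rule reflect_off_inner)
  moreover have "0 < ?g x \<bullet> x" if "x \<noteq> 0" for x
  proof -
    have "?J x \<noteq> 0" using that norm_reflect_off[of S x] by force
    then show ?thesis unfolding reflect_off_inner using posdefD(3)[OF f] by blast
  qed
  ultimately have "posdef ?g" by (simp add: posdef_def symmetric_op_def)
  moreover have "norm (?g v) = norm (f v)" for v by (simp add: norm_reflect_off eq)
  ultimately have "?g = f" using posdef_unique f by blast
  then have "?J (?g v) = ?J (f v)" by (metis (no_types))
  then show ?thesis by (simp only: reflect_off_idem)
qed

context
  fixes n :: nat and \<iota> :: "nat \<Rightarrow> 't::finite"
  assumes inj: "inj_on \<iota> {..<n}"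
begin

text \<open>The vectors fixed by the reflection are those supported on the block, so a commuting map
  preserves them.\<close>

lemma reflect_off_commute_block:
  assumes f: "linear f" and J: "\<And>v. f (reflect_off (\<iota> ` {..<n}) v) = reflect_off (\<iota> ` {..<n}) (f v)" and m: "m < n"
  shows "f (axis (\<iota> m) 1) = (\<Sum>k<n. block_entry \<iota> f k m *\<^sub>R axis (\<iota> k) 1)"
proof -
  let ?S = "\<iota> ` {..<n}" and ?v = "f (axis (\<iota> m) 1)"
  have "reflect_off ?S (axis (\<iota> m) 1) = (axis (\<iota> m) 1 :: real ^ 't)"
    using m by (auto simp: reflect_off_def vec_eq_iff axis_def)
  then have fixed: "reflect_off ?S ?v = ?v" using J by metis
  have off: "?v $ t = 0" if "t \<notin> ?S" for t
  proof -
    have "reflect_off ?S ?v $ t = - ?v $ t" using that by (simp add: reflect_off_def)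
    then show ?thesis unfolding fixed by simp
  qed
  have "?v $ t = embed n \<iota> (euclid_vec n (\<lambda>k. block_entry \<iota> f k m)) $ t" for t
  proof (cases "t \<in> ?S")
    case True
    then show ?thesis by (auto simp: embed_component[OF inj] coord_euclid_vec block_entry_def)
  qed (simp add: off embed_component_off[OF inj])
  then have "?v = embed n \<iota> (euclid_vec n (\<lambda>k. block_entry \<iota> f k m))" by (simp add: vec_eq_iff)
  then show ?thesis by (simp add: embed_def coord_euclid_vec)
qed

lemma block_entry_compose:
  assumes f: "linear f" and g: "linear g"
    "\<And>v. g (reflect_off (\<iota> ` {..<n}) v) = reflect_off (\<iota> ` {..<n}) (g v)" and m: "m < n"
  shows "block_entry \<iota> (f \<circ> g) k m = mat_prod n (block_entry \<iota> f) (block_entry \<iota> g) k m"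
proof -
  have "(f \<circ> g) (axis (\<iota> m) 1) = (\<Sum>j<n. block_entry \<iota> g j m *\<^sub>R f (axis (\<iota> j) 1))"
    by (simp add: reflect_off_commute_block[OF g m] linear_sum[OF f] linear_scale[OF f])
  then show ?thesis by (simp add: block_entry_def mat_prod_def mult.commute)
qed

lemma block_entry_embed_off:
  assumes f: "linear f"
    "\<And>v. f (reflect_off (\<iota> ` {..<n}) v) = reflect_off (\<iota> ` {..<n}) (f v)"
  shows "f (embed n \<iota> x) = embed n \<iota> (mat_apply n (block_entry \<iota> f) x)"
proof -
  have "f (embed n \<iota> x) = (\<Sum>m<n. coord x m *\<^sub>R (\<Sum>k<n. block_entry \<iota> f k m *\<^sub>R axis (\<iota> k) 1))"
    by (simp add: embed_def linear_sum[OF f(1)] linear_scale[OF f(1)] reflect_off_commute_block[OF f])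
  also have "\<dots> = (\<Sum>k<n. (\<Sum>m<n. block_entry \<iota> f k m * coord x m) *\<^sub>R axis (\<iota> k) 1)"
    unfolding scaleR_sum_right scaleR_sum_left by (subst sum.swap) (simp add: mult.commute)
  finally show ?thesis by (simp add: embed_def coord_mat_apply)
qed

lemma block_entry_sym:
  assumes "symmetric_op f" shows "mat_sym n (block_entry \<iota> f)"
proof -
  have "f (axis i 1) $ j = f (axis j 1) $ i" for i j
    using symmetric_opD(2)[OF assms, of "axis i 1" "axis j 1"] by (simp add: inner_axis inner_axis')
  then show ?thesis by (simp add: mat_sym_def block_entry_def)
qed

lemma block_entry_id: "mat_id n (block_entry \<iota> (\<lambda>v. v))"
  using inj by (auto simp: mat_id_def block_entry_def axis_def inj_on_def)

text \<open>\<open>b\<close> is the matrix of the position, \<open>b'\<close> its inverse and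
  \<open>p\<close> its square root. The square root is recorded because positivity of a tensor
  product of matrices will be deduced from the tensor product of their roots.\<close>

theorem factor_john:
  assumes K: "factor_body n K"
  obtains p b b' X c where
    "mat_sym n p" "mat_sym n b'" "\<And>k m. k < n \<Longrightarrow> m < n \<Longrightarrow> mat_prod n p p k m = b k m"
    "mat_id n (mat_prod n b b')" "mat_id n (mat_prod n b' b)"
    "finite X" "X \<subseteq> K" "\<forall>x\<in>X. 0 \<le> c x" "sum c X = real n"
    "mat_id n (\<lambda>k m. \<Sum>x\<in>X. c x * (coord (mat_apply n b' x) k * coord (mat_apply n b' x) m))"
    "\<forall>x\<in>K. dot n (mat_apply n b' x) (mat_apply n b' x) \<le> 1"
proof -
  let ?S = "\<iota> ` {..<n}" and ?E = "embed n \<iota>"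
  let ?J = "reflect_off ?S"
  let ?off = "(\<lambda>t. axis t 1 :: real ^ 't) ` (- ?S)"
  let ?K = "?E ` K \<union> ?off"
  have cK: "compact ?K"
    by (rule compact_Un[OF compact_continuous_image[OF continuous_on_embed[OF inj] factor_bodyD(2)[OF K]] finite_imp_compact]) simp
  have "axis t 1 \<in> span ?K" for t
  proof (cases "t \<in> ?S")
    case True
    then obtain k where k: "k < n" "t = \<iota> k" by auto
    obtain r where r: "0 < r" "\<And>z. z \<in> euclid n \<Longrightarrow> (\<And>k. k < n \<Longrightarrow> \<bar>coord z k\<bar> \<le> r) \<Longrightarrow> z \<in> K"
      using factor_body_box[OF K] by blast
    let ?z = "euclid_vec n (\<lambda>j. if j = k then r else 0)"
    have "?z \<in> K" using r(1) by (intro r(2) euclid_vec_in_euclid) (simp add: coord_euclid_vec)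
    then have "?E ?z \<in> span ?K" by (intro span_base) blast
    moreover have "?E ?z = (\<Sum>j<n. if j = k then r *\<^sub>R axis t 1 else 0)"
      unfolding embed_def using k by (intro sum.cong) (auto simp: coord_euclid_vec)
    then have "?E ?z = r *\<^sub>R axis t 1" using k by simp
    ultimately have "(1 / r) *\<^sub>R (r *\<^sub>R axis t 1) \<in> span ?K" by (metis span_scale)
    then show ?thesis using r(1) by simp
  qed (auto intro: span_base)
  then have "Basis \<subseteq> span ?K" by (auto simp: Basis_vec_def)
  then have "span ?K = UNIV" by (metis span_Basis span_mono span_span top.extremum_uniqueI)
  then obtain T where T: "posdef T" and john: "john (inv T ` ?K)" using john_position_exists[OF cK] by blast
  obtain Y w where Y: "Y \<subseteq> inv T ` ?K" "frame Y w" and ball: "inv T ` ?K \<subseteq> cball 0 1"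
    using john by (auto simp: john_def)
  have fY: "finite Y" "\<forall>y\<in>Y. 0 \<le> w y" "sum w Y = CARD('t)" and frame: "(\<Sum>y\<in>Y. w y * (y \<bullet> v)\<^sup>2) = (norm v)\<^sup>2" for v
    using Y(2) by (auto simp: frame_def)
  have bT: "bij T" by (rule posdef_bij[OF T])
  have TiT: "T (inv T x) = x" "inv T (T x) = x" for x using bT by (simp_all add: bij_is_surj surj_f_inv_f bij_is_inj)
  have iT: "posdef (inv T)" by (rule posdef_inv[OF T])
  have JK: "?J x = x \<or> ?J x = - x" if "x \<in> ?K" for x
    using that
  proof
    assume "x \<in> ?E ` K"
    then have "x $ t = 0" if "t \<notin> ?S" for t using that embed_component_off[OF inj] by auto
    then have "?J x = x" by (simp add: reflect_off_def vec_eq_iff)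
    then show ?thesis ..
  next
    assume "x \<in> ?off"
    then have "?J x = - x" by (auto simp: reflect_off_def vec_eq_iff axis_def)
    then show ?thesis ..
  qed
  \<comment> \<open>By the frame identity the squared norm of \<open>T v\<close> is a weighted sum
    of squares of x . v with \<open>x\<close> in \<open>?K\<close>, and the reflection changes such
    \<open>x\<close> only by a sign.\<close>
  have "norm (T (?J v)) = norm (T v)" for v
  proof -
    have "(norm (T (?J v)))\<^sup>2 = (\<Sum>y\<in>Y. w y * (y \<bullet> T (?J v))\<^sup>2)" by (simp add: frame)
    also have "\<dots> = (\<Sum>y\<in>Y. w y * (y \<bullet> T v)\<^sup>2)"
    proof (intro sum.cong refl)
      fix y assume "y \<in> Y"
      then obtain x where x: "x \<in> ?K" "y = inv T x" using Y(1) by blast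
      have "y \<bullet> T (?J v) = ?J x \<bullet> v" unfolding x(2) posdefD(4)[OF T, symmetric] TiT by (rule reflect_off_inner[symmetric])
      moreover have "y \<bullet> T v = x \<bullet> v" unfolding x(2) posdefD(4)[OF T, symmetric] TiT ..
      ultimately show "w y * (y \<bullet> T (?J v))\<^sup>2 = w y * (y \<bullet> T v)\<^sup>2" using JK[OF x(1)] by auto
    qed
    also have "\<dots> = (norm (T v))\<^sup>2" by (simp add: frame)
    finally show ?thesis by (simp add: power2_eq_iff_nonneg)
  qed
  then have JT: "T (?J v) = ?J (T v)" for v by (rule posdef_reflect_off_commute[OF T])
  have JiT: "inv T (?J v) = ?J (inv T v)" for v using JT[of "inv T v"] TiT by metis
  obtain S where S': "posdef S" "\<forall>x. S (S x) = T x" using posdef_sqrt[OF T] by blast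
  note S = S'(1) S'(2)[rule_format]
  have nS: "(norm (S v))\<^sup>2 = T v \<bullet> v" for v
    by (simp add: power2_norm_eq_inner posdefD(4)[OF S(1), of "S v", symmetric] S(2))
  have "norm (S (?J v)) = norm (S v)" for v
  proof -
    have "(norm (S (?J v)))\<^sup>2 = (norm (S v))\<^sup>2" unfolding nS JT reflect_off_inner reflect_off_idem ..
    then show ?thesis by (simp add: power2_eq_iff_nonneg)
  qed
  then have JS: "S (?J v) = ?J (S v)" for v by (rule posdef_reflect_off_commute[OF S(1)])
  let ?p = "block_entry \<iota> S" and ?b = "block_entry \<iota> T" and ?b' = "block_entry \<iota> (inv T)"
  define X where "X = {x \<in> K. inv T (?E x) \<in> Y}"
  define c where "c x = w (inv T (?E x))" for x
  let ?Y = "(\<lambda>x. inv T (?E x)) ` X"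
  have injX: "inj_on (\<lambda>x. inv T (?E x)) X"
  proof (rule inj_onI)
    fix x y assume xy: "x \<in> X" "y \<in> X" "inv T (?E x) = inv T (?E y)"
    then have "?E x = ?E y" using TiT(1) by metis
    then show "x = y" using embed_inj[OF inj] xy factor_bodyD(1)[OF K] by (auto simp: X_def)
  qed
  have YX: "?Y \<subseteq> Y" by (auto simp: X_def)
  have iTE: "inv T (?E x) = ?E (mat_apply n ?b' x)" for x
    by (rule block_entry_embed_off[OF posdefD(2)[OF iT] JiT])
  \<comment> \<open>Frame vectors that do not come from \<open>K\<close> are reversed by the
    reflection, so they vanish on the block; dropping them leaves the block of the identity
    unchanged.\<close>
  have off: "y $ \<iota> k = 0" if y: "y \<in> Y - ?Y" and k: "k < n" for y k
  proof -
    obtain t where t: "t \<notin> ?S" "y = inv T (axis t 1)" using y Y(1) by (auto simp: X_def)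
    have "?J (axis t 1 :: real ^ 't) = - axis t 1" using t(1) by (auto simp: reflect_off_def vec_eq_iff axis_def)
    then have "?J y = - y" unfolding t(2) JiT[symmetric] by (simp add: linear_neg[OF posdefD(2)[OF iT]])
    then have "?J y $ \<iota> k = - y $ \<iota> k" by simp
    then show ?thesis using k by (simp add: reflect_off_def)
  qed
  \<comment> \<open>Polarization of the frame identity, giving matrix entries.\<close>
  have pol: "(\<Sum>y\<in>Y. w y * ((y \<bullet> u) * (y \<bullet> v))) = u \<bullet> v" for u v
  proof -
    have "(\<Sum>y\<in>Y. w y * (y \<bullet> (u + v))\<^sup>2) = (\<Sum>y\<in>Y. w y * (y \<bullet> u)\<^sup>2) + (\<Sum>y\<in>Y. w y * (y \<bullet> v)\<^sup>2) +
        2 * (\<Sum>y\<in>Y. w y * ((y \<bullet> u) * (y \<bullet> v)))"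
      unfolding sum_distrib_left sum.distrib[symmetric]
      by (intro sum.cong) (auto simp: inner_add_right power2_eq_square algebra_simps)
    then have "(norm (u + v))\<^sup>2 = (norm u)\<^sup>2 + (norm v)\<^sup>2 + 2 * (\<Sum>y\<in>Y. w y * ((y \<bullet> u) * (y \<bullet> v)))"
      unfolding frame .
    then show ?thesis by (simp add: power2_norm_eq_inner inner_simps inner_commute)
  qed
  have gram: "(\<Sum>x\<in>X. c x * (coord (mat_apply n ?b' x) k * coord (mat_apply n ?b' x) m)) = (if k = m then 1 else 0)"
    if km: "k < n" "m < n" for k m
  proof -
    have "(\<Sum>x\<in>X. c x * (coord (mat_apply n ?b' x) k * coord (mat_apply n ?b' x) m)) =
        (\<Sum>y\<in>?Y. w y * (y $ \<iota> k * y $ \<iota> m))"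
      unfolding sum.reindex[OF injX] o_def c_def using km by (simp add: iTE embed_component[OF inj])
    also have "\<dots> = (\<Sum>y\<in>Y. w y * (y $ \<iota> k * y $ \<iota> m))"
      using fY(1) YX off km by (intro sum.mono_neutral_left) auto
    also have "\<dots> = axis (\<iota> k) 1 \<bullet> (axis (\<iota> m) 1 :: real ^ 't)"
      using pol[of "axis (\<iota> k) 1" "axis (\<iota> m) 1"] by (simp add: inner_axis)
    also have "\<dots> = (if k = m then 1 else 0)"
      using km inj_on_eq_iff[OF inj, of k m] by (simp add: inner_axis_axis)
    finally show ?thesis .
  qed
  \<comment> \<open>The trace of the frame shows that the nonnegative terms w y (1 - |y|^2) sum to
    0, so each vanishes. Weights may then be multiplied by squared norms, and the weight kept on the
    block is the trace n of its identity matrix.\<close>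
  have idb: "eigenbasis (\<lambda>v :: real ^ 't. v) Basis (\<lambda>_. 1)"
    by (auto simp: eigenbasis_def orthogonal_def pairwise_def inner_Basis)
  have "(\<Sum>y\<in>Y. w y * (norm y)\<^sup>2) = CARD('t)"
    using frame_hilbert_schmidt[OF Y(2) posdefD(1)[OF posdef_id] idb] by simp
  then have "(\<Sum>y\<in>Y. w y * (1 - (norm y)\<^sup>2)) = 0" using fY(3) by (simp add: right_diff_distrib sum_subtractf)
  moreover have "0 \<le> w y * (1 - (norm y)\<^sup>2)" if "y \<in> Y" for y
  proof -
    have "y \<in> cball 0 1" using that Y(1) ball by (meson subsetD)
    then have "norm y \<le> 1" by simp
    then show ?thesis using fY(2) that by (simp add: power_le_one)
  qed
  ultimately have unit: "w y * (1 - (norm y)\<^sup>2) = 0" if "y \<in> Y" for y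
    using sum_nonneg_eq_0_iff[OF fY(1), of "\<lambda>y. w y * (1 - (norm y)\<^sup>2)"] that by blast
  have normE: "(norm (inv T (?E x)))\<^sup>2 = dot n (mat_apply n ?b' x) (mat_apply n ?b' x)" for x
    unfolding iTE by (simp add: power2_norm_eq_inner inner_embed_embed[OF inj])
  have "sum c X = (\<Sum>x\<in>X. c x * dot n (mat_apply n ?b' x) (mat_apply n ?b' x))"
  proof (rule sum.cong[OF refl])
    fix x assume "x \<in> X"
    then have "w (inv T (?E x)) * (1 - (norm (inv T (?E x)))\<^sup>2) = 0" using unit YX by blast
    then show "c x = c x * dot n (mat_apply n ?b' x) (mat_apply n ?b' x)"
      unfolding normE c_def by (simp add: algebra_simps)
  qed
  also have "\<dots> = (\<Sum>k<n. \<Sum>x\<in>X. c x * (coord (mat_apply n ?b' x) k * coord (mat_apply n ?b' x) k))"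
    unfolding dot_def sum_distrib_left by (rule sum.swap)
  also have "\<dots> = real n" by (simp add: gram)
  finally have sc: "sum c X = real n" .
  show thesis
  proof (rule that[of ?p ?b' ?b X c])
    show "mat_sym n ?p" by (rule block_entry_sym[OF posdefD(1)[OF S(1)]])
    show "mat_sym n ?b'" by (rule block_entry_sym[OF posdefD(1)[OF iT]])
    have comp: "S \<circ> S = T" "T \<circ> inv T = (\<lambda>v. v)" "inv T \<circ> T = (\<lambda>v. v)" by (auto simp: S(2) TiT)
    show "mat_prod n ?p ?p k m = ?b k m" if "k < n" "m < n" for k m
      using block_entry_compose[OF posdefD(2)[OF S(1)] posdefD(2)[OF S(1)] JS that(2), of k] comp(1) by simp
    have "mat_prod n ?b ?b' k m = block_entry \<iota> (\<lambda>v. v) k m" if "m < n" for k m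
      using block_entry_compose[OF posdefD(2)[OF T] posdefD(2)[OF iT] JiT that, of k] comp(2) by simp
    then show "mat_id n (mat_prod n ?b ?b')" using block_entry_id by (simp add: mat_id_def)
    have "mat_prod n ?b' ?b k m = block_entry \<iota> (\<lambda>v. v) k m" if "m < n" for k m
      using block_entry_compose[OF posdefD(2)[OF iT] posdefD(2)[OF T] JT that, of k] comp(3) by simp
    then show "mat_id n (mat_prod n ?b' ?b)" using block_entry_id by (simp add: mat_id_def)
    show "finite X" using finite_subset[OF YX fY(1)] injX by (rule finite_imageD)
    show "X \<subseteq> K" by (auto simp: X_def)
    show "\<forall>x\<in>X. 0 \<le> c x" using fY(2) by (auto simp: X_def c_def)
    show "sum c X = real n" by (rule sc)
    show "mat_id n (\<lambda>k m. \<Sum>x\<in>X. c x * (coord (mat_apply n ?b' x) k * coord (mat_apply n ?b' x) m))"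
      by (simp add: mat_id_def gram)
    show "\<forall>x\<in>K. dot n (mat_apply n ?b' x) (mat_apply n ?b' x) \<le> 1"
    proof
      fix x assume "x \<in> K"
      then have "inv T (?E x) \<in> cball 0 1" using ball by blast
      then have "norm (inv T (?E x)) \<le> 1" by simp
      then show "dot n (mat_apply n ?b' x) (mat_apply n ?b' x) \<le> 1"
        unfolding normE[symmetric] by (simp add: power_le_one)
    qed
  qed
qed

end

section \<open>Tensor products of matrices\<close>

text \<open>The Kronecker product of the matrices \<open>a i\<close>, in the coordinates given by
  \<open>multi_index\<close>.\<close>

definition tensor_map ::
  "nat \<Rightarrow> (nat \<Rightarrow> nat) \<Rightarrow> (nat \<Rightarrow> nat \<Rightarrow> nat \<Rightarrow> real) \<Rightarrow> real ^ 't::finite \<Rightarrow> real ^ 't" where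
  "tensor_map l d a u =
     (\<chi> s. \<Sum>t\<in>UNIV. (\<Prod>i<l. a i (multi_index l d s i) (multi_index l d t i)) * u $ t)"

definition mats_id :: "nat \<Rightarrow> (nat \<Rightarrow> nat) \<Rightarrow> (nat \<Rightarrow> nat \<Rightarrow> nat \<Rightarrow> real) \<Rightarrow> bool" where
  "mats_id l d a \<longleftrightarrow> (\<forall>i<l. mat_id (d i) (a i))"

definition mats_prod :: "(nat \<Rightarrow> nat) \<Rightarrow> (nat \<Rightarrow> nat \<Rightarrow> nat \<Rightarrow> real) \<Rightarrow> (nat \<Rightarrow> nat \<Rightarrow> nat \<Rightarrow> real) \<Rightarrow> nat \<Rightarrow> nat \<Rightarrow> nat \<Rightarrow> real" where
  "mats_prod d a b i = mat_prod (d i) (a i) (b i)"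

definition mats_apply :: "(nat \<Rightarrow> nat) \<Rightarrow> (nat \<Rightarrow> nat \<Rightarrow> nat \<Rightarrow> real) \<Rightarrow> (nat \<Rightarrow> nat \<Rightarrow>\<^sub>0 real) \<Rightarrow> nat \<Rightarrow> nat \<Rightarrow>\<^sub>0 real" where
  "mats_apply d a x i = mat_apply (d i) (a i) (x i)"

text \<open>A frame is a set with weights, while a family may repeat a vector; weights of equal
  vectors are added.\<close>

lemma frame_indexed:
  fixes x :: "'i \<Rightarrow> 'a::euclidean_space" and c :: "'i \<Rightarrow> real"
  assumes I: "finite I" and c: "\<And>i. i \<in> I \<Longrightarrow> 0 \<le> c i" "sum c I = DIM('a)"
    and fr: "\<And>v. (\<Sum>i\<in>I. c i * (x i \<bullet> v)\<^sup>2) = (norm v)\<^sup>2"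
  shows "\<exists>w. frame (x ` I) w"
proof -
  let ?w = "\<lambda>y. \<Sum>i | i \<in> I \<and> x i = y. c i"
  have "frame (x ` I) ?w" unfolding frame_def
  proof (intro conjI allI ballI)
    show "finite (x ` I)" using I by simp
    show "0 \<le> ?w y" for y using c(1) by (intro sum_nonneg) auto
    show "sum ?w (x ` I) = DIM('a)" using sum.image_gen[OF I, of c x] c(2) by simp
    fix v
    have "(norm v)\<^sup>2 = (\<Sum>y\<in>x ` I. \<Sum>i | i \<in> I \<and> x i = y. c i * (x i \<bullet> v)\<^sup>2)"
      unfolding fr[symmetric] by (rule sum.image_gen[OF I])
    also have "\<dots> = (\<Sum>y\<in>x ` I. ?w y * (y \<bullet> v)\<^sup>2)"
      unfolding sum_distrib_right by (intro sum.cong) auto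
    finally show "(\<Sum>y\<in>x ` I. ?w y * (y \<bullet> v)\<^sup>2) = (norm v)\<^sup>2" by simp
  qed
  then show ?thesis by blast
qed

lemma tensor_cong: "(\<And>i. i < l \<Longrightarrow> x i = y i) \<Longrightarrow> tensor l d x = tensor l d y"
  by (simp add: tensor_def)

lemma tensor_scaleR: "tensor l d (\<lambda>i. c i *\<^sub>R x i) = (\<Prod>i<l. c i) *\<^sub>R tensor l d x"
  by (simp add: tensor_def vec_eq_iff prod.distrib)

lemma tensor_eq_0: "i < l \<Longrightarrow> x i = 0 \<Longrightarrow> tensor l d x = 0"
  by (auto simp: tensor_def vec_eq_iff intro!: bexI[of _ i])

lemma linear_tensor_map: "linear (tensor_map l d a)"
  by (rule linearI) (simp_all add: tensor_map_def vec_eq_iff distrib_left sum.distrib sum_distrib_left mult.left_commute)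

text \<open>The parameter \<open>ty\<close> only fixes the type variable of the tensor space.\<close>

context
  fixes l :: nat and d :: "nat \<Rightarrow> nat" and ty :: "'t::finite itself"
  assumes card: "CARD('t) = (\<Prod>i<l. d i)"
begin

lemma multi_index_less: "i < l \<Longrightarrow> multi_index l d (t :: 't) i < d i"
  using bij_multi_index[OF card] by (auto simp: bij_betw_def PiE_iff)

lemma multi_index_eqI:
  assumes "\<And>i. i < l \<Longrightarrow> multi_index l d s i = multi_index l d t i"
  shows "s = (t :: 't)"
proof -
  have b: "bij_betw (multi_index l d :: 't \<Rightarrow> nat \<Rightarrow> nat) UNIV (\<Pi>\<^sub>E i\<in>{..<l}. {..<d i})" by (rule bij_multi_index[OF card])
  have mem: "multi_index l d u \<in> (\<Pi>\<^sub>E i\<in>{..<l}. {..<d i})" for u :: 't using bij_betwE[OF b] by blast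
  have "multi_index l d s = multi_index l d t" using assms by (intro PiE_ext[OF mem mem]) auto
  then show ?thesis using bij_betw_imp_inj_on[OF b] by (simp add: inj_on_eq_iff)
qed

lemma sum_multi_index:
  "(\<Sum>t\<in>(UNIV :: 't set). \<Prod>i<l. f i (multi_index l d t i)) = (\<Prod>i<l. \<Sum>k<d i. (f i k :: real))"
proof -
  have "(\<Sum>t\<in>(UNIV :: 't set). \<Prod>i<l. f i (multi_index l d t i)) = (\<Sum>s\<in>(\<Pi>\<^sub>E i\<in>{..<l}. {..<d i}). \<Prod>i<l. f i (s i))"
    by (rule sum.reindex_bij_betw[OF bij_multi_index[OF card]])
  then show ?thesis by (subst prod_sum_PiE) auto
qed

lemma prod_multi_index_delta:
  "(\<Prod>i<l. if multi_index l d s i = multi_index l d t i then 1 else (0::real)) = (if s = (t :: 't) then 1 else 0)"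
proof (cases "s = t")
  case False
  then have "\<exists>i<l. multi_index l d s i \<noteq> multi_index l d t i" using multi_index_eqI by blast
  then show ?thesis using False by (auto simp: prod_zero_iff)
qed simp

lemma tensor_map_tensor: "tensor_map l d a (tensor l d x) = (tensor l d (mats_apply d a x) :: real ^ 't)"
proof -
  have "(\<Sum>t\<in>(UNIV :: 't set). (\<Prod>i<l. a i (multi_index l d s i) (multi_index l d t i)) * tensor l d x $ t) =
      (\<Prod>i<l. coord (mats_apply d a x i) (multi_index l d s i))" for s :: 't
  proof -
    have "(\<Sum>t\<in>(UNIV :: 't set). (\<Prod>i<l. a i (multi_index l d s i) (multi_index l d t i)) * tensor l d x $ t) =
        (\<Sum>t\<in>(UNIV :: 't set). \<Prod>i<l. a i (multi_index l d s i) (multi_index l d t i) * coord (x i) (multi_index l d t i))"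
      by (simp add: tensor_def prod.distrib)
    also have "\<dots> = (\<Prod>i<l. \<Sum>k<d i. a i (multi_index l d s i) k * coord (x i) k)"
      by (rule sum_multi_index)
    also have "\<dots> = (\<Prod>i<l. coord (mats_apply d a x i) (multi_index l d s i))"
      by (intro prod.cong) (auto simp: mats_apply_def coord_mat_apply multi_index_less)
    finally show ?thesis .
  qed
  then show ?thesis by (simp add: tensor_map_def tensor_def vec_eq_iff)
qed

lemma tensor_map_compose: "tensor_map l d a (tensor_map l d b u) = tensor_map l d (mats_prod d a b) (u :: real ^ 't)"
proof -
  have "(\<Sum>t\<in>UNIV. (\<Prod>i<l. a i (multi_index l d s i) (multi_index l d t i)) * tensor_map l d b u $ t) =
      (\<Sum>r\<in>UNIV. (\<Prod>i<l. mats_prod d a b i (multi_index l d s i) (multi_index l d r i)) * u $ r)" for s :: 't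
  proof -
    have "(\<Sum>t\<in>UNIV. (\<Prod>i<l. a i (multi_index l d s i) (multi_index l d t i)) * tensor_map l d b u $ t) =
       (\<Sum>r\<in>UNIV. (\<Sum>t\<in>(UNIV :: 't set). \<Prod>i<l. a i (multi_index l d s i) (multi_index l d t i) *
          b i (multi_index l d t i) (multi_index l d r i)) * u $ r)"
      unfolding tensor_map_def vec_lambda_beta sum_distrib_left sum_distrib_right prod.distrib
      by (subst sum.swap) (simp add: mult.assoc)
    also have "\<dots> = (\<Sum>r\<in>UNIV. (\<Prod>i<l. mats_prod d a b i (multi_index l d s i) (multi_index l d r i)) * u $ r)"
      unfolding mats_prod_def mat_prod_def
      by (simp add: sum_multi_index[of "\<lambda>i k. a i (multi_index l d s i) k * b i k (multi_index l d _ i)"])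
    finally show ?thesis .
  qed
  then show ?thesis by (simp add: tensor_map_def[of l d a] tensor_map_def[of l d "mats_prod d a b"] vec_eq_iff)
qed

lemma tensor_map_id: assumes "mats_id l d a" shows "tensor_map l d a u = (u :: real ^ 't)"
proof -
  have "(\<Prod>i<l. a i (multi_index l d s i) (multi_index l d t i)) = (if s = t then 1 else 0)" for s t :: 't
    unfolding prod_multi_index_delta[symmetric]
    using assms multi_index_less by (intro prod.cong) (auto simp: mats_id_def mat_id_def)
  then have "tensor_map l d a u $ s = (\<Sum>t\<in>UNIV. if t = s then u $ s else 0)" for s
    unfolding tensor_map_def vec_lambda_beta by (intro sum.cong) auto
  then show ?thesis by (simp add: vec_eq_iff)
qed

lemma tensor_map_inner:
  "tensor_map l d a u \<bullet> v = u \<bullet> tensor_map l d (\<lambda>i k m. a i m k) (v :: real ^ 't)"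
proof -
  have "tensor_map l d a u \<bullet> v =
     (\<Sum>s\<in>UNIV. \<Sum>t\<in>UNIV. (\<Prod>i<l. a i (multi_index l d s i) (multi_index l d t i)) * u $ t * v $ s)"
    by (simp add: tensor_map_def inner_vec_def sum_distrib_right)
  also have "\<dots> = (\<Sum>t\<in>UNIV. \<Sum>s\<in>UNIV. (\<Prod>i<l. a i (multi_index l d s i) (multi_index l d t i)) * u $ t * v $ s)"
    by (rule sum.swap)
  also have "\<dots> = u \<bullet> tensor_map l d (\<lambda>i k m. a i m k) v"
    by (simp add: tensor_map_def inner_vec_def sum_distrib_left mult_ac)
  finally show ?thesis .
qed

lemma tensor_map_cong:
  assumes "\<And>i k m. i < l \<Longrightarrow> k < d i \<Longrightarrow> m < d i \<Longrightarrow> a i k m = b i k m"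
  shows "tensor_map l d a u = tensor_map l d b (u :: real ^ 't)"
proof -
  have "(\<Prod>i<l. a i (multi_index l d s i) (multi_index l d t i)) =
      (\<Prod>i<l. b i (multi_index l d s i) (multi_index l d t i))" for s t :: 't
    using assms multi_index_less by (intro prod.cong) auto
  then show ?thesis by (simp add: tensor_map_def)
qed

lemma tensor_map_symmetric:
  assumes "\<And>i. i < l \<Longrightarrow> mat_sym (d i) (a i)"
  shows "symmetric_op (tensor_map l d a :: real ^ 't \<Rightarrow> real ^ 't)"
proof -
  have "tensor_map l d (\<lambda>i k m. a i m k) v = tensor_map l d a v" for v :: "real ^ 't"
    using assms by (intro tensor_map_cong) (simp add: mat_sym_def)
  then show ?thesis by (simp add: symmetric_op_def linear_tensor_map tensor_map_inner)
qed

lemma tensor_map_inverse: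
  assumes "mats_id l d (mats_prod d a b)"
  shows "tensor_map l d a (tensor_map l d b u) = (u :: real ^ 't)"
  by (simp add: tensor_map_compose tensor_map_id[OF assms])

lemma tensor_map_bij:
  assumes "mats_id l d (mats_prod d a b)" "mats_id l d (mats_prod d b a)"
  shows "bij (tensor_map l d a :: real ^ 't \<Rightarrow> real ^ 't)" "inv (tensor_map l d a) = (tensor_map l d b :: real ^ 't \<Rightarrow> real ^ 't)"
proof -
  show "bij (tensor_map l d a :: real ^ 't \<Rightarrow> real ^ 't)"
    by (rule o_bij[of "tensor_map l d b"]) (auto simp: tensor_map_inverse assms)
  show "inv (tensor_map l d a) = (tensor_map l d b :: real ^ 't \<Rightarrow> real ^ 't)"
    by (rule inv_unique_comp) (auto simp: tensor_map_inverse assms)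
qed

text \<open>Tensoring the roots gives a symmetric ?P with ?P ?P = ?A, so ?A x . x is the squared
  norm of ?P x, which is nonzero for x nonzero by injectivity of ?A.\<close>

lemma tensor_map_posdef:
  assumes ab: "mats_id l d (mats_prod d a b)" "mats_id l d (mats_prod d b a)"
    and p: "\<And>i. i < l \<Longrightarrow> mat_sym (d i) (p i)"
    "\<And>i k m. i < l \<Longrightarrow> k < d i \<Longrightarrow> m < d i \<Longrightarrow> mats_prod d p p i k m = a i k m"
  shows "posdef (tensor_map l d a :: real ^ 't \<Rightarrow> real ^ 't)"
proof -
  let ?P = "tensor_map l d p :: real ^ 't \<Rightarrow> real ^ 't" and ?A = "tensor_map l d a :: real ^ 't \<Rightarrow> real ^ 't"
  have P: "symmetric_op ?P" by (rule tensor_map_symmetric[OF p(1)])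
  have PP: "?A u = ?P (?P u)" for u
    unfolding tensor_map_compose by (rule tensor_map_cong) (simp add: p(2))
  have "?A x \<bullet> y = x \<bullet> ?A y" for x y unfolding PP symmetric_opD(2)[OF P] ..
  moreover have "0 < ?A x \<bullet> x" if "x \<noteq> 0" for x
  proof -
    have "?P x \<noteq> 0"
    proof
      assume "?P x = 0"
      then have "?A x = 0" by (simp add: PP linear_0[OF linear_tensor_map])
      then have "x = 0" using tensor_map_inverse[OF ab(2), of x] by (simp add: linear_0[OF linear_tensor_map])
      then show False using that by simp
    qed
    moreover have "?A x \<bullet> x = ?P x \<bullet> ?P x" unfolding PP by (rule symmetric_opD(2)[OF P])
    ultimately show ?thesis by simp
  qed
  ultimately show ?thesis by (simp add: posdef_def symmetric_op_def linear_tensor_map)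
qed

lemma tensor_map_decomposable: "u \<in> decomposable l d \<Longrightarrow> tensor_map l d a u \<in> (decomposable l d :: (real ^ 't) set)"
  unfolding decomposable_def
  by (auto simp: tensor_map_tensor) (metis mat_apply_in_euclid mats_apply_def)

lemma tensor_map_decomposable_image:
  assumes "mats_id l d (mats_prod d a b)"
  shows "tensor_map l d a ` decomposable l d = (decomposable l d :: (real ^ 't) set)"
proof
  show "tensor_map l d a ` decomposable l d \<subseteq> (decomposable l d :: (real ^ 't) set)"
    using tensor_map_decomposable by blast
  show "(decomposable l d :: (real ^ 't) set) \<subseteq> tensor_map l d a ` decomposable l d"
  proof
    fix u :: "real ^ 't" assume "u \<in> decomposable l d"
    then have "tensor_map l d b u \<in> decomposable l d" by (rule tensor_map_decomposable)
    then show "u \<in> tensor_map l d a ` decomposable l d"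
      using tensor_map_inverse[OF assms, of u] by (metis image_eqI)
  qed
qed

lemma tensor_axis: "(axis t 1 :: real ^ 't) = tensor l d (\<lambda>i. Poly_Mapping.single (multi_index l d t i) 1)"
proof -
  have "(\<Prod>i<l. coord (Poly_Mapping.single (multi_index l d t i) 1) (multi_index l d s i)) =
     (if t = s then 1 else (0::real))" for s :: 't
    unfolding prod_multi_index_delta[symmetric] by (intro prod.cong) (auto simp: lookup_single)
  then show ?thesis by (auto simp: tensor_def axis_def vec_eq_iff)
qed

end

section \<open>Polars and the two inclusions defining tensorial bodies\<close>

lemma polar_convex_hull: "x \<in> polar (convex hull S) \<longleftrightarrow> (\<forall>y\<in>S. \<bar>y \<bullet> x\<bar> \<le> 1)"
proof
  assume r: "\<forall>y\<in>S. \<bar>y \<bullet> x\<bar> \<le> 1"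
  have "convex {y. \<bar>y \<bullet> x\<bar> \<le> 1}"
  proof -
    have "{y. \<bar>y \<bullet> x\<bar> \<le> 1} = {y. x \<bullet> y \<le> 1} \<inter> {y. x \<bullet> y \<ge> - 1}" by (auto simp: inner_commute abs_le_iff)
    then show ?thesis by (simp add: convex_Int convex_halfspace_le convex_halfspace_ge)
  qed
  moreover have "S \<subseteq> {y. \<bar>y \<bullet> x\<bar> \<le> 1}" using r by blast
  ultimately have "convex hull S \<subseteq> {y. \<bar>y \<bullet> x\<bar> \<le> 1}" by (rule hull_minimal[rotated])
  then show "x \<in> polar (convex hull S)" by (auto simp: polar_def)
next
  assume "x \<in> polar (convex hull S)"
  then show "\<forall>y\<in>S. \<bar>y \<bullet> x\<bar> \<le> 1" by (auto simp: polar_def hull_inc)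
qed

lemma inj_tensor_iff:
  "u \<in> inj_tensor l d K \<longleftrightarrow>
    (\<forall>y. (\<forall>i<l. y i \<in> factor_polar (d i) (K i)) \<longrightarrow> \<bar>tensor l d y \<bullet> u\<bar> \<le> 1)"
  unfolding inj_tensor_def proj_tensor_def polar_convex_hull by blast

lemma tensorial_bodyE:
  assumes "Q \<in> tensorial_bodies l d"
  obtains K where "symmetric_body Q" "\<And>i. i < l \<Longrightarrow> factor_body (d i) (K i)"
    "\<And>x. (\<And>i. i < l \<Longrightarrow> x i \<in> K i) \<Longrightarrow> tensor l d x \<in> Q"
    "\<And>u y. u \<in> Q \<Longrightarrow> (\<And>i. i < l \<Longrightarrow> y i \<in> factor_polar (d i) (K i)) \<Longrightarrow> \<bar>tensor l d y \<bullet> u\<bar> \<le> 1"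
proof -
  obtain K where K: "symmetric_body Q" "\<forall>i<l. factor_body (d i) (K i)" "proj_tensor l d K \<subseteq> Q" "Q \<subseteq> inj_tensor l d K"
    using assms by (auto simp: tensorial_bodies_def)
  have "tensor l d x \<in> Q" if "\<And>i. i < l \<Longrightarrow> x i \<in> K i" for x
    using K(3) that unfolding proj_tensor_def by (auto intro: hull_inc)
  moreover have "\<bar>tensor l d y \<bullet> u\<bar> \<le> 1"
    if "u \<in> Q" "\<And>i. i < l \<Longrightarrow> y i \<in> factor_polar (d i) (K i)" for u y
    using K(4) that inj_tensor_iff by blast
  ultimately show thesis using that K by blast
qed

lemma tensorial_bodyI:
  fixes Q :: "(real ^ 't::finite) set"
  assumes Q: "symmetric_body Q" and K: "\<And>i. i < l \<Longrightarrow> factor_body (d i) (K i)"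
    and proj: "\<And>x. (\<And>i. i < l \<Longrightarrow> x i \<in> K i) \<Longrightarrow> tensor l d x \<in> Q"
    and inj: "\<And>u y. u \<in> Q \<Longrightarrow> (\<And>i. i < l \<Longrightarrow> y i \<in> factor_polar (d i) (K i)) \<Longrightarrow> \<bar>tensor l d y \<bullet> u\<bar> \<le> 1"
  shows "Q \<in> tensorial_bodies l d"
proof -
  have "{tensor l d x | x. \<forall>i<l. x i \<in> K i} \<subseteq> Q" using proj by blast
  then have "proj_tensor l d K \<subseteq> Q"
    unfolding proj_tensor_def using Q by (intro hull_minimal) (auto simp: symmetric_body_def)
  moreover have "Q \<subseteq> inj_tensor l d K" using inj by (auto simp: inj_tensor_iff)
  ultimately show ?thesis using Q K unfolding tensorial_bodies_def by blast
qed

lemma symmetric_body_linear_image: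
  fixes Q :: "'a::euclidean_space set"
  assumes Q: "symmetric_body Q" and T: "linear T" "bij T"
  shows "symmetric_body (T ` Q :: 'a set)"
proof -
  have "interior (T ` Q) = T ` interior Q" by (rule interior_bijective_linear_image[OF T])
  moreover have "T ` Q = uminus ` T ` Q"
  proof -
    have "T ` Q = T ` uminus ` Q" using Q by (simp add: symmetric_body_def)
    also have "\<dots> = uminus ` T ` Q" by (simp add: image_image linear_neg[OF T(1)])
    finally show ?thesis .
  qed
  ultimately show ?thesis
    using Q T by (auto simp: symmetric_body_def compact_linear_image convex_linear_image)
qed

lemma symmetric_body_cball_01: "symmetric_body (cball 0 1 :: 'a::euclidean_space set)"
proof -
  have "(0::'a) \<in> interior (cball 0 1)" by (simp add: interior_cball)
  moreover have "(cball 0 1 :: 'a set) = uminus ` cball 0 1" by (auto intro: image_eqI[of _ uminus "- _"])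
  ultimately show ?thesis unfolding symmetric_body_def by (metis compact_cball convex_cball empty_iff)
qed

section \<open>The John position of a tensorial body\<close>

text \<open>Packages the conclusions of \<open>factor_john\<close>, so that the data of all factors
  can be chosen simultaneously.\<close>

definition factor_john_data where
  "factor_john_data n K p b b' X c \<longleftrightarrow>
    mat_sym n p \<and> mat_sym n b' \<and> (\<forall>k<n. \<forall>m<n. mat_prod n p p k m = b k m) \<and>
    mat_id n (mat_prod n b b') \<and> mat_id n (mat_prod n b' b) \<and>
    finite X \<and> X \<subseteq> K \<and> (\<forall>x\<in>X. 0 \<le> c x) \<and> sum c X = real n \<and>
    mat_id n (\<lambda>k m. \<Sum>x\<in>X. c x * (coord (mat_apply n b' x) k * coord (mat_apply n b' x) m)) \<and>
    (\<forall>x\<in>K. dot n (mat_apply n b' x) (mat_apply n b' x) \<le> 1)"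

lemma symmetric_body_0: "symmetric_body Q \<Longrightarrow> 0 \<in> (Q :: 'a::euclidean_space set)"
  by (rule symmetric_body_cball) auto

context
  fixes l :: nat and d :: "nat \<Rightarrow> nat" and ty :: "'t::finite itself"
  assumes card: "CARD('t) = (\<Prod>i<l. d i)" and l: "1 \<le> l" and d: "\<forall>i<l. 1 \<le> d i"
begin

lemma inj_factor_coordinates:
  assumes "i < l" shows "\<exists>\<iota> :: nat \<Rightarrow> 't. inj_on \<iota> {..<d i}"
proof -
  have "d i dvd (\<Prod>i<l. d i)" using assms by (intro dvd_prodI) auto
  moreover have "0 < (\<Prod>i<l. d i)" using d by (intro prod_pos) force
  ultimately have "card {..<d i} \<le> card (UNIV :: 't set)" unfolding card by (simp add: dvd_imp_le)
  then show ?thesis using card_le_inj[of "{..<d i}" "UNIV :: 't set"] by auto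
qed

text \<open>The projective inclusion gives membership after scaling each factor to the boundary of
  its body; the injective inclusion gives the converse by multiplying separating functionals. Only
  positivity and homogeneity of \<open>g\<close> are exported, which is all that the sections
  require.\<close>

lemma tensorial_gauge:
  fixes Q :: "(real ^ 't) set"
  assumes Q: "Q \<in> tensorial_bodies l d"
  obtains g where "\<And>i x. i < l \<Longrightarrow> x \<in> euclid (d i) \<Longrightarrow> x \<noteq> 0 \<Longrightarrow> 0 < (g i x :: real)"
    "\<And>i x c. i < l \<Longrightarrow> x \<in> euclid (d i) \<Longrightarrow> x \<noteq> 0 \<Longrightarrow> 0 < c \<Longrightarrow> g i (c *\<^sub>R x) = c * g i x"
    "\<And>x c. (\<And>i. i < l \<Longrightarrow> x i \<in> euclid (d i) \<and> x i \<noteq> 0) \<Longrightarrow> 0 < c \<Longrightarrow>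
      c *\<^sub>R tensor l d x \<in> Q \<longleftrightarrow> c * (\<Prod>i<l. g i (x i)) \<le> 1"
proof -
  obtain K where K: "symmetric_body Q" "\<And>i. i < l \<Longrightarrow> factor_body (d i) (K i)"
    "\<And>x. (\<And>i. i < l \<Longrightarrow> x i \<in> K i) \<Longrightarrow> tensor l d x \<in> Q"
    "\<And>u y. u \<in> Q \<Longrightarrow> (\<And>i. i < l \<Longrightarrow> y i \<in> factor_polar (d i) (K i)) \<Longrightarrow> \<bar>tensor l d y \<bullet> u\<bar> \<le> 1"
    using tensorial_bodyE[OF Q] by blast
  define g where "g i = minkowski_functional (K i)" for i
  show thesis
  proof (rule that[of g])
    show "0 < g i x" if "i < l" "x \<in> euclid (d i)" "x \<noteq> 0" for i x
      unfolding g_def using factor_body_gauge(1)[OF K(2)] that by blast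
    show "g i (c *\<^sub>R x) = c * g i x" if "i < l" "x \<in> euclid (d i)" "x \<noteq> 0" "0 < c" for i x c
      unfolding g_def using factor_body_gauge_scaleR[OF K(2)] that by blast
    fix x and c :: real assume x: "\<And>i. i < l \<Longrightarrow> x i \<in> euclid (d i) \<and> x i \<noteq> 0" and c: "0 < c"
    have pos: "0 < g i (x i)" if "i < l" for i
      unfolding g_def using factor_body_gauge(1)[OF K(2)] that x by blast
    have mem: "inverse k *\<^sub>R x i \<in> K i \<longleftrightarrow> g i (x i) \<le> k" if "i < l" "0 < k" for i k
      unfolding g_def using factor_body_gauge(2)[OF K(2)] that x by blast
    let ?P = "\<Prod>i<l. g i (x i)"
    have P: "0 < ?P" using pos by (intro prod_pos) auto
    show "c *\<^sub>R tensor l d x \<in> Q \<longleftrightarrow> c * ?P \<le> 1"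
    proof
      assume le: "c * ?P \<le> 1"
      have "tensor l d (\<lambda>i. inverse (g i (x i)) *\<^sub>R x i) \<in> Q"
        using mem pos by (intro K(3)) auto
      then have "(c * ?P) *\<^sub>R tensor l d (\<lambda>i. inverse (g i (x i)) *\<^sub>R x i) + (1 - c * ?P) *\<^sub>R 0 \<in> Q"
        using K(1) symmetric_body_0 le c P by (intro convexD) (auto simp: symmetric_body_def)
      moreover have "(\<Prod>i<l. inverse (g i (x i))) = inverse ?P"
        using prod_inversef[of "\<lambda>i. g i (x i)" "{..<l}"] by (simp add: o_def)
      moreover have "?P * inverse ?P = 1" using P by (intro right_inverse) linarith
      ultimately show "c *\<^sub>R tensor l d x \<in> Q"
        unfolding tensor_scaleR scaleR_scaleR mult.assoc by (simp only: mult_1_right scaleR_zero_right add_0_right)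
    next
      assume mQ: "c *\<^sub>R tensor l d x \<in> Q"
      show "c * ?P \<le> 1"
      proof (rule ccontr)
        assume "\<not> c * ?P \<le> 1"
        then have gt: "1 < c * ?P" by simp
        \<comment> \<open>The excess of \<open>c * ?P\<close> over 1 is spread evenly over the l
          factors: scaling down by h still leaves each factor outside its body, and the l separating
          inequalities multiply to a contradiction.\<close>
        define h where "h = root l (1 / (c * ?P))"
        have h: "0 < h" "h < 1" "h ^ l = 1 / (c * ?P)"
          using gt l by (simp_all add: h_def real_root_pow_pos2)
        have "\<exists>y. y \<in> factor_polar (d i) (K i) \<and> h * g i (x i) < dot (d i) (x i) y" if i: "i < l" for i
        proof -
          obtain \<iota> :: "nat \<Rightarrow> 't" where \<iota>: "inj_on \<iota> {..<d i}" using inj_factor_coordinates[OF i] by blast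
          define k where "k = h * g i (x i)"
          have k: "0 < k" "k < g i (x i)" using h pos[OF i] by (simp_all add: k_def)
          then have "inverse k *\<^sub>R x i \<notin> K i" using mem[OF i k(1)] by simp
          then obtain y where y: "y \<in> factor_polar (d i) (K i)" "1 < dot (d i) (inverse k *\<^sub>R x i) y"
            using factor_body_separation[OF \<iota> K(2)[OF i] euclid_scaleR] x[OF i] by blast
          have "1 < inverse k * dot (d i) (x i) y" using y(2) unfolding dot_scaleR_left .
          then have "k < dot (d i) (x i) y" using k(1) by (simp add: field_simps)
          then have "h * g i (x i) < dot (d i) (x i) y" by (simp only: k_def)
          then show ?thesis using y(1) by blast
        qed
        then have "\<forall>i. \<exists>y. i < l \<longrightarrow> y \<in> factor_polar (d i) (K i) \<and> h * g i (x i) < dot (d i) (x i) y" by blast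
        from choice[OF this] obtain y where y: "\<And>i. i < l \<Longrightarrow> y i \<in> factor_polar (d i) (K i)"
          "\<And>i. i < l \<Longrightarrow> h * g i (x i) < dot (d i) (x i) (y i)" by blast
        have "\<bar>tensor l d y \<bullet> (c *\<^sub>R (tensor l d x :: real ^ 't))\<bar> \<le> 1" by (rule K(4)[OF mQ y(1)])
        moreover have "tensor l d y \<bullet> (c *\<^sub>R (tensor l d x :: real ^ 't)) = c * (\<Prod>i<l. dot (d i) (x i) (y i))"
          by (simp add: inner_tensor[OF card] dot_commute)
        moreover have "(\<Prod>i<l. h * g i (x i)) < (\<Prod>i<l. dot (d i) (x i) (y i))"
        proof (rule prod_mono_strict[of 0])
          show "0 \<in> {..<l}" using l by simp
          show "h * g 0 (x 0) < dot (d 0) (x 0) (y 0)" using y(2) l by simp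
          fix i assume "i \<in> {..<l}"
          then have "0 < h * g i (x i)" "h * g i (x i) < dot (d i) (x i) (y i)" using h(1) pos y(2) by auto
          then show "0 \<le> h * g i (x i) \<and> h * g i (x i) \<le> dot (d i) (x i) (y i)" "0 < dot (d i) (x i) (y i)" by linarith+
        qed simp
        moreover have "(\<Prod>i<l. h * g i (x i)) = 1 / c"
        proof -
          have "1 / (c * q) * q = 1 / c" if "0 < q" for q :: real using that c by simp
          from this[OF P] show ?thesis unfolding prod.distrib h(3)[symmetric] by simp
        qed
        ultimately have "c * (\<Prod>i<l. dot (d i) (x i) (y i)) \<le> 1" "1 / c < (\<Prod>i<l. dot (d i) (x i) (y i))"
          by linarith+
        then show False using c by (simp add: divide_less_eq mult.commute)
      qed
    qed
  qed
qed

lemma e1_euclid: "i < l \<Longrightarrow> e1 \<in> euclid (d i)" and e1_nonzero: "e1 \<noteq> 0"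
proof -
  show "e1 \<in> euclid (d i)" if "i < l"
    unfolding euclid_iff e1_def
  proof (intro allI impI)
    fix k assume "d i \<le> k"
    moreover have "1 \<le> d i" using d that by blast
    ultimately have "0 \<noteq> k" by simp
    then show "coord (Poly_Mapping.single 0 1) k = 0" by (rule lookup_single_not_eq)
  qed
  have "coord e1 0 = 1" unfolding e1_def by (rule lookup_single_eq)
  then show "e1 \<noteq> 0" by force
qed

text \<open>The i-th section is the sublevel set of \<open>g i\<close> at the gauge
  \<open>w i\<close> of its base vector. Since the product of the \<open>w i\<close> is 1, these
  conditions bound the product of gauges by 1, and conversely scalars can be moved between factors
  to meet them.\<close>

lemma tensor_sections:
  fixes Q :: "(real ^ 't) set"
  assumes Q: "Q \<in> tensorial_bodies l d"
  shows "{tensor l d x | x. \<forall>i<l. x i \<in> factor_section l d Q i} = Q \<inter> decomposable l d"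
proof -
  obtain g where pos: "\<And>i x. i < l \<Longrightarrow> x \<in> euclid (d i) \<Longrightarrow> x \<noteq> 0 \<Longrightarrow> 0 < (g i x :: real)"
    and hom: "\<And>i x c. i < l \<Longrightarrow> x \<in> euclid (d i) \<Longrightarrow> x \<noteq> 0 \<Longrightarrow> 0 < c \<Longrightarrow> g i (c *\<^sub>R x) = c * g i x"
    and cross: "\<And>x c. (\<And>i. i < l \<Longrightarrow> x i \<in> euclid (d i) \<and> x i \<noteq> 0) \<Longrightarrow> 0 < c \<Longrightarrow>
      c *\<^sub>R tensor l d x \<in> Q \<longleftrightarrow> c * (\<Prod>i<l. g i (x i)) \<le> 1"
    using tensorial_gauge[OF Q] by blast
  have cross1: "tensor l d x \<in> Q \<longleftrightarrow> (\<Prod>i<l. g i (x i)) \<le> 1"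
    if "\<And>i. i < l \<Longrightarrow> x i \<in> euclid (d i) \<and> x i \<noteq> 0" for x
    using cross[of x 1] that by simp
  have Q0: "0 \<in> Q" using Q by (auto simp: tensorial_bodies_def intro: symmetric_body_0)
  define C where "C = (\<Prod>i<l. g i e1)"
  have C: "0 < C" unfolding C_def using pos e1_euclid e1_nonzero by (intro prod_pos) auto
  have "minkowski_functional Q (tensor l d (\<lambda>_. e1)) = C"
  proof (rule minkowski_functional_eqI[OF C])
    fix k :: real assume k: "0 < k"
    then show "inverse k *\<^sub>R tensor l d (\<lambda>_. e1) \<in> Q \<longleftrightarrow> C \<le> k"
      using cross[of "\<lambda>_. e1" "inverse k"] e1_euclid e1_nonzero by (simp add: C_def field_simps)
  qed
  then have a: "base_vectors l d Q j = (if j = l - 1 then 1 / C else 1) *\<^sub>R e1" for j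
    by (simp add: base_vectors_def)
  let ?a = "base_vectors l d Q"
  have ae: "?a j \<in> euclid (d j) \<and> ?a j \<noteq> 0" if "j < l" for j
    using that e1_euclid e1_nonzero C by (auto simp: a euclid_scaleR)
  define w where "w j = g j (?a j)" for j
  have wp: "0 < w j" if "j < l" for j using pos ae that by (simp add: w_def)
  \<comment> \<open>The factor 1 / C on the last base vector is exactly what normalizes this
    product.\<close>
  have w1: "(\<Prod>j<l. w j) = 1"
  proof -
    have "(\<Prod>j<l. w j) = (\<Prod>j<l. (if j = l - 1 then 1 / C else 1) * g j e1)"
    proof (intro prod.cong refl)
      fix j assume "j \<in> {..<l}"
      then show "w j = (if j = l - 1 then 1 / C else 1) * g j e1"
        unfolding w_def a using C by (intro hom e1_euclid e1_nonzero) auto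
    qed
    also have "\<dots> = (\<Prod>j<l. if j = l - 1 then 1 / C else 1) * C" unfolding C_def by (rule prod.distrib)
    also have "(\<Prod>j<l. if j = l - 1 then 1 / C else 1) = 1 / C" using l by (subst prod.delta) auto
    finally show ?thesis using C by simp
  qed
  \<comment> \<open>With base vectors in all other slots, the remaining gauges multiply to 1 / w
    i.\<close>
  have sec: "x \<in> factor_section l d Q i \<longleftrightarrow> x \<in> euclid (d i) \<and> (x = 0 \<or> g i x \<le> w i)" if i: "i < l" for i x
  proof (cases "x \<in> euclid (d i) \<and> x \<noteq> 0")
    case True
    have "x \<in> factor_section l d Q i \<longleftrightarrow> (\<Prod>j<l. g j ((?a(i := x)) j)) \<le> 1"
    proof -
      have "(tensor l d (?a(i := x)) \<in> Q) = ((\<Prod>j<l. g j ((?a(i := x)) j)) \<le> 1)"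
        by (rule cross1) (use True ae in simp)
      then show ?thesis unfolding factor_section_def using True by blast
    qed
    also have "(\<Prod>j<l. g j ((?a(i := x)) j)) = g i x * (\<Prod>j\<in>{..<l} - {i}. w j)"
      using i by (subst prod.remove[of _ i]) (auto simp: w_def intro!: prod.cong)
    also have "(\<Prod>j\<in>{..<l} - {i}. w j) = 1 / w i"
      using w1 wp[OF i] i prod.remove[of "{..<l}" i w] by (simp add: field_simps)
    also have "g i x * (1 / w i) \<le> 1 \<longleftrightarrow> g i x \<le> w i" using wp[OF i] by (simp add: divide_le_eq)
    finally show ?thesis using True by blast
  next
    case False
    have "(tensor l d (?a(i := 0)) :: real ^ 't) = 0" by (rule tensor_eq_0[OF i]) simp
    then show ?thesis using False Q0 by (auto simp: factor_section_def)
  qed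
  show ?thesis
  proof (intro equalityI subsetI)
    fix u :: "real ^ 't" assume "u \<in> {tensor l d x | x. \<forall>i<l. x i \<in> factor_section l d Q i}"
    then obtain x where u: "u = tensor l d x" and x: "\<And>i. i < l \<Longrightarrow> x i \<in> factor_section l d Q i" by blast
    have xe: "x i \<in> euclid (d i)" if "i < l" for i using x that sec by blast
    have "u \<in> Q"
    proof (cases "\<exists>i<l. x i = 0")
      case True
      then show ?thesis using u Q0 tensor_eq_0 by metis
    next
      case False
      then have "\<And>i. i < l \<Longrightarrow> x i \<in> euclid (d i) \<and> x i \<noteq> 0" using xe by blast
      moreover have "(\<Prod>i<l. g i (x i)) \<le> (\<Prod>i<l. w i)"
        using False x xe sec pos by (intro prod_mono) (auto simp: less_imp_le)
      ultimately show ?thesis unfolding u w1 by (subst cross1)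
    qed
    then show "u \<in> Q \<inter> decomposable l d" using u xe by (auto simp: decomposable_def)
  next
    fix u :: "real ^ 't" assume "u \<in> Q \<inter> decomposable l d"
    then obtain x where uQ: "u \<in> Q" and u: "u = tensor l d x" and xe: "\<And>i. i < l \<Longrightarrow> x i \<in> euclid (d i)"
      by (auto simp: decomposable_def)
    show "u \<in> {tensor l d x | x. \<forall>i<l. x i \<in> factor_section l d Q i}"
    proof (cases "\<exists>i<l. x i = 0")
      case True
      then have "u = 0" using u tensor_eq_0 by metis
      also have "\<dots> = tensor l d (\<lambda>_. 0)" using l tensor_eq_0[of 0 l "\<lambda>_. 0" d] by simp
      finally show ?thesis using sec euclid_0 by blast
    next
      case False
      then have nz: "\<And>i. i < l \<Longrightarrow> x i \<in> euclid (d i) \<and> x i \<noteq> 0" using xe by blast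
      define P where "P = (\<Prod>i<l. g i (x i))"
      have gp: "0 < g i (x i)" if "i < l" for i using pos nz that by blast
      have P: "0 < P" "P \<le> 1" unfolding P_def using gp cross1[OF nz] uQ u by (auto intro: prod_pos)
      \<comment> \<open>Each factor is scaled to its bound \<open>w i\<close>, and the slack P \<le>
        1 is assigned to factor 0; the scalars then multiply to 1 and leave the tensor
        unchanged.\<close>
      define s where "s i = (if i = 0 then P else 1) * (w i / g i (x i))" for i
      have sp: "0 < s i" if "i < l" for i using P wp gp that by (simp add: s_def)
      have "(\<Prod>i<l. s i) = (\<Prod>i<l. if i = 0 then P else 1) * ((\<Prod>i<l. w i) / P)"
        unfolding s_def P_def prod.distrib prod_dividef ..
      also have "(\<Prod>i<l. if i = 0 then P else 1) = P" using l by (subst prod.delta) auto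
      finally have "(\<Prod>i<l. s i) = 1" using w1 P by simp
      then have "tensor l d (\<lambda>i. s i *\<^sub>R x i) = (tensor l d x :: real ^ 't)" unfolding tensor_scaleR by simp
      moreover have "s i *\<^sub>R x i \<in> factor_section l d Q i" if i: "i < l" for i
      proof -
        have "g i (s i *\<^sub>R x i) = (if i = 0 then P else 1) * w i"
          using hom[OF i, of "x i" "s i"] nz[OF i] sp[OF i] gp[OF i] by (simp add: s_def)
        also have "\<dots> \<le> w i" using P wp[OF i] by (simp add: mult_left_le_one_le)
        finally show ?thesis using sec[OF i] nz[OF i] euclid_scaleR by blast
      qed
      ultimately have "\<exists>y. u = tensor l d y \<and> (\<forall>i<l. y i \<in> factor_section l d Q i)"
        using u by (intro exI[of _ "\<lambda>i. s i *\<^sub>R x i"]) simp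
      then show ?thesis by blast
    qed
  qed
qed

lemma tensor_lowner_eq:
  fixes Q :: "(real ^ 't) set"
  assumes "Q \<in> tensorial_bodies l d"
  shows "tensor_lowner l d Q = lowner (Q \<inter> decomposable l d)"
  unfolding tensor_lowner_def proj_tensor_def tensor_sections[OF assms] lowner_convex_hull ..

text \<open>Expanding the square and interchanging sum and product turns the moments of the product
  family into products of entries of identity matrices. The weights multiply to the dimension of the
  tensor space.\<close>

lemma frame_tensor:
  assumes X: "\<And>i. i < l \<Longrightarrow> finite (X i)" "\<And>i x. i < l \<Longrightarrow> x \<in> X i \<Longrightarrow> 0 \<le> c i x" "\<And>i. i < l \<Longrightarrow> sum (c i) (X i) = real (d i)"
    and gram: "\<And>i. i < l \<Longrightarrow> mat_id (d i) (\<lambda>k m. \<Sum>x\<in>X i. c i x * (coord (z i x) k * coord (z i x) m))"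
  shows "\<exists>w. frame ((\<lambda>\<xi>. tensor l d (\<lambda>i. z i (\<xi> i)) :: real ^ 't) ` (\<Pi>\<^sub>E i\<in>{..<l}. X i)) w"
proof (rule frame_indexed)
  show "finite (\<Pi>\<^sub>E i\<in>{..<l}. X i)" using X(1) by (intro finite_PiE) auto
  show "0 \<le> (\<Prod>i<l. c i (\<xi> i))" if "\<xi> \<in> (\<Pi>\<^sub>E i\<in>{..<l}. X i)" for \<xi>
    using that X(2) by (intro prod_nonneg) (auto simp: PiE_iff)
  have "(\<Sum>\<xi>\<in>(\<Pi>\<^sub>E i\<in>{..<l}. X i). \<Prod>i<l. c i (\<xi> i)) = (\<Prod>i<l. sum (c i) (X i))"
    using X(1) by (subst prod_sum_PiE) auto
  also have "\<dots> = (\<Prod>i<l. real (d i))" using X(3) by simp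
  finally show "(\<Sum>\<xi>\<in>(\<Pi>\<^sub>E i\<in>{..<l}. X i). \<Prod>i<l. c i (\<xi> i)) = real DIM(real ^ 't)"
    by (simp add: card)
  fix v :: "real ^ 't"
  let ?z = "\<lambda>\<xi> i. z i (\<xi> i)" and ?ix = "multi_index l d :: 't \<Rightarrow> nat \<Rightarrow> nat"
  have expand: "P * (tensor l d y \<bullet> v)\<^sup>2 =
      (\<Sum>s\<in>UNIV. \<Sum>t\<in>UNIV. P * ((tensor l d y $ s * v $ s) * (tensor l d y $ t * v $ t)))" for P and y
  proof -
    have "(tensor l d y \<bullet> v)\<^sup>2 = (\<Sum>s\<in>UNIV. \<Sum>t\<in>UNIV. (tensor l d y $ s * v $ s) * (tensor l d y $ t * v $ t))"
      unfolding power2_eq_square inner_vec_def inner_real_def by (rule sum_product)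
    then show ?thesis by (simp only: sum_distrib_left)
  qed
  have "(\<Sum>\<xi>\<in>(\<Pi>\<^sub>E i\<in>{..<l}. X i). (\<Prod>i<l. c i (\<xi> i)) * (tensor l d (?z \<xi>) \<bullet> v)\<^sup>2) =
    (\<Sum>\<xi>\<in>(\<Pi>\<^sub>E i\<in>{..<l}. X i). \<Sum>s\<in>UNIV. \<Sum>t\<in>UNIV.
      (\<Prod>i<l. c i (\<xi> i) * (coord (z i (\<xi> i)) (?ix s i) * coord (z i (\<xi> i)) (?ix t i))) * (v $ s * v $ t))"
    unfolding expand by (intro sum.cong refl) (simp add: tensor_def prod.distrib mult_ac)
  also have "\<dots> = (\<Sum>s\<in>UNIV. \<Sum>t\<in>UNIV. \<Sum>\<xi>\<in>(\<Pi>\<^sub>E i\<in>{..<l}. X i).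
      (\<Prod>i<l. c i (\<xi> i) * (coord (z i (\<xi> i)) (?ix s i) * coord (z i (\<xi> i)) (?ix t i))) * (v $ s * v $ t))"
    by (subst sum.swap, intro sum.cong refl, rule sum.swap)
  also have "\<dots> = (\<Sum>s\<in>UNIV. \<Sum>t\<in>UNIV. if t = s then v $ s * v $ s else 0)"
  proof (intro sum.cong refl)
    fix s t :: 't
    have "(\<Sum>\<xi>\<in>(\<Pi>\<^sub>E i\<in>{..<l}. X i). \<Prod>i<l. c i (\<xi> i) * (coord (z i (\<xi> i)) (?ix s i) * coord (z i (\<xi> i)) (?ix t i))) =
       (\<Prod>i<l. \<Sum>x\<in>X i. c i x * (coord (z i x) (?ix s i) * coord (z i x) (?ix t i)))"
      using X(1) by (subst prod_sum_PiE) auto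
    also have "\<dots> = (\<Prod>i<l. if ?ix s i = ?ix t i then 1 else 0)"
      using gram multi_index_less[OF card] by (intro prod.cong) (auto simp: mat_id_def)
    also have "\<dots> = (if s = t then 1 else 0)" by (rule prod_multi_index_delta[OF card])
    finally show "(\<Sum>\<xi>\<in>(\<Pi>\<^sub>E i\<in>{..<l}. X i).
        (\<Prod>i<l. c i (\<xi> i) * (coord (z i (\<xi> i)) (?ix s i) * coord (z i (\<xi> i)) (?ix t i))) * (v $ s * v $ t)) =
      (if t = s then v $ s * v $ s else 0)"
      unfolding sum_distrib_right[symmetric] by auto
  qed
  also have "\<dots> = (norm v)\<^sup>2" by (simp add: power2_norm_eq_inner inner_vec_def)
  finally show "(\<Sum>\<xi>\<in>(\<Pi>\<^sub>E i\<in>{..<l}. X i). (\<Prod>i<l. c i (\<xi> i)) * (tensor l d (?z \<xi>) \<bullet> v)\<^sup>2) = (norm v)\<^sup>2" .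
qed

text \<open>The last conclusion retains the injective bound on all of \<open>Q\<close>, tested only
  on coordinate vectors; it is what later identifies tensorial ellipsoids.\<close>

theorem tensor_john:
  fixes Q :: "(real ^ 't) set"
  assumes Q: "Q \<in> tensorial_bodies l d"
  obtains a b where "mats_id l d (mats_prod d a b)" "mats_id l d (mats_prod d b a)"
    "posdef (tensor_map l d a :: real ^ 't \<Rightarrow> real ^ 't)"
    "john (tensor_map l d b ` (Q \<inter> decomposable l d))"
    "\<And>y t. y \<in> Q \<Longrightarrow> \<bar>tensor_map l d b y $ t\<bar> \<le> 1"
proof -
  obtain K where K: "symmetric_body Q" "\<And>i. i < l \<Longrightarrow> factor_body (d i) (K i)"
    "\<And>x. (\<And>i. i < l \<Longrightarrow> x i \<in> K i) \<Longrightarrow> tensor l d x \<in> Q"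
    "\<And>u y. u \<in> Q \<Longrightarrow> (\<And>i. i < l \<Longrightarrow> y i \<in> factor_polar (d i) (K i)) \<Longrightarrow> \<bar>tensor l d y \<bullet> u\<bar> \<le> 1"
    using tensorial_bodyE[OF Q] by blast
  have "\<exists>p b b' X c. factor_john_data (d i) (K i) p b b' X c" if i: "i < l" for i
  proof -
    obtain \<iota> :: "nat \<Rightarrow> 't" where \<iota>: "inj_on \<iota> {..<d i}" using inj_factor_coordinates[OF i] by blast
    show ?thesis by (rule factor_john[OF \<iota> K(2)[OF i]]) (unfold factor_john_data_def, blast)
  qed
  then have "\<forall>i. \<exists>p b b' X c. i < l \<longrightarrow> factor_john_data (d i) (K i) p b b' X c" by blast
  then obtain p a b X c where data: "\<And>i. i < l \<Longrightarrow> factor_john_data (d i) (K i) (p i) (a i) (b i) (X i) (c i)"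
    by metis
  note D = data[unfolded factor_john_data_def]
  have ab: "mats_id l d (mats_prod d a b)" "mats_id l d (mats_prod d b a)"
    unfolding mats_id_def mats_prod_def using D by blast+
  let ?B = "tensor_map l d b :: real ^ 't \<Rightarrow> real ^ 't"
  have symB: "symmetric_op ?B" by (rule tensor_map_symmetric[OF card]) (rule D[THEN conjunct2, THEN conjunct1])
  \<comment> \<open>The symmetric matrix \<open>b i\<close> maps \<open>K i\<close> into the
    Euclidean unit ball, so by duality it maps the unit ball into the polar of
    \<open>K i\<close>.\<close>
  have polar: "mat_apply (d i) (b i) y \<in> factor_polar (d i) (K i)" if i: "i < l" and y: "dot (d i) y y \<le> 1" for i y
  proof -
    have "\<bar>dot (d i) x (mat_apply (d i) (b i) y)\<bar> \<le> 1" if x: "x \<in> K i" for x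
    proof -
      have sym: "mat_sym (d i) (b i)" using D[OF i] by blast
      have "dot (d i) x (mat_apply (d i) (b i) y) = dot (d i) (mat_apply (d i) (b i) x) y"
        unfolding dot_mat_apply mat_apply_sym[OF sym] ..
      also have "\<bar>\<dots>\<bar> \<le> sqrt (dot (d i) (mat_apply (d i) (b i) x) (mat_apply (d i) (b i) x)) * sqrt (dot (d i) y y)"
        by (rule dot_Cauchy_Schwarz)
      also have "\<dots> \<le> 1 * 1"
        using D[OF i] x y dot_self_nonneg by (intro mult_mono) auto
      finally show ?thesis by simp
    qed
    then show ?thesis by (simp add: factor_polar_def mat_apply_in_euclid)
  qed
  have dual: "\<bar>?B u \<bullet> tensor l d y\<bar> \<le> 1" if "u \<in> Q" and y: "\<And>i. i < l \<Longrightarrow> dot (d i) (y i) (y i) \<le> 1" for u y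
  proof -
    have "?B u \<bullet> tensor l d y = u \<bullet> ?B (tensor l d y)" by (rule symmetric_opD(2)[OF symB])
    also have "\<dots> = tensor l d (mats_apply d b y) \<bullet> u"
      unfolding tensor_map_tensor[OF card] by (rule inner_commute)
    also have "\<bar>\<dots>\<bar> \<le> 1" using that polar by (intro K(4)) (auto simp: mats_apply_def)
    finally show ?thesis .
  qed
  have coordB: "\<bar>?B u $ t\<bar> \<le> 1" if u: "u \<in> Q" for u t
  proof -
    have "dot (d i) (Poly_Mapping.single (multi_index l d t i) 1) (Poly_Mapping.single (multi_index l d t i) 1) \<le> 1" if "i < l" for i
    proof -
      have "dot (d i) (Poly_Mapping.single (multi_index l d t i) 1) (Poly_Mapping.single (multi_index l d t i) 1) =
          (\<Sum>k<d i. if k = multi_index l d t i then 1 else 0)"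
        unfolding dot_def by (intro sum.cong) (auto simp: lookup_single)
      then show ?thesis by simp
    qed
    then have "\<bar>?B u \<bullet> axis t 1\<bar> \<le> 1" unfolding tensor_axis[OF card, of t] by (intro dual[OF u])
    then show ?thesis by (simp add: inner_axis)
  qed
  have "?B ` (Q \<inter> decomposable l d) \<subseteq> cball 0 1"
  proof
    fix w assume "w \<in> ?B ` (Q \<inter> decomposable l d)"
    then obtain x where w: "w = ?B (tensor l d x)" and xQ: "tensor l d x \<in> Q" by (auto simp: decomposable_def)
    let ?z = "mats_apply d b x"
    have wz: "w = tensor l d ?z" unfolding w by (rule tensor_map_tensor[OF card])
    have nw: "(norm w)\<^sup>2 = (\<Prod>i<l. dot (d i) (?z i) (?z i))"
      unfolding power2_norm_eq_inner wz by (rule inner_tensor[OF card])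
    have "norm w \<le> 1"
    proof (cases "w = 0")
      case False
      then have P: "0 < (\<Prod>i<l. dot (d i) (?z i) (?z i))" unfolding nw[symmetric] by simp
      have zp: "0 < dot (d i) (?z i) (?z i)" if "i < l" for i
        using P that dot_self_nonneg[of "d i" "?z i"] by (auto simp: prod_zero_iff less_le)
      \<comment> \<open>The norm of a decomposable vector is its pairing with the tensor of its
        normalized factors, to which the injective bound applies.\<close>
      define y where "y i = inverse (sqrt (dot (d i) (?z i) (?z i))) *\<^sub>R ?z i" for i
      have "dot (d i) (y i) (y i) \<le> 1" if "i < l" for i
        using zp[OF that] by (simp add: y_def dot_scaleR_left dot_scaleR_right field_simps)
      then have "\<bar>w \<bullet> tensor l d y\<bar> \<le> 1" unfolding w by (intro dual[OF xQ])
      moreover have "tensor l d y = (\<Prod>i<l. inverse (sqrt (dot (d i) (?z i) (?z i)))) *\<^sub>R w"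
        unfolding y_def wz by (rule tensor_scaleR)
      moreover have "(\<Prod>i<l. inverse (sqrt (dot (d i) (?z i) (?z i)))) = inverse (norm w)"
      proof -
        have "(\<Prod>i<l. sqrt (dot (d i) (?z i) (?z i))) = sqrt (\<Prod>i<l. dot (d i) (?z i) (?z i))"
          by (induction l) (simp_all add: real_sqrt_mult)
        also have "\<dots> = norm w" unfolding nw[symmetric] by simp
        finally show ?thesis by (simp add: prod_inversef[unfolded o_def])
      qed
      moreover have "inverse (norm w) * (norm w * norm w) = norm w" using False by simp
      ultimately show ?thesis by (simp add: dot_square_norm power2_eq_square)
    qed simp
    then show "w \<in> cball 0 1" by simp
  qed
  moreover obtain w where w: "frame ((\<lambda>\<xi>. tensor l d (\<lambda>i. mat_apply (d i) (b i) (\<xi> i)) :: real ^ 't) ` (\<Pi>\<^sub>E i\<in>{..<l}. X i)) w"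
  proof -
    have "\<exists>w. frame ((\<lambda>\<xi>. tensor l d (\<lambda>i. mat_apply (d i) (b i) (\<xi> i)) :: real ^ 't) ` (\<Pi>\<^sub>E i\<in>{..<l}. X i)) w"
      by (rule frame_tensor[of X c]) (use D in \<open>blast+\<close>)
    then show thesis using that by blast
  qed
  have "(\<lambda>\<xi>. tensor l d (\<lambda>i. mat_apply (d i) (b i) (\<xi> i)) :: real ^ 't) ` (\<Pi>\<^sub>E i\<in>{..<l}. X i) \<subseteq> ?B ` (Q \<inter> decomposable l d)"
  proof clarify
    fix \<xi> assume \<xi>: "\<xi> \<in> (\<Pi>\<^sub>E i\<in>{..<l}. X i)"
    have \<xi>K: "\<xi> i \<in> K i" if "i < l" for i using PiE_mem[OF \<xi>, of i] D[OF that] that by blast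
    have "tensor l d (\<lambda>i. mat_apply (d i) (b i) (\<xi> i)) = ?B (tensor l d \<xi>)"
      by (simp add: tensor_map_tensor[OF card] mats_apply_def[abs_def])
    moreover have "(tensor l d \<xi> :: real ^ 't) \<in> Q" by (rule K(3)[OF \<xi>K])
    moreover have "(tensor l d \<xi> :: real ^ 't) \<in> decomposable l d"
      using \<xi>K factor_bodyD(1)[OF K(2)] by (auto simp: decomposable_def)
    ultimately show "tensor l d (\<lambda>i. mat_apply (d i) (b i) (\<xi> i)) \<in> ?B ` (Q \<inter> decomposable l d)" by blast
  qed
  ultimately have john: "john (?B ` (Q \<inter> decomposable l d))" using w unfolding john_def by blast
  have "posdef (tensor_map l d a :: real ^ 't \<Rightarrow> real ^ 't)"
  proof (rule tensor_map_posdef[OF card ab, of p])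
    show "mat_sym (d i) (p i)" if "i < l" for i using D[OF that] by blast
    show "mats_prod d p p i k m = a i k m" if "i < l" "k < d i" "m < d i" for i k m
      unfolding mats_prod_def using D[OF that(1)] that(2,3) by blast
  qed
  then show thesis by (rule that[OF ab _ john coordB])
qed

end

definition ellipsoid_root :: "'a::euclidean_space set \<Rightarrow> 'a \<Rightarrow> 'a" where
  "ellipsoid_root E = (THE R. posdef R \<and> E = R ` cball 0 1)"

lemma ellipsoid_root_eqI:
  assumes "posdef R" shows "ellipsoid_root (R ` cball 0 1) = R"
  unfolding ellipsoid_root_def
proof (rule the_equality)
  fix S assume "posdef S \<and> R ` cball 0 1 = S ` cball 0 1"
  then show "S = R" using posdef_cball_unique[OF assms, of S] by blast
qed (use assms in simp)

text \<open>By \<open>tensor_lowner_eq\<close> the ellipsoid is \<open>tensor_lowner\<close> on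
  tensorial bodies; this form mentions no base vectors and is visibly compatible with maps
  preserving the decomposable set.\<close>

definition lowner_retraction :: "nat \<Rightarrow> (nat \<Rightarrow> nat) \<Rightarrow> (real ^ 't::finite) set \<Rightarrow> (real ^ 't) set" where
  "lowner_retraction l d Q = inv (ellipsoid_root (lowner (Q \<inter> decomposable l d))) ` Q"

text \<open>A point outside the closed image has distance at least e from it. Its iterates are then
  pairwise at distance at least e, so no subsequence converges.\<close>

lemma isometry_compact_surj:
  fixes f :: "'a::heine_borel \<Rightarrow> 'a"
  assumes S: "compact S" and f: "f ` S \<subseteq> S" "\<And>x y. dist (f x) (f y) = dist x y"
  shows "f ` S = S"
proof (rule ccontr)
  assume "f ` S \<noteq> S"
  then obtain x where x: "x \<in> S" "x \<notin> f ` S" using f(1) by blast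
  have "continuous_on S f" unfolding continuous_on_iff by (auto simp: f(2))
  then have "closed (f ` S)" using compact_continuous_image[OF _ S] compact_imp_closed by blast
  then obtain e where e: "0 < e" "\<forall>y\<in>f ` S. e \<le> dist x y"
    using separate_point_closed[OF _ x(2)] by blast
  have iter: "(f ^^ n) x \<in> S" for n
  proof (induction n)
    case (Suc n)
    then show ?case using f(1) by auto
  qed (simp add: x(1))
  have shift: "dist ((f ^^ n) y) ((f ^^ n) z) = dist y z" for n y z by (induction n) (simp_all add: f(2))
  have far: "e \<le> dist ((f ^^ m) x) ((f ^^ n) x)" if mn: "m < n" for m n
  proof -
    obtain k where n: "n = m + Suc k" using less_imp_Suc_add[OF mn] by auto
    have "(f ^^ n) x = (f ^^ m) ((f ^^ Suc k) x)" unfolding n funpow_add by simp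
    then have "dist ((f ^^ m) x) ((f ^^ n) x) = dist x ((f ^^ Suc k) x)" by (simp only: shift)
    moreover have "(f ^^ Suc k) x \<in> f ` S" using iter[of k] by simp
    ultimately show ?thesis using e(2) by auto
  qed
  from S have "\<exists>L\<in>S. \<exists>r. strict_mono r \<and> ((\<lambda>n. (f ^^ n) x) \<circ> r) \<longlonglongrightarrow> L"
    unfolding compact_def by (rule allE[of _ "\<lambda>n. (f ^^ n) x"]) (use iter in simp)
  then obtain L and r :: "nat \<Rightarrow> nat" where r: "strict_mono r" "((\<lambda>n. (f ^^ n) x) \<circ> r) \<longlonglongrightarrow> L" by blast
  have "Cauchy ((\<lambda>n. (f ^^ n) x) \<circ> r)" using r(2) by (rule LIMSEQ_imp_Cauchy)
  then obtain M where M: "\<forall>m\<ge>M. \<forall>n\<ge>M. dist (((\<lambda>n. (f ^^ n) x) \<circ> r) m) (((\<lambda>n. (f ^^ n) x) \<circ> r) n) < e"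
    unfolding Cauchy_def using e(1) by blast
  then have "dist ((f ^^ r M) x) ((f ^^ r (Suc M)) x) < e" by simp
  moreover have "e \<le> dist ((f ^^ r M) x) ((f ^^ r (Suc M)) x)"
    using r(1) by (intro far) (simp add: strict_mono_Suc_iff)
  ultimately show False by simp
qed

section \<open>Linear images, the cone of decomposable vectors and tensorial ellipsoids\<close>

context
  fixes l :: nat and d :: "nat \<Rightarrow> nat" and ty :: "'t::finite itself"
  assumes card: "CARD('t) = (\<Prod>i<l. d i)" and l: "1 \<le> l" and d: "\<forall>i<l. 1 \<le> d i"
begin

text \<open>The factor bodies are mapped by the matrices \<open>a i\<close>, and their polars are
  pulled back by the transposes.\<close>

lemma tensorial_linear_image:
  fixes Q :: "(real ^ 't) set"
  assumes Q: "Q \<in> tensorial_bodies l d"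
    and ab: "mats_id l d (mats_prod d a b)" "mats_id l d (mats_prod d b a)"
  shows "tensor_map l d a ` Q \<in> tensorial_bodies l d"
proof -
  obtain K where K: "symmetric_body Q" "\<And>i. i < l \<Longrightarrow> factor_body (d i) (K i)"
    "\<And>x. (\<And>i. i < l \<Longrightarrow> x i \<in> K i) \<Longrightarrow> tensor l d x \<in> Q"
    "\<And>u y. u \<in> Q \<Longrightarrow> (\<And>i. i < l \<Longrightarrow> y i \<in> factor_polar (d i) (K i)) \<Longrightarrow> \<bar>tensor l d y \<bullet> u\<bar> \<le> 1"
    using tensorial_bodyE[OF Q] by blast
  let ?K = "\<lambda>i. mat_apply (d i) (a i) ` K i"
  show ?thesis
  proof (rule tensorial_bodyI[where K = ?K])
    show "symmetric_body (tensor_map l d a ` Q)"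
      by (rule symmetric_body_linear_image[OF K(1) linear_tensor_map tensor_map_bij(1)[OF card ab]])
    show "factor_body (d i) (?K i)" if "i < l" for i
      using ab(1) that by (intro factor_body_mat_image[OF K(2)]) (auto simp: mats_id_def mats_prod_def)
    show "tensor l d x \<in> tensor_map l d a ` Q" if x: "\<And>i. i < l \<Longrightarrow> x i \<in> ?K i" for x
    proof -
      have "\<forall>i. \<exists>z. i < l \<longrightarrow> z \<in> K i \<and> x i = mat_apply (d i) (a i) z" using x by blast
      from choice[OF this] obtain z where z: "\<And>i. i < l \<Longrightarrow> z i \<in> K i"
        "\<And>i. i < l \<Longrightarrow> x i = mat_apply (d i) (a i) (z i)" by blast
      have "(tensor l d x :: real ^ 't) = tensor l d (mats_apply d a z)"
        by (rule tensor_cong) (simp add: z mats_apply_def)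
      also have "\<dots> = tensor_map l d a (tensor l d z)" by (rule tensor_map_tensor[OF card, symmetric])
      finally show ?thesis using K(3)[OF z(1)] by blast
    qed
    show "\<bar>tensor l d y \<bullet> u\<bar> \<le> 1"
      if u: "u \<in> tensor_map l d a ` Q" and y: "\<And>i. i < l \<Longrightarrow> y i \<in> factor_polar (d i) (?K i)" for u y
    proof -
      obtain v where v: "v \<in> Q" "u = tensor_map l d a v" using u by blast
      let ?y = "mats_apply d (\<lambda>i k m. a i m k) y"
      have "tensor l d y \<bullet> u = tensor_map l d a v \<bullet> tensor l d y" unfolding v(2) by (rule inner_commute)
      also have "\<dots> = v \<bullet> tensor l d ?y" by (simp only: tensor_map_inner[OF card] tensor_map_tensor[OF card])
      also have "\<dots> = tensor l d ?y \<bullet> v" by (rule inner_commute)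
      also have "\<bar>\<dots>\<bar> \<le> 1"
      proof (rule K(4)[OF v(1)])
        fix i assume i: "i < l"
        have "\<bar>dot (d i) x (?y i)\<bar> \<le> 1" if "x \<in> K i" for x
          using y[OF i] that by (simp add: mats_apply_def dot_mat_apply[symmetric] factor_polar_def)
        then show "?y i \<in> factor_polar (d i) (K i)"
          by (simp add: factor_polar_def mats_apply_def mat_apply_in_euclid)
      qed
      finally show ?thesis .
    qed
  qed
qed

text \<open>The factors are Euclidean balls: these are self-polar and norms of tensors multiply, so
  the injective inclusion is the Cauchy-Schwarz inequality.\<close>

lemma cball_tensorial: "(cball 0 1 :: (real ^ 't) set) \<in> tensorial_bodies l d"
proof (rule tensorial_bodyI[where K = "\<lambda>i. {x \<in> euclid (d i). dot (d i) x x \<le> 1}"])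
  show "symmetric_body (cball 0 1 :: (real ^ 't) set)" by (rule symmetric_body_cball_01)
  show "factor_body (d i) {x \<in> euclid (d i). dot (d i) x x \<le> 1}" if i: "i < l" for i
  proof -
    obtain \<iota> :: "nat \<Rightarrow> 't" where "inj_on \<iota> {..<d i}" using inj_factor_coordinates[OF card l d i] by blast
    then show ?thesis by (rule factor_body_unit_ball)
  qed
  have norm_tensor: "norm (tensor l d x :: real ^ 't) \<le> 1" if "\<And>i. i < l \<Longrightarrow> dot (d i) (x i) (x i) \<le> 1" for x
  proof -
    have "(norm (tensor l d x :: real ^ 't))\<^sup>2 = (\<Prod>i<l. dot (d i) (x i) (x i))"
      unfolding power2_norm_eq_inner by (rule inner_tensor[OF card])
    also have "\<dots> \<le> 1" using that dot_self_nonneg by (intro prod_le_1) auto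
    finally show ?thesis using power2_le_imp_le[of "norm (tensor l d x :: real ^ 't)" 1] by simp
  qed
  show "tensor l d x \<in> (cball 0 1 :: (real ^ 't) set)"
    if "\<And>i. i < l \<Longrightarrow> x i \<in> {x \<in> euclid (d i). dot (d i) x x \<le> 1}" for x
    using norm_tensor[of x] that by simp
  fix u :: "real ^ 't" and y
  assume u: "u \<in> cball 0 1" and y: "\<And>i. i < l \<Longrightarrow> y i \<in> factor_polar (d i) {x \<in> euclid (d i). dot (d i) x x \<le> 1}"
  have "dot (d i) (y i) (y i) \<le> 1" if i: "i < l" for i
  proof (rule ccontr)
    assume "\<not> ?thesis"
    then have gt: "1 < dot (d i) (y i) (y i)" by simp
    define n where "n = sqrt (dot (d i) (y i) (y i))"
    have n: "1 < n" "dot (d i) (y i) (y i) = n * n" using gt by (simp_all add: n_def)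
    have "y i \<in> euclid (d i)" using y[OF i] by (simp add: factor_polar_def)
    moreover have "dot (d i) (inverse n *\<^sub>R y i) (inverse n *\<^sub>R y i) = 1"
      unfolding dot_scaleR_left dot_scaleR_right n(2) using n(1) by (simp add: field_simps)
    ultimately have "inverse n *\<^sub>R y i \<in> {x \<in> euclid (d i). dot (d i) x x \<le> 1}" by (simp add: euclid_scaleR)
    then have "\<bar>dot (d i) (inverse n *\<^sub>R y i) (y i)\<bar> \<le> 1" using y[OF i] unfolding factor_polar_def by blast
    moreover have "dot (d i) (inverse n *\<^sub>R y i) (y i) = n"
      unfolding dot_scaleR_left n(2) using n(1) by (simp add: field_simps)
    ultimately show False using n(1) by simp
  qed
  then have "norm (tensor l d y :: real ^ 't) \<le> 1" by (rule norm_tensor)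
  then have "norm (tensor l d y :: real ^ 't) * norm u \<le> 1 * 1" using u by (intro mult_mono) auto
  then show "\<bar>tensor l d y \<bullet> u\<bar> \<le> 1" using Cauchy_Schwarz_ineq2[of "tensor l d y" u] by linarith
qed

text \<open>The factors of a unit tensor can be normalized separately, because their norms multiply
  to 1; the coordinates then range in a compact cube.\<close>

lemma decomposable_normalized:
  "decomposable l d \<inter> sphere 0 1 \<subseteq> {(\<chi> t. \<Prod>i<l. f i (multi_index l d t i)) :: real ^ 't | f. \<forall>i k. f i k \<in> {-1..1}}"
proof
  fix u :: "real ^ 't" assume "u \<in> decomposable l d \<inter> sphere 0 1"
  then obtain x where u: "u = tensor l d x" and nu: "norm u = 1" by (auto simp: decomposable_def)
  have n1: "(\<Prod>i<l. dot (d i) (x i) (x i)) = 1"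
    using inner_tensor[OF card, of x x] nu u by (simp add: dot_square_norm)
  have pos: "0 < dot (d i) (x i) (x i)" if "i < l" for i
  proof -
    have "dot (d i) (x i) (x i) \<noteq> 0"
    proof
      assume "dot (d i) (x i) (x i) = 0"
      then have "(\<Prod>i<l. dot (d i) (x i) (x i)) = 0" using that by (intro prod_zero) auto
      then show False using n1 by simp
    qed
    then show ?thesis using dot_self_nonneg[of "d i" "x i"] by linarith
  qed
  let ?n = "\<lambda>i. sqrt (dot (d i) (x i) (x i))"
  define f where "f i k = (if i < l \<and> k < d i then coord (x i) k / ?n i else 0)" for i k
  have "f i k \<in> {-1..1}" for i k
  proof (cases "i < l \<and> k < d i")
    case True
    have "(coord (x i) k)\<^sup>2 \<le> dot (d i) (x i) (x i)"
      unfolding dot_def power2_eq_square using True by (intro member_le_sum) auto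
    then have "\<bar>coord (x i) k\<bar> \<le> ?n i" by (intro real_le_rsqrt) simp
    then have "\<bar>f i k\<bar> \<le> 1" using True pos[of i] by (simp add: f_def abs_divide)
    then show ?thesis by (simp add: abs_le_iff)
  qed (auto simp: f_def)
  moreover have "(\<Prod>i<l. ?n i) = 1"
  proof -
    have "(\<Prod>i<l. ?n i) = sqrt (\<Prod>i<l. dot (d i) (x i) (x i))" by (induction l) (simp_all add: real_sqrt_mult)
    then show ?thesis by (simp add: n1)
  qed
  then have "(\<Prod>i<l. f i (multi_index l d t i)) = (\<Prod>i<l. coord (x i) (multi_index l d t i))" for t :: 't
    using multi_index_less[OF card, of _ t] by (simp add: f_def prod_dividef)
  then have "u = (\<chi> t. \<Prod>i<l. f i (multi_index l d t i))" by (simp add: u tensor_def)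
  ultimately show "u \<in> {(\<chi> t. \<Prod>i<l. f i (multi_index l d t i)) :: real ^ 't | f. \<forall>i k. f i k \<in> {-1..1}}" by blast
qed

lemma compact_decomposable_sphere: "compact (decomposable l d \<inter> sphere 0 1 :: (real ^ 't) set)"
proof -
  \<comment> \<open>The parameters form an infinite cube, compact by Tychonoff; \<open>?g\<close>
    reads finitely many of its coordinates.\<close>
  let ?g = "\<lambda>f :: nat \<Rightarrow> nat \<Rightarrow> real. (\<chi> t. \<Prod>i<l. f i (multi_index l d t i)) :: real ^ 't"
  let ?F = "{f :: nat \<Rightarrow> nat \<Rightarrow> real. \<forall>i k. f i k \<in> {-1..1}}"
  have c1: "compact (PiE UNIV (\<lambda>_ :: nat. A))" if "compact A" for A :: "'b::topological_space set"
  proof -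
    have "compactin (product_topology (\<lambda>_ :: nat. euclidean) UNIV) (PiE UNIV (\<lambda>_. A))"
      unfolding compactin_PiE using that by (simp add: compactin_euclidean_iff)
    then show ?thesis by (simp only: euclidean_product_topology compactin_euclidean_iff)
  qed
  have "?F = PiE UNIV (\<lambda>_. PiE UNIV (\<lambda>_. {-1..1}))" unfolding PiE_UNIV_domain Pi_def by simp
  moreover have "compact (PiE UNIV (\<lambda>_ :: nat. PiE UNIV (\<lambda>_ :: nat. {-1..1 :: real})))"
    by (rule c1[OF c1[OF compact_Icc]])
  ultimately have "compact ?F" by (simp only:)
  moreover have "continuous_on ?F (\<lambda>f. f i k)" for i k :: nat
  proof -
    have "continuous_on UNIV (\<lambda>f :: nat \<Rightarrow> nat \<Rightarrow> real. f i k)"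
      by (rule continuous_on_product_then_coordinatewise[OF continuous_on_product_coordinates])
    then show ?thesis by (rule continuous_on_subset) simp
  qed
  then have "continuous_on ?F ?g" by (intro continuous_on_vec_lambda continuous_on_prod)
  ultimately have cg: "compact (?g ` ?F)" using compact_continuous_image by blast
  have "?g f \<in> decomposable l d" for f
  proof -
    have "?g f = tensor l d (\<lambda>i. euclid_vec (d i) (f i))"
      using multi_index_less[OF card] by (simp add: tensor_def vec_eq_iff coord_euclid_vec)
    then show ?thesis unfolding decomposable_def using euclid_vec_in_euclid by blast
  qed
  then have "?g ` ?F \<inter> sphere 0 1 \<subseteq> decomposable l d \<inter> sphere 0 1" by blast
  moreover have "decomposable l d \<inter> sphere 0 1 \<subseteq> ?g ` ?F \<inter> sphere 0 1"
    using decomposable_normalized by blast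
  ultimately have "decomposable l d \<inter> sphere 0 1 = ?g ` ?F \<inter> sphere 0 1" by (rule subset_antisym[rotated])
  then show ?thesis using compact_Int_closed[OF cg closed_sphere] by simp
qed

lemma decomposable_scaleR: "u \<in> decomposable l d \<Longrightarrow> c *\<^sub>R u \<in> (decomposable l d :: (real ^ 't) set)"
proof -
  assume "u \<in> decomposable l d"
  then obtain x where x: "u = tensor l d x" "\<And>i. i < l \<Longrightarrow> x i \<in> euclid (d i)" by (auto simp: decomposable_def)
  have "(\<Prod>i<l. if i = 0 then c else 1) = c" using l by (subst prod.delta) auto
  then have "c *\<^sub>R u = tensor l d (\<lambda>i. (if i = 0 then c else 1) *\<^sub>R x i)" unfolding tensor_scaleR x(1) by simp
  then show "c *\<^sub>R u \<in> decomposable l d" unfolding decomposable_def using x(2) euclid_scaleR by blast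
qed

text \<open>An isometry of the compact set of decomposable unit vectors into itself is onto;
  homogeneity extends this to the cone.\<close>

lemma O_tensor_decomposable:
  assumes "g \<in> O_tensor l d"
  shows "g ` decomposable l d = (decomposable l d :: (real ^ 't) set)"
proof -
  let ?D = "decomposable l d :: (real ^ 't) set"
  have sub: "g ` ?D \<subseteq> ?D" and og: "orthogonal_transformation g" and lg: "linear g"
    using assms by (auto simp: O_tensor_def GL_tensor_def)
  have ng: "norm (g x) = norm x" for x using og by (simp add: orthogonal_transformation_norm)
  have "dist (g x) (g y) = dist x y" for x y
    unfolding dist_norm linear_diff[OF lg, symmetric] by (rule ng)
  then have S: "g ` (?D \<inter> sphere 0 1) = ?D \<inter> sphere 0 1"
    using sub ng by (intro isometry_compact_surj[OF compact_decomposable_sphere]) auto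
  have "u \<in> g ` ?D" if u: "u \<in> ?D" for u
  proof (cases "u = 0")
    case True
    then show ?thesis using u linear_0[OF lg] by (metis image_eqI)
  next
    case False
    then have "(1 / norm u) *\<^sub>R u \<in> ?D \<inter> sphere 0 1" using decomposable_scaleR[OF u] by simp
    then obtain v where v: "v \<in> ?D" "(1 / norm u) *\<^sub>R u = g v" using S by blast
    have "g (norm u *\<^sub>R v) = u" using v(2)[symmetric] False by (simp add: linear_scale[OF lg])
    then show ?thesis using decomposable_scaleR[OF v(1)] by (metis image_eqI)
  qed
  then show ?thesis using sub by blast
qed

lemma lowner_tensorial:
  fixes Q :: "(real ^ 't) set"
  assumes Q: "Q \<in> tensorial_bodies l d"
  obtains a b where "mats_id l d (mats_prod d a b)" "mats_id l d (mats_prod d b a)"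
    "posdef (tensor_map l d a :: real ^ 't \<Rightarrow> real ^ 't)"
    "john (tensor_map l d b ` (Q \<inter> decomposable l d))"
    "lowner (Q \<inter> decomposable l d) = tensor_map l d a ` cball 0 1"
    "ellipsoid_root (lowner (Q \<inter> decomposable l d)) = tensor_map l d a"
    "inv (tensor_map l d a :: real ^ 't \<Rightarrow> real ^ 't) = tensor_map l d b"
    "\<And>y t. y \<in> Q \<Longrightarrow> \<bar>tensor_map l d b y $ t\<bar> \<le> 1"
proof -
  obtain a b where ab: "mats_id l d (mats_prod d a b)" "mats_id l d (mats_prod d b a)"
    and pd: "posdef (tensor_map l d a :: real ^ 't \<Rightarrow> real ^ 't)"
    and john: "john (tensor_map l d b ` (Q \<inter> decomposable l d))"
    and dual: "\<And>y t. y \<in> Q \<Longrightarrow> \<bar>tensor_map l d b y $ t\<bar> \<le> 1"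
    using tensor_john[OF card l d Q] by blast
  have "tensor_map l d a ` tensor_map l d b ` (Q \<inter> decomposable l d) = Q \<inter> decomposable l d"
    by (simp add: image_image tensor_map_inverse[OF card ab(1)])
  then have low: "lowner (Q \<inter> decomposable l d) = tensor_map l d a ` cball 0 1"
    using lowner_john_image[OF john linear_tensor_map tensor_map_bij(1)[OF card ab]] by simp
  show thesis
    by (rule that[OF ab pd john low _ tensor_map_bij(2)[OF card ab] dual]) (simp_all add: low ellipsoid_root_eqI[OF pd])
qed

lemma tensorial_ellipsoid_lowner:
  fixes E :: "(real ^ 't) set"
  assumes E: "E \<in> tensorial_ellipsoids l d"
  shows "lowner (E \<inter> decomposable l d) = E"
proof -
  have tE: "E \<in> tensorial_bodies l d" and eE: "ellipsoid E" using E by (auto simp: tensorial_ellipsoids_def)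
  obtain a b where ab: "mats_id l d (mats_prod d a b)" "mats_id l d (mats_prod d b a)"
    and john: "john (tensor_map l d b ` (E \<inter> decomposable l d))"
    and low: "lowner (E \<inter> decomposable l d) = tensor_map l d a ` cball 0 1"
    and dual: "\<And>y t. y \<in> E \<Longrightarrow> \<bar>tensor_map l d b y $ t\<bar> \<le> 1"
    by (rule lowner_tensorial[OF tE]) blast
  let ?B = "tensor_map l d b :: real ^ 't \<Rightarrow> real ^ 't"
  have "ellipsoid (?B ` E)" by (rule ellipsoid_linear_image[OF eE linear_tensor_map tensor_map_bij(1)[OF card ab(2,1)]])
  then obtain S where S: "posdef S" "?B ` E = S ` cball 0 1" unfolding ellipsoid_posdef by blast
  obtain B m where B: "eigenbasis S B m" using symmetric_op_eigenbasis[OF posdefD(1)[OF S(1)]] by blast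
  have fin: "finite B" "card B = CARD('t)" using B by (auto simp: eigenbasis_def)
  have mp: "0 < m b" if "b \<in> B" for b using posdef_eigenvalue_pos[OF S(1) B that] .
  obtain X c where X: "X \<subseteq> ?B ` (E \<inter> decomposable l d)" "frame X c" using john by (auto simp: john_def)
  have "norm (inv S x) \<le> 1" if "x \<in> X" for x
  proof -
    have "x \<in> S ` cball 0 1" using that X(1) S(2) by blast
    then show ?thesis using bij_is_inj[OF posdef_bij[OF S(1)]] by auto
  qed
  then have 1: "(\<Sum>b\<in>B. (1 / m b)\<^sup>2) \<le> real DIM(real ^ 't) * 1\<^sup>2"
    by (rule frame_sum_squares_le[OF X(2) posdefD(1)[OF posdef_inv[OF S(1)]] eigenbasis_inv[OF S(1) B]])
  \<comment> \<open>The coordinate vectors are a second frame. On them \<open>S\<close> is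
    controlled by the injective bound, applied to the point of \<open>S\<close> of the ball where
    the coordinate is largest.\<close>
  have "frame (Basis :: (real ^ 't) set) (\<lambda>_. 1)"
    unfolding frame_def
  proof (intro conjI allI)
    fix v :: "real ^ 't"
    have "(norm v)\<^sup>2 = (\<Sum>b\<in>Basis. (v \<bullet> b) * (v \<bullet> b))"
      unfolding power2_norm_eq_inner by (rule euclidean_inner)
    then show "(\<Sum>x\<in>Basis. 1 * (x \<bullet> v)\<^sup>2) = (norm v)\<^sup>2" by (simp add: power2_eq_square inner_commute)
  qed simp_all
  moreover have "norm (S e) \<le> 1" if eB: "e \<in> Basis" for e :: "real ^ 't"
  proof (cases "S e = 0")
    case False
    obtain t where e: "e = axis t 1" using eB by (auto simp: Basis_vec_def)
    let ?y = "(1 / norm (S e)) *\<^sub>R S e"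
    have "S ?y \<in> ?B ` E" unfolding S(2) using False by simp
    then have "\<bar>S ?y $ t\<bar> \<le> 1" using dual by auto
    moreover have "S ?y $ t = S ?y \<bullet> e" by (simp add: e inner_axis)
    moreover have "\<dots> = ?y \<bullet> S e" by (rule posdefD(4)[OF S(1)])
    moreover have "\<dots> = norm (S e)" using False by (simp add: dot_square_norm power2_eq_square)
    ultimately show ?thesis by simp
  qed simp
  ultimately have 2: "(\<Sum>b\<in>B. (m b)\<^sup>2) \<le> real DIM(real ^ 't) * 1\<^sup>2"
    by (rule frame_sum_squares_le[OF _ posdefD(1)[OF S(1)] B])
  \<comment> \<open>The two Hilbert-Schmidt bounds are exactly those that make this sum of squares
    nonpositive.\<close>
  have "(\<Sum>b\<in>B. (m b - 1 / m b)\<^sup>2) = (\<Sum>b\<in>B. (m b)\<^sup>2 + (1 / m b)\<^sup>2 - 2)"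
    using mp by (intro sum.cong refl) (simp add: power2_diff less_imp_neq[symmetric])
  also have "\<dots> = (\<Sum>b\<in>B. (m b)\<^sup>2) + (\<Sum>b\<in>B. (1 / m b)\<^sup>2) - 2 * CARD('t)"
    by (simp add: sum.distrib sum_subtractf fin)
  also have "\<dots> \<le> 0" using 1 2 by simp
  finally have "(\<Sum>b\<in>B. (m b - 1 / m b)\<^sup>2) \<le> 0" .
  then have "(\<Sum>b\<in>B. (m b - 1 / m b)\<^sup>2) = 0" by (simp add: sum_nonneg order_antisym)
  then have "\<forall>b\<in>B. (m b - 1 / m b)\<^sup>2 = 0" by (subst (asm) sum_nonneg_eq_0_iff) (auto simp: fin)
  then have m1: "m b = 1" if "b \<in> B" for b
  proof -
    have "m b = 1 / m b" using \<open>\<forall>b\<in>B. _\<close> that by simp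
    then have "m b * m b = 1 / m b * m b" by (rule arg_cong)
    then have "m b * m b = 1" using mp[OF that] by simp
    then have "(m b)\<^sup>2 = 1" by (simp add: power2_eq_square)
    then show ?thesis using mp[OF that] by (simp add: power2_eq_1_iff)
  qed
  have "S x = x" for x
  proof -
    have "S x = (\<Sum>b\<in>B. (x \<bullet> b) *\<^sub>R b)"
      unfolding eigenbasis_apply(1)[OF posdefD(1)[OF S(1)] B, of x] by (intro sum.cong) (auto simp: m1)
    then show ?thesis by (simp only: eigenbasis_expand[OF B])
  qed
  then have "?B ` E = cball 0 1" using S(2) by simp
  then have "tensor_map l d a ` cball 0 1 = tensor_map l d a ` ?B ` E" by simp
  also have "\<dots> = E" by (simp add: image_image tensor_map_inverse[OF card ab(1)])
  finally show ?thesis using low by simp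
qed

end

section \<open>The retraction\<close>

lemma lowner_john:
  fixes K :: "(real ^ 'n) set"
  assumes "john K" shows "lowner K = cball 0 1"
  using lowner_john_image[OF assms, of "\<lambda>x. x"] by (simp add: linear_id[unfolded id_def] bij_id[unfolded id_def])

lemma body_near_mono:
  fixes P Q :: "'a::euclidean_space set"
  assumes near: "body_near s P Q" and P: "symmetric_body P" and Q: "symmetric_body Q" and s: "0 < s" "s \<le> t"
  shows "body_near t P Q"
proof -
  have "(*\<^sub>R) s ` K \<subseteq> (*\<^sub>R) t ` K" if K: "symmetric_body K" for K :: "'a set"
  proof clarify
    fix x assume "x \<in> K"
    then have "(s / t) *\<^sub>R x + (1 - s / t) *\<^sub>R 0 \<in> K"
      using K symmetric_body_0[OF K] s by (intro convexD) (auto simp: symmetric_body_def)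
    then show "s *\<^sub>R x \<in> (*\<^sub>R) t ` K" using s by (intro image_eqI[of _ _ "(s / t) *\<^sub>R x"]) auto
  qed
  then show ?thesis using near P Q unfolding body_near_def by (meson subset_trans)
qed

context
  fixes l :: nat and d :: "nat \<Rightarrow> nat" and ty :: "'t::finite itself"
  assumes card: "CARD('t) = (\<Prod>i<l. d i)" and l: "1 \<le> l" and d: "\<forall>i<l. 1 \<le> d i"
begin

lemma tensorial_symmetric: "tensorial_bodies l d \<subseteq> Collect symmetric_body"
  by (auto simp: tensorial_bodies_def)

lemma image_Int_decomposable:
  fixes Q :: "(real ^ 't) set"
  assumes ab: "mats_id l d (mats_prod d a b)" "mats_id l d (mats_prod d b a)"
  shows "tensor_map l d a ` Q \<inter> decomposable l d = tensor_map l d a ` (Q \<inter> decomposable l d)"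
proof -
  have "inj (tensor_map l d a :: real ^ 't \<Rightarrow> real ^ 't)" by (rule bij_is_inj[OF tensor_map_bij(1)[OF card ab]])
  then have "tensor_map l d a ` (Q \<inter> decomposable l d) = tensor_map l d a ` Q \<inter> tensor_map l d a ` decomposable l d"
    by (rule image_Int)
  then show ?thesis by (simp only: tensor_map_decomposable_image[OF card ab(1)])
qed

text \<open>The hypothesis speaks only of an ellipsoid. A John decomposition is recovered because
  the tensor map supplied by \<open>lowner_tensorial\<close> is the identity when the ellipsoid is
  the unit ball.\<close>

lemma lowner_position_john:
  fixes P :: "(real ^ 't) set"
  assumes "P \<in> lowner_position_bodies l d"
  shows "P \<in> tensorial_bodies l d" "lowner (P \<inter> decomposable l d) = cball 0 1" "john (P \<inter> decomposable l d)"
    "lowner_retraction l d P = P"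
proof -
  show P: "P \<in> tensorial_bodies l d" using assms by (simp add: lowner_position_bodies_def)
  show low: "lowner (P \<inter> decomposable l d) = cball 0 1"
    using assms tensor_lowner_eq[OF card l d P] by (simp add: lowner_position_bodies_def)
  have root: "ellipsoid_root (cball 0 1) = (\<lambda>x :: real ^ 't. x)" using ellipsoid_root_eqI[OF posdef_id] by simp
  have inv: "inv (\<lambda>x :: real ^ 't. x) = (\<lambda>x. x)" using inv_id by (simp add: id_def)
  obtain a b where john: "john (tensor_map l d b ` (P \<inter> decomposable l d))"
    and eq: "ellipsoid_root (lowner (P \<inter> decomposable l d)) = tensor_map l d a"
    and ib: "inv (tensor_map l d a :: real ^ 't \<Rightarrow> real ^ 't) = tensor_map l d b"
    by (rule lowner_tensorial[OF card l d P]) blast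
  have "tensor_map l d a = (\<lambda>x :: real ^ 't. x)" using eq unfolding low root by simp
  then have "tensor_map l d b = (\<lambda>x :: real ^ 't. x)" using ib inv by simp
  then show "john (P \<inter> decomposable l d)" using john by simp
  show "lowner_retraction l d P = P" by (simp add: lowner_retraction_def low root inv)
qed

lemma lowner_retraction_properties:
  fixes Q :: "(real ^ 't) set"
  assumes Q: "Q \<in> tensorial_bodies l d"
  defines "E \<equiv> lowner (Q \<inter> decomposable l d)"
  shows "lowner_retraction l d Q \<in> lowner_position_bodies l d"
    and "\<exists>T\<in>GL_tensor l d. lowner_retraction l d Q = T ` Q"
    and "E \<in> tensorial_ellipsoids l d" and "posdef (ellipsoid_root E)" and "E = ellipsoid_root E ` cball 0 1"
    and "ellipsoid_root E ` lowner_retraction l d Q = Q"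
proof -
  obtain a b where ab: "mats_id l d (mats_prod d a b)" "mats_id l d (mats_prod d b a)"
    and pd: "posdef (tensor_map l d a :: real ^ 't \<Rightarrow> real ^ 't)"
    and john: "john (tensor_map l d b ` (Q \<inter> decomposable l d))"
    and low: "E = tensor_map l d a ` cball 0 1"
    and root: "ellipsoid_root E = tensor_map l d a"
    and ib: "inv (tensor_map l d a :: real ^ 't \<Rightarrow> real ^ 't) = tensor_map l d b"
    unfolding E_def by (rule lowner_tensorial[OF card l d Q]) blast
  have r: "lowner_retraction l d Q = tensor_map l d b ` Q"
    using root by (simp add: lowner_retraction_def E_def ib)
  have rB: "tensor_map l d b ` Q \<in> tensorial_bodies l d" by (rule tensorial_linear_image[OF card l d Q ab(2,1)])
  have "lowner (tensor_map l d b ` Q \<inter> decomposable l d) = cball 0 1"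
    unfolding image_Int_decomposable[OF ab(2,1)] by (rule lowner_john[OF john])
  then show "lowner_retraction l d Q \<in> lowner_position_bodies l d"
    unfolding r lowner_position_bodies_def using rB tensor_lowner_eq[OF card l d rB] by simp
  have "tensor_map l d b \<in> (GL_tensor l d :: (real ^ 't \<Rightarrow> real ^ 't) set)"
    unfolding GL_tensor_def
    using linear_tensor_map tensor_map_bij(1)[OF card ab(2,1)] tensor_map_decomposable[OF card] by blast
  then show "\<exists>T\<in>GL_tensor l d. lowner_retraction l d Q = T ` Q" using r by blast
  have "E \<in> tensorial_bodies l d"
    unfolding low by (rule tensorial_linear_image[OF card l d cball_tensorial[OF card l d] ab])
  moreover have "ellipsoid E" unfolding ellipsoid_posdef using pd low by blast
  ultimately show "E \<in> tensorial_ellipsoids l d" by (simp add: tensorial_ellipsoids_def)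
  show "posdef (ellipsoid_root E)" unfolding root by (rule pd)
  show "E = ellipsoid_root E ` cball 0 1" unfolding root by (rule low)
  show "ellipsoid_root E ` lowner_retraction l d Q = Q"
    unfolding root r by (simp add: image_image tensor_map_inverse[OF card ab(1)])
qed

text \<open>As a tensorial ellipsoid is its own Loewner ellipsoid, its root is a tensor product of
  matrices and so preserves decomposable vectors.\<close>

lemma ellipsoid_root_action:
  fixes P E :: "(real ^ 't) set"
  assumes P: "P \<in> lowner_position_bodies l d" and E: "E \<in> tensorial_ellipsoids l d"
  shows "ellipsoid_root E ` P \<in> tensorial_bodies l d"
    and "lowner (ellipsoid_root E ` P \<inter> decomposable l d) = E"
    and "lowner_retraction l d (ellipsoid_root E ` P) = P"
proof -
  have tE: "E \<in> tensorial_bodies l d" using E by (simp add: tensorial_ellipsoids_def)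
  have lE: "lowner (E \<inter> decomposable l d) = E" by (rule tensorial_ellipsoid_lowner[OF card l d E])
  obtain a b where ab: "mats_id l d (mats_prod d a b)" "mats_id l d (mats_prod d b a)"
    and low: "E = tensor_map l d a ` cball 0 1"
    and root: "ellipsoid_root E = tensor_map l d a"
    and ib: "inv (tensor_map l d a :: real ^ 't \<Rightarrow> real ^ 't) = tensor_map l d b"
    by (rule lowner_tensorial[OF card l d tE], unfold lE) blast
  note Pj = lowner_position_john[OF P]
  show "ellipsoid_root E ` P \<in> tensorial_bodies l d"
    unfolding root by (rule tensorial_linear_image[OF card l d Pj(1) ab])
  show lowP: "lowner (ellipsoid_root E ` P \<inter> decomposable l d) = E"
    unfolding root image_Int_decomposable[OF ab]
    using lowner_john_image[OF Pj(3) linear_tensor_map tensor_map_bij(1)[OF card ab]] low by simp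
  show "lowner_retraction l d (ellipsoid_root E ` P) = P"
    unfolding lowner_retraction_def lowP unfolding root ib by (simp add: image_image tensor_map_inverse[OF card ab(2)])
qed

lemma lowner_retraction_equivariant:
  fixes Q :: "(real ^ 't) set"
  assumes g: "g \<in> O_tensor l d" and Q: "Q \<in> tensorial_bodies l d"
  shows "lowner_retraction l d (g ` Q) = g ` lowner_retraction l d Q"
proof -
  let ?E = "lowner (Q \<inter> decomposable l d)"
  let ?R = "ellipsoid_root ?E"
  have og: "orthogonal_transformation g" using g by (simp add: O_tensor_def)
  then have lg: "linear g" and bg: "bij g" and ig: "orthogonal_transformation (inv g)"
    by (auto simp: orthogonal_transformation_linear orthogonal_transformation_bij orthogonal_transformation_inv)
  have gg: "g (inv g x) = x" "inv g (g x) = x" for x using bg by (simp_all add: bij_is_surj surj_f_inv_f bij_is_inj)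
  have gi: "g x \<bullet> y = x \<bullet> inv g y" for x y
    using og gg unfolding orthogonal_transformation_def by metis
  have lig: "linear (inv g)" using ig by (rule orthogonal_transformation_linear)
  obtain a b where john: "john (tensor_map l d b ` (Q \<inter> decomposable l d))"
    and ab: "mats_id l d (mats_prod d a b)" "mats_id l d (mats_prod d b a)"
    and pd: "posdef (tensor_map l d a :: real ^ 't \<Rightarrow> real ^ 't)"
    and root: "?R = tensor_map l d a" and ib: "inv (tensor_map l d a :: real ^ 't \<Rightarrow> real ^ 't) = tensor_map l d b"
    by (rule lowner_tensorial[OF card l d Q]) blast
  let ?A = "tensor_map l d a :: real ^ 't \<Rightarrow> real ^ 't" and ?B = "tensor_map l d b :: real ^ 't \<Rightarrow> real ^ 't"
  have "g ` Q \<inter> decomposable l d = g ` Q \<inter> g ` decomposable l d"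
    by (simp only: O_tensor_decomposable[OF card l d g])
  also have "\<dots> = g ` (Q \<inter> decomposable l d)" by (rule image_Int[OF bij_is_inj[OF bg], symmetric])
  also have "\<dots> = (g \<circ> ?A) ` ?B ` (Q \<inter> decomposable l d)"
    by (simp add: image_image tensor_map_inverse[OF card ab(1)])
  finally have "lowner (g ` Q \<inter> decomposable l d) = (g \<circ> ?A) ` cball 0 1"
    using lowner_john_image[OF john linear_compose[OF linear_tensor_map lg] bij_comp[OF tensor_map_bij(1)[OF card ab] bg]]
    by simp
  \<comment> \<open>Inserting \<open>inv g\<close> does not change the image of the ball, but makes
    the operator positive definite and hence the root.\<close>
  also have "\<dots> = (g \<circ> ?A \<circ> inv g) ` cball 0 1"
  proof -
    have "inv g ` cball 0 1 = cball 0 1" using image_orthogonal_transformation_cball[OF ig, of 0 1] linear_0[OF lig] by simp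
    then have "(g \<circ> ?A) ` cball 0 1 = (g \<circ> ?A) ` inv g ` cball 0 1" by simp
    then show ?thesis by (simp only: image_comp)
  qed
  finally have low: "lowner (g ` Q \<inter> decomposable l d) = (g \<circ> ?A \<circ> inv g) ` cball 0 1" .
  have "linear (g \<circ> ?A \<circ> inv g)" by (intro linear_compose lig linear_tensor_map lg)
  moreover have "(g \<circ> ?A \<circ> inv g) x \<bullet> y = x \<bullet> (g \<circ> ?A \<circ> inv g) y" for x y
  proof -
    have "(g \<circ> ?A \<circ> inv g) x \<bullet> y = ?A (inv g x) \<bullet> inv g y" by (simp add: gi)
    also have "\<dots> = inv g x \<bullet> ?A (inv g y)" by (rule posdefD(4)[OF pd])
    also have "\<dots> = ?A (inv g y) \<bullet> inv g x" by (rule inner_commute)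
    also have "\<dots> = (g \<circ> ?A \<circ> inv g) y \<bullet> x" by (simp add: gi)
    also have "\<dots> = x \<bullet> (g \<circ> ?A \<circ> inv g) y" by (rule inner_commute)
    finally show ?thesis .
  qed
  moreover have "0 < (g \<circ> ?A \<circ> inv g) x \<bullet> x" if "x \<noteq> 0" for x
  proof -
    have "inv g x \<noteq> 0" using that gg(1)[of x] linear_0[OF lg] by metis
    then show ?thesis using posdefD(3)[OF pd] by (simp add: gi)
  qed
  ultimately have "posdef (g \<circ> ?A \<circ> inv g)" by (simp add: posdef_def symmetric_op_def)
  then have "ellipsoid_root (lowner (g ` Q \<inter> decomposable l d)) = g \<circ> ?A \<circ> inv g"
    unfolding low by (rule ellipsoid_root_eqI)
  moreover have "inv (g \<circ> ?A \<circ> inv g) = g \<circ> ?B \<circ> inv g"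
    by (rule inv_unique_comp) (auto simp: gg tensor_map_inverse[OF card ab(1)] tensor_map_inverse[OF card ab(2)])
  ultimately show ?thesis
    unfolding lowner_retraction_def root ib by (simp add: image_image gg)
qed

section \<open>Continuity of the retraction, of the Loewner map and of the inverse\<close>

lemma body_near_Int_decomposable:
  fixes P Q :: "(real ^ 't) set"
  assumes "body_near t P Q" "0 < t"
  shows "body_near t (P \<inter> decomposable l d) (Q \<inter> decomposable l d)"
proof -
  have "A \<inter> decomposable l d \<subseteq> (*\<^sub>R) t ` (B \<inter> decomposable l d)" if sub: "A \<subseteq> (*\<^sub>R) t ` B" for A B :: "(real ^ 't) set"
  proof
    fix x assume x: "x \<in> A \<inter> decomposable l d"
    then obtain y where y: "y \<in> B" "x = t *\<^sub>R y" using sub by blast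
    have "x \<in> decomposable l d" using x by blast
    then have "(1 / t) *\<^sub>R x \<in> decomposable l d" by (rule decomposable_scaleR[OF card l d])
    then have "y \<in> decomposable l d" unfolding y(2) using assms(2) by simp
    then show "x \<in> (*\<^sub>R) t ` (B \<inter> decomposable l d)" using y by blast
  qed
  then show ?thesis using assms(1) by (simp add: body_near_def)
qed

lemma lowner_near:
  fixes s :: real
  assumes "1 < s"
  obtains t where "1 < t"
    "\<And>P Q :: (real ^ 't) set. P \<in> tensorial_bodies l d \<Longrightarrow> Q \<in> tensorial_bodies l d \<Longrightarrow> body_near t P Q \<Longrightarrow>
      body_near s (lowner (P \<inter> decomposable l d)) (lowner (Q \<inter> decomposable l d))"
proof (rule body_near_lowner[OF assms, where 'n = 't])
  fix t assume t: "1 < t" "\<And>T K T' K'. \<lbrakk>linear (T :: real ^ 't \<Rightarrow> real ^ 't); bij T; john K; linear (T' :: real ^ 't \<Rightarrow> real ^ 't); bij T'; john (K' :: (real ^ 't) set);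
    body_near t (T ` K) (T' ` K')\<rbrakk> \<Longrightarrow> body_near s (T ` cball 0 1) (T' ` cball 0 1)"
  show thesis
  proof (rule that[OF t(1)])
    fix P Q :: "(real ^ 't) set"
    assume P: "P \<in> tensorial_bodies l d" and Q: "Q \<in> tensorial_bodies l d" and near: "body_near t P Q"
    obtain a b where ab: "mats_id l d (mats_prod d a b)" "mats_id l d (mats_prod d b a)"
      and john: "john (tensor_map l d b ` (P \<inter> decomposable l d))"
      and low: "lowner (P \<inter> decomposable l d) = tensor_map l d a ` cball 0 1"
      by (rule lowner_tensorial[OF card l d P]) blast
    obtain a' b' where ab': "mats_id l d (mats_prod d a' b')" "mats_id l d (mats_prod d b' a')"
      and john': "john (tensor_map l d b' ` (Q \<inter> decomposable l d))"
      and low': "lowner (Q \<inter> decomposable l d) = tensor_map l d a' ` cball 0 1"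
      by (rule lowner_tensorial[OF card l d Q]) blast
    have "tensor_map l d a ` tensor_map l d b ` (P \<inter> decomposable l d) = P \<inter> decomposable l d"
      "tensor_map l d a' ` tensor_map l d b' ` (Q \<inter> decomposable l d) = Q \<inter> decomposable l d"
      by (simp_all add: image_image tensor_map_inverse[OF card ab(1)] tensor_map_inverse[OF card ab'(1)])
    then have "body_near t (tensor_map l d a ` tensor_map l d b ` (P \<inter> decomposable l d))
        (tensor_map l d a' ` tensor_map l d b' ` (Q \<inter> decomposable l d))"
      using body_near_Int_decomposable[OF near] t(1) by simp
    then show "body_near s (lowner (P \<inter> decomposable l d)) (lowner (Q \<inter> decomposable l d))"
      unfolding low low'
      by (rule t(2)[OF linear_tensor_map tensor_map_bij(1)[OF card ab] john
            linear_tensor_map tensor_map_bij(1)[OF card ab'] john'])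
  qed
qed

lemma ellipsoids_symmetric: "tensorial_ellipsoids l d \<subseteq> Collect symmetric_body"
  using tensorial_symmetric by (auto simp: tensorial_ellipsoids_def)

lemma lowner_position_symmetric: "lowner_position_bodies l d \<subseteq> Collect symmetric_body"
  using tensorial_symmetric by (auto simp: lowner_position_bodies_def)

lemma continuous_map_lowner:
  "continuous_map (subtopology hausdorff_topology (tensorial_bodies l d :: (real ^ 't) set set))
    (subtopology hausdorff_topology (tensorial_ellipsoids l d)) (\<lambda>Q. lowner (Q \<inter> decomposable l d))"
proof (rule continuous_map_body_nearI[OF tensorial_symmetric ellipsoids_symmetric])
  show "lowner (P \<inter> decomposable l d) \<in> tensorial_ellipsoids l d"
    if "P \<in> tensorial_bodies l d" for P :: "(real ^ 't) set"
    by (rule lowner_retraction_properties(3)[OF that])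
  fix P :: "(real ^ 't) set" and s :: real assume P: "P \<in> tensorial_bodies l d" and s: "1 < s"
  obtain t where "1 < t" "\<And>P Q :: (real ^ 't) set. P \<in> tensorial_bodies l d \<Longrightarrow> Q \<in> tensorial_bodies l d \<Longrightarrow>
      body_near t P Q \<Longrightarrow> body_near s (lowner (P \<inter> decomposable l d)) (lowner (Q \<inter> decomposable l d))"
    using lowner_near[OF s] by blast
  then show "\<exists>t>1. \<forall>Q\<in>tensorial_bodies l d. body_near t P Q \<longrightarrow>
      body_near s (lowner (P \<inter> decomposable l d)) (lowner (Q \<inter> decomposable l d))"
    using P by blast
qed

text \<open>The chain runs from R^-1 P through S^-1 P to S^-1 Q: first the root changes for a fixed
  body, then the body for a fixed map, at no loss. Each link receives sqrt s because constants
  multiply.\<close>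

lemma continuous_map_lowner_retraction:
  "continuous_map (subtopology hausdorff_topology (tensorial_bodies l d :: (real ^ 't) set set))
    (subtopology hausdorff_topology (lowner_position_bodies l d)) (lowner_retraction l d)"
proof (rule continuous_map_body_nearI[OF tensorial_symmetric lowner_position_symmetric])
  show "lowner_retraction l d P \<in> lowner_position_bodies l d"
    if "P \<in> tensorial_bodies l d" for P :: "(real ^ 't) set"
    by (rule lowner_retraction_properties(1)[OF that])
  fix P :: "(real ^ 't) set" and s :: real assume P: "P \<in> tensorial_bodies l d" and s: "1 < s"
  let ?tl = "\<lambda>Q :: (real ^ 't) set. lowner (Q \<inter> decomposable l d)"
  define R where "R = ellipsoid_root (?tl P)"
  have R: "posdef R" "?tl P = R ` cball 0 1"
    using lowner_retraction_properties(4,5)[OF P] by (simp_all add: R_def)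
  have sP: "symmetric_body P" using P tensorial_symmetric by blast
  have iR: "linear (inv R)" "bij (inv R)"
    using posdefD(2)[OF posdef_inv[OF R(1)]] posdef_bij[OF posdef_inv[OF R(1)]] by auto
  have P1: "symmetric_body (inv R ` P)" by (rule symmetric_body_linear_image[OF sP iR])
  have s1: "1 < sqrt s" "sqrt s * sqrt s = s" using s by simp_all
  obtain t1 where t1: "1 < t1" "\<And>S. posdef S \<Longrightarrow> body_near t1 (R ` cball 0 1) (S ` cball 0 1) \<Longrightarrow>
      body_near (sqrt s) (inv R ` P) ((inv R \<circ> S) ` inv R ` P) \<and> body_near (sqrt s) (inv R ` P) ((inv S \<circ> R) ` inv R ` P)"
    using body_near_posdef_quotient[OF R(1) P1 s1(1)] by blast
  obtain t2 where t2: "1 < t2" "\<And>P Q :: (real ^ 't) set. P \<in> tensorial_bodies l d \<Longrightarrow> Q \<in> tensorial_bodies l d \<Longrightarrow>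
      body_near t2 P Q \<Longrightarrow> body_near t1 (?tl P) (?tl Q)"
    using lowner_near[OF t1(1)] by blast
  have "body_near s (lowner_retraction l d P) (lowner_retraction l d Q)"
    if Q: "Q \<in> tensorial_bodies l d" and near: "body_near (min t2 (sqrt s)) P Q" for Q
  proof -
    define S where "S = ellipsoid_root (?tl Q)"
    have S: "posdef S" "?tl Q = S ` cball 0 1"
      using lowner_retraction_properties(4,5)[OF Q] by (simp_all add: S_def)
    have sQ: "symmetric_body Q" using Q tensorial_symmetric by blast
    have "body_near t2 P Q" "body_near (sqrt s) P Q"
      using body_near_mono[OF near sP sQ] t2(1) s1(1) by auto
    then have "body_near t1 (R ` cball 0 1) (S ` cball 0 1)" using t2(2)[OF P Q] R(2) S(2) by simp
    then have "body_near (sqrt s) (inv R ` P) ((inv S \<circ> R) ` inv R ` P)" using t1(2)[OF S(1)] by blast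
    moreover have "(inv S \<circ> R) ` inv R ` P = inv S ` P"
      using posdef_bij[OF R(1)] by (simp add: image_image bij_is_surj surj_f_inv_f)
    moreover have "body_near (sqrt s) (inv S ` P) (inv S ` Q)"
      by (rule body_near_linear_image[OF posdefD(2)[OF posdef_inv[OF S(1)]] \<open>body_near (sqrt s) P Q\<close>])
    ultimately have "body_near (sqrt s * sqrt s) (inv R ` P) (inv S ` Q)" using body_near_trans by metis
    then show ?thesis unfolding s1(2) lowner_retraction_def R_def S_def .
  qed
  moreover have "1 < min t2 (sqrt s)" using t2(1) s1(1) by simp
  ultimately show "\<exists>t>1. \<forall>Q\<in>tensorial_bodies l d. body_near t P Q \<longrightarrow>
      body_near s (lowner_retraction l d P) (lowner_retraction l d Q)"
    by blast
qed

text \<open>The same two-link argument, now through \<open>S\<close> applied to \<open>P\<close>,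
  with the first quotient of roots instead of its inverse.\<close>

lemma continuous_map_root_action:
  "continuous_map
    (prod_topology (subtopology hausdorff_topology (lowner_position_bodies l d :: (real ^ 't) set set))
      (subtopology hausdorff_topology (tensorial_ellipsoids l d)))
    (subtopology hausdorff_topology (tensorial_bodies l d)) (\<lambda>(P, E). ellipsoid_root E ` P)"
proof (rule continuous_map_prod_body_nearI[OF lowner_position_symmetric ellipsoids_symmetric tensorial_symmetric])
  fix P E :: "(real ^ 't) set"
  assume P: "P \<in> lowner_position_bodies l d" and E: "E \<in> tensorial_ellipsoids l d"
  show "(case (P, E) of (P, E) \<Rightarrow> ellipsoid_root E ` P) \<in> tensorial_bodies l d"
    using ellipsoid_root_action(1)[OF P E] by simp
  have rootE: "posdef (ellipsoid_root E) \<and> E = ellipsoid_root E ` cball 0 1"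
    if "E \<in> tensorial_ellipsoids l d" for E :: "(real ^ 't) set"
  proof -
    have "E \<in> tensorial_bodies l d" using that by (simp add: tensorial_ellipsoids_def)
    then show ?thesis
      using lowner_retraction_properties(4,5)[of E] tensorial_ellipsoid_lowner[OF card l d that] by simp
  qed
  fix s :: real assume s: "1 < s"
  define R where "R = ellipsoid_root E"
  have R: "posdef R" "E = R ` cball 0 1" using rootE[OF E] by (simp_all add: R_def)
  have sP: "symmetric_body P" "symmetric_body E" using P E lowner_position_symmetric ellipsoids_symmetric by blast+
  have s1: "1 < sqrt s" "sqrt s * sqrt s = s" using s by simp_all
  obtain t1 where t1: "1 < t1" "\<And>S. posdef S \<Longrightarrow> body_near t1 (R ` cball 0 1) (S ` cball 0 1) \<Longrightarrow>
      body_near (sqrt s) P ((inv R \<circ> S) ` P) \<and> body_near (sqrt s) P ((inv S \<circ> R) ` P)"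
    using body_near_posdef_quotient[OF R(1) sP(1) s1(1)] by blast
  have "body_near s (ellipsoid_root E ` P) (ellipsoid_root F ` Q)"
    if Q: "Q \<in> lowner_position_bodies l d" and F: "F \<in> tensorial_ellipsoids l d"
      and near: "body_near (min t1 (sqrt s)) P Q" "body_near (min t1 (sqrt s)) E F" for Q F
  proof -
    define S where "S = ellipsoid_root F"
    have S: "posdef S" "F = S ` cball 0 1" using rootE[OF F] by (simp_all add: S_def)
    have sQ: "symmetric_body Q" "symmetric_body F" using Q F lowner_position_symmetric ellipsoids_symmetric by blast+
    have PQ: "body_near (sqrt s) P Q" using body_near_mono[OF near(1) sP(1) sQ(1)] t1(1) s1(1) by simp
    have "body_near t1 E F" using body_near_mono[OF near(2) sP(2) sQ(2)] t1(1) s1(1) by simp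
    then have "body_near t1 (R ` cball 0 1) (S ` cball 0 1)" using R(2) S(2) by simp
    then have "body_near (sqrt s) P ((inv R \<circ> S) ` P)" using t1(2)[OF S(1)] by blast
    then have "body_near (sqrt s) (R ` P) (R ` (inv R \<circ> S) ` P)" by (rule body_near_linear_image[OF posdefD(2)[OF R(1)]])
    moreover have "R ` (inv R \<circ> S) ` P = S ` P"
      using posdef_bij[OF R(1)] by (simp add: image_image bij_is_surj surj_f_inv_f)
    moreover have "body_near (sqrt s) (S ` P) (S ` Q)" by (rule body_near_linear_image[OF posdefD(2)[OF S(1)] PQ])
    ultimately have "body_near (sqrt s * sqrt s) (R ` P) (S ` Q)" using body_near_trans by metis
    then show ?thesis unfolding s1(2) R_def S_def .
  qed
  moreover have "1 < min t1 (sqrt s)" using t1(1) s1(1) by simp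
  ultimately show "\<exists>t>1. \<forall>Q\<in>lowner_position_bodies l d. \<forall>F\<in>tensorial_ellipsoids l d.
      body_near t P Q \<longrightarrow> body_near t E F \<longrightarrow>
      body_near s (case (P, E) of (P, E) \<Rightarrow> ellipsoid_root E ` P) (case (Q, F) of (P, E) \<Rightarrow> ellipsoid_root E ` P)"
    unfolding prod.case by blast
qed

end

theorem corollary4p10:
  fixes l :: nat and d :: "nat \<Rightarrow> nat"
  assumes "l \<ge> 2" and "\<forall>i<l. d i \<ge> 2"
    and "CARD('t::finite) = (\<Prod>i<l. d i)"
  shows
    "(\<exists>r. retraction_maps
            (subtopology hausdorff_topology (tensorial_bodies l d :: (real ^ 't) set set))
            (subtopology hausdorff_topology (lowner_position_bodies l d)) r id \<and>
          (\<forall>g\<in>O_tensor l d. \<forall>P\<in>tensorial_bodies l d. r (g ` P) = g ` r P) \<and>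
          (\<forall>P\<in>tensorial_bodies l d. \<exists>T\<in>GL_tensor l d. r P = T ` P)) \<and>
     subtopology hausdorff_topology (tensorial_bodies l d :: (real ^ 't) set set)
       homeomorphic_space
     prod_topology
       (subtopology hausdorff_topology (lowner_position_bodies l d :: (real ^ 't) set set))
       (subtopology hausdorff_topology (tensorial_ellipsoids l d :: (real ^ 't) set set))"
proof -
  have l: "1 \<le> l" and d: "\<forall>i<l. 1 \<le> d i" using assms(1,2) by force+
  note ctx = assms(3) l d
  let ?B = "subtopology hausdorff_topology (tensorial_bodies l d :: (real ^ 't) set set)"
  let ?L = "subtopology hausdorff_topology (lowner_position_bodies l d :: (real ^ 't) set set)"
  let ?E = "subtopology hausdorff_topology (tensorial_ellipsoids l d :: (real ^ 't) set set)"
  let ?tl = "\<lambda>Q :: (real ^ 't) set. lowner (Q \<inter> decomposable l d)"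
  have topB: "topspace ?B = tensorial_bodies l d"
    by (rule topspace_subtopology_hausdorff[OF tensorial_symmetric[OF ctx]])
  have topL: "topspace ?L = lowner_position_bodies l d"
    by (rule topspace_subtopology_hausdorff[OF lowner_position_symmetric[OF ctx]])
  have topE: "topspace ?E = tensorial_ellipsoids l d"
    by (rule topspace_subtopology_hausdorff[OF ellipsoids_symmetric[OF ctx]])
  have "continuous_map ?L ?B id"
    by (rule continuous_map_body_nearI[OF lowner_position_symmetric[OF ctx] tensorial_symmetric[OF ctx]])
      (auto simp: lowner_position_bodies_def)
  then have retraction: "retraction_maps ?B ?L (lowner_retraction l d) id"
    unfolding retraction_maps_def topL
    using continuous_map_lowner_retraction[OF ctx] lowner_position_john(4)[OF ctx] by simp
  have homeo: "homeomorphic_maps ?B (prod_topology ?L ?E)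
      (\<lambda>Q. (lowner_retraction l d Q, ?tl Q)) (\<lambda>(P, E). ellipsoid_root E ` P)"
    unfolding homeomorphic_maps_def topspace_prod_topology topB topL topE
  proof (intro conjI ballI)
    show "continuous_map ?B (prod_topology ?L ?E) (\<lambda>Q. (lowner_retraction l d Q, ?tl Q))"
      by (intro continuous_map_pairedI continuous_map_lowner_retraction[OF ctx] continuous_map_lowner[OF ctx])
    show "continuous_map (prod_topology ?L ?E) ?B (\<lambda>(P, E). ellipsoid_root E ` P)"
      by (rule continuous_map_root_action[OF ctx])
    show "(case (lowner_retraction l d Q, ?tl Q) of (P, E) \<Rightarrow> ellipsoid_root E ` P) = Q"
      if "Q \<in> tensorial_bodies l d" for Q
      using lowner_retraction_properties(6)[OF ctx that] by simp
    fix z :: "(real ^ 't) set \<times> (real ^ 't) set"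
    assume "z \<in> lowner_position_bodies l d \<times> tensorial_ellipsoids l d"
    then obtain P E where z: "z = (P, E)" "P \<in> lowner_position_bodies l d" "E \<in> tensorial_ellipsoids l d" by blast
    show "(lowner_retraction l d (case z of (P, E) \<Rightarrow> ellipsoid_root E ` P), ?tl (case z of (P, E) \<Rightarrow> ellipsoid_root E ` P)) = z"
      using ellipsoid_root_action(2,3)[OF ctx z(2,3)] by (simp add: z(1))
  qed
  show ?thesis
  proof (intro conjI exI[of _ "lowner_retraction l d"] ballI)
    show "retraction_maps ?B ?L (lowner_retraction l d) id" by (rule retraction)
    show "lowner_retraction l d (g ` P) = g ` lowner_retraction l d P"
      if "g \<in> O_tensor l d" "P \<in> tensorial_bodies l d" for g and P :: "(real ^ 't) set"
      by (rule lowner_retraction_equivariant[OF ctx that])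
    show "\<exists>T\<in>GL_tensor l d. lowner_retraction l d P = T ` P"
      if "P \<in> tensorial_bodies l d" for P :: "(real ^ 't) set"
      by (rule lowner_retraction_properties(2)[OF ctx that])
    show "?B homeomorphic_space prod_topology ?L ?E"
      unfolding homeomorphic_space_def using homeo by (intro exI)
  qed
qed

end
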